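(* Let $G$ be a finite group, $N$ a normal subgroup of $G$, and $\theta$ an irreducible $G$-invariant character of $N$. Assume that all irreducible characters of $G$ lying above $\theta$ have pairwise distinct degrees. If $G/N$ is supersolvable, then $\theta$ is fully ramified in $G/N$.
   Context: Characters are complex. An irreducible character $\chi$ of $G$ lies above $\theta$ if $\theta$ is a constituent of the restriction $\chi_N$. A $G$-invariant irreducible character $\theta$ of $N$ is fully ramified in $G/N$ if there is exactly one irreducible character of $G$ lying above $\theta$ (equivalently, there is $\chi\in\operatorname{Irr}(G)$ with $\chi_N=e\theta$ and $e^2=|G:N|$). *)

theory Defs
  imports
    "HOL-Algebra.Elementary_Groups"
    "Jordan_Normal_Form.VS_Connect"
begin

text \<open>
  Characters of a group \<open>G\<close> are the traces of complex matrix representations of positive degree.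
  They are kept extensional on \<open>carrier G\<close>, so that equality of characters is equality of
  functions on \<open>carrier G\<close>. For a subgroup \<open>N\<close> the group itself is \<open>G\<lparr>carrier := N\<rparr>\<close>.
\<close>

definition mat_trace :: "complex mat \<Rightarrow> complex" where
  "mat_trace A = (\<Sum>i<dim_row A. A $$ (i, i))"

definition representation :: "('a, 'b) monoid_scheme \<Rightarrow> nat \<Rightarrow> ('a \<Rightarrow> complex mat) \<Rightarrow> bool" where
  "representation G n \<rho> \<longleftrightarrow> n > 0 \<and> \<rho> \<in> hom G (units_of (ring_mat TYPE(complex) n ()))"

definition irreducible_representation ::
    "('a, 'b) monoid_scheme \<Rightarrow> nat \<Rightarrow> ('a \<Rightarrow> complex mat) \<Rightarrow> bool" where
  "irreducible_representation G n \<rho> \<longleftrightarrow> representation G n \<rho> \<and>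
     (\<forall>W. VectorSpace.subspace class_ring W (module_vec TYPE(complex) n) \<and>
          (\<forall>g\<in>carrier G. \<forall>w\<in>W. \<rho> g *\<^sub>v w \<in> W) \<longrightarrow>
          W = {0\<^sub>v n} \<or> W = carrier_vec n)"

definition rep_character :: "('a, 'b) monoid_scheme \<Rightarrow> ('a \<Rightarrow> complex mat) \<Rightarrow> 'a \<Rightarrow> complex" where
  "rep_character G \<rho> = (\<lambda>g\<in>carrier G. mat_trace (\<rho> g))"

definition characters :: "('a, 'b) monoid_scheme \<Rightarrow> ('a \<Rightarrow> complex) set" where
  "characters G = {rep_character G \<rho> | n \<rho>. representation G n \<rho>}"

definition Irr :: "('a, 'b) monoid_scheme \<Rightarrow> ('a \<Rightarrow> complex) set" where
  "Irr G = {rep_character G \<rho> | n \<rho>. irreducible_representation G n \<rho>}"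

definition char_degree :: "('a, 'b) monoid_scheme \<Rightarrow> ('a \<Rightarrow> complex) \<Rightarrow> complex" where
  "char_degree G \<chi> = \<chi> \<one>\<^bsub>G\<^esub>"

text \<open>A character \<open>\<theta>\<close> is a constituent of \<open>\<chi>\<close> if \<open>\<chi> - \<theta>\<close> is zero or a character.\<close>

definition constituent :: "('a, 'b) monoid_scheme \<Rightarrow> ('a \<Rightarrow> complex) \<Rightarrow> ('a \<Rightarrow> complex) \<Rightarrow> bool" where
  "constituent G \<theta> \<chi> \<longleftrightarrow>
     (\<forall>g\<in>carrier G. \<chi> g = \<theta> g) \<or>
     (\<exists>\<psi>\<in>characters G. \<forall>g\<in>carrier G. \<chi> g = \<theta> g + \<psi> g)"

definition lies_above ::
    "('a, 'b) monoid_scheme \<Rightarrow> 'a set \<Rightarrow> ('a \<Rightarrow> complex) \<Rightarrow> ('a \<Rightarrow> complex) \<Rightarrow> bool" where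
  "lies_above G N \<chi> \<theta> \<longleftrightarrow> constituent (G\<lparr>carrier := N\<rparr>) \<theta> (restrict \<chi> N)"

definition Irr_above :: "('a, 'b) monoid_scheme \<Rightarrow> 'a set \<Rightarrow> ('a \<Rightarrow> complex) \<Rightarrow> ('a \<Rightarrow> complex) set" where
  "Irr_above G N \<theta> = {\<chi> \<in> Irr G. lies_above G N \<chi> \<theta>}"

definition invariant_character ::
    "('a, 'b) monoid_scheme \<Rightarrow> 'a set \<Rightarrow> ('a \<Rightarrow> complex) \<Rightarrow> bool" where
  "invariant_character G N \<theta> \<longleftrightarrow>
     (\<forall>g\<in>carrier G. \<forall>x\<in>N. \<theta> (g \<otimes>\<^bsub>G\<^esub> x \<otimes>\<^bsub>G\<^esub> inv\<^bsub>G\<^esub> g) = \<theta> x)"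

definition fully_ramified ::
    "('a, 'b) monoid_scheme \<Rightarrow> 'a set \<Rightarrow> ('a \<Rightarrow> complex) \<Rightarrow> bool" where
  "fully_ramified G N \<theta> \<longleftrightarrow>
     \<theta> \<in> Irr (G\<lparr>carrier := N\<rparr>) \<and> invariant_character G N \<theta> \<and> (\<exists>!\<chi>. \<chi> \<in> Irr_above G N \<theta>)"

text \<open>
  Supersolvability means a series from the trivial subgroup to the
  whole group with cyclic factors, where every term is normal in the whole group.
\<close>

inductive supersolvable_seq :: "('a, 'b) monoid_scheme \<Rightarrow> 'a set \<Rightarrow> bool" for G where
  unity: "supersolvable_seq G {\<one>\<^bsub>G\<^esub>}"
| extension: "\<lbrakk>supersolvable_seq G K; K \<subseteq> H; H \<lhd> G;
               cyclic_group ((G\<lparr>carrier := H\<rparr>) Mod K)\<rbrakk> \<Longrightarrow> supersolvable_seq G H"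

definition supersolvable :: "('a, 'b) monoid_scheme \<Rightarrow> bool" where
  "supersolvable G \<longleftrightarrow> supersolvable_seq G (carrier G)"

end

theory Submission
  imports
    Defs
    "Jordan_Normal_Form.Spectral_Radius"
    "HOL-Algebra.Sylow"
    "HOL-Algebra.Zassenhaus"
    "HOL-Number_Theory.Residue_Primitive_Roots"
begin

text \<open>
  If \<open>\<chi>\<close> lies above the invariant character \<open>\<theta>\<close>, then
  \<open>\<chi>\<^sub>N = e \<theta>\<close>, and the squares \<open>e\<^sup>2\<close> add up to \<open>|G : N|\<close>. The proof is by induction on \<open>|G : N|\<close>. A
  supersolvable quotient provides a normal subgroup \<open>M\<close> of \<open>G\<close> with \<open>|M : N| = p\<close> prime, and a prime is
  not a square, so \<open>\<theta>\<close> has exactly \<open>p\<close> extensions \<open>\<mu>\<^sup>i \<eta>\<close> to \<open>M\<close>, where \<open>\<mu>\<close> generates the linear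
  characters of \<open>M/N\<close> (\<open>prime_index_extensions\<close>). Let \<open>C\<close> be the centralizer of \<open>M/N\<close> in \<open>G\<close>. It acts on the
  exponents \<open>i\<close> by translations, while \<open>G/C\<close> is a subgroup of the cyclic group \<open>(\<int>/p)\<^sup>\<times>\<close>.

  If \<open>C\<close> moves \<open>\<eta>\<close>, all extensions are conjugate (\<open>transitive_above\<close>). Then the characters above \<open>\<theta>\<close> are
  those above \<open>\<eta>\<close>. By Clifford's correspondence they are induced from the stabilizer \<open>T\<close> of \<open>\<eta>\<close>, where
  degrees are divided by \<open>|G : T|\<close> and stay distinct, and the induction hypothesis for \<open>(T, M, \<eta>)\<close> applies.

  If \<open>C\<close> fixes \<open>\<eta>\<close>, a generator of the cyclic group \<open>G/C\<close> fixes some extension, which is then invariant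
  in \<open>G\<close> (\<open>exists_invariant_extension\<close>); call it \<open>\<eta>\<close> again. This case is contradictory
  (\<open>no_invariant_extension\<close>). The stabilizer of \<open>\<mu>\<eta>\<close> is \<open>C\<close>, so by induction there are single characters
  \<open>\<chi>\<^sub>0\<close> of \<open>G\<close> above \<open>\<eta>\<close> and \<open>\<psi>\<close> of \<open>C\<close> above \<open>\<mu>\<eta>\<close>, of degrees \<open>e \<eta>(1)\<close> and \<open>f \<eta>(1)\<close> with
  \<open>e\<^sup>2 = |G : M|\<close> and \<open>f\<^sup>2 = |C : M|\<close>. Let \<open>\<beta>\<close> be a character of \<open>C\<close> below \<open>\<chi>\<^sub>0\<close>, of degree \<open>b \<eta>(1)\<close>,
  with \<open>k\<close> conjugates. Counting degrees gives \<open>f\<^sup>2 = k b\<^sup>2\<close>. Suppose that a prime \<open>q\<close> divides \<open>k\<close>. As \<open>k\<close>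
  divides \<open>|G : C|\<close>, which divides \<open>p - 1\<close>, we have \<open>q \<noteq> p\<close>; hence for a Sylow \<open>q\<close>-subgroup \<open>P\<close> of \<open>C\<close>
  the linear character \<open>\<mu>\<close> extends to \<open>M P\<close>. Twisting \<open>\<beta>\<close> by the extension and inducing to \<open>C\<close> yields a multiple of
  \<open>\<psi>\<close>, so that \<open>f\<close> divides \<open>|C : M P| b\<close> and \<open>k\<close> divides \<open>|C : M P|\<^sup>2\<close>, which is prime to \<open>q\<close>. So \<open>k = 1\<close>
  and \<open>\<beta>\<close> is invariant in \<open>G\<close>. As \<open>G/C\<close> is cyclic, \<open>\<chi>\<^sub>0\<close> restricts to \<open>\<beta>\<close>
  (\<open>cyclic_quotient_multiplicity_one\<close>), and the degree count then forces \<open>G = C\<close>. But then \<open>\<chi>\<^sub>0\<close> and \<open>\<psi>\<close>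
  are two characters of the same degree above \<open>\<theta>\<close>.

  The character theory is built on the bilinear form \<open>[\<chi>, \<psi>] = |G|\<^sup>-\<^sup>1 \<Sum>\<^sub>g \<chi>(g) \<psi>(g\<inverse>)\<close>. Induced characters
  enter only through their degree, which comes from restricting the regular character (\<open>induction_degree\<close>).
\<close>

section \<open>Traces, invariant subspaces and Schur's lemma\<close>

lemma mat_trace_mult_comm:
  assumes A: "A \<in> carrier_mat n m" and B: "B \<in> carrier_mat m n"
  shows "mat_trace (A * B) = mat_trace (B * A)"
proof -
  have "mat_trace (A * B) = (\<Sum>i<n. \<Sum>j<m. A $$ (i, j) * B $$ (j, i))"
    using A B by (simp add: mat_trace_def scalar_prod_def atLeast0LessThan)
  also have "\<dots> = (\<Sum>j<m. \<Sum>i<n. B $$ (j, i) * A $$ (i, j))"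
    by (subst sum.swap) (simp add: mult.commute)
  also have "\<dots> = mat_trace (B * A)"
    using A B by (simp add: mat_trace_def scalar_prod_def atLeast0LessThan)
  finally show ?thesis .
qed

lemma mat_trace_one: "mat_trace (1\<^sub>m n) = of_nat n"
  by (simp add: mat_trace_def)

lemma subspace_vec_iff:
  "VectorSpace.subspace class_ring W (module_vec TYPE(complex) n) \<longleftrightarrow>
     W \<subseteq> carrier_vec n \<and> 0\<^sub>v n \<in> W \<and> (\<forall>v\<in>W. \<forall>w\<in>W. v + w \<in> W) \<and> (\<forall>c. \<forall>v\<in>W. c \<cdot>\<^sub>v v \<in> W)"
  using vec_vs[of n, where 'a = complex] vec_module[of n, where 'a = complex]
  unfolding VectorSpace.subspace_def LinearCombinations.submodule_def
  by (auto simp: module_vec_simps)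

lemma representationD:
  assumes "representation G n \<rho>"
  shows "n > 0" and "\<And>g. g \<in> carrier G \<Longrightarrow> \<rho> g \<in> carrier_mat n n"
    and "\<And>g h. g \<in> carrier G \<Longrightarrow> h \<in> carrier G \<Longrightarrow> \<rho> (g \<otimes>\<^bsub>G\<^esub> h) = \<rho> g * \<rho> h"
  using assms unfolding representation_def hom_def units_of_def Units_def
  by (auto simp: ring_mat_simps)

lemma representation_one:
  assumes "group G" and "representation G n \<rho>"
  shows "\<rho> \<one>\<^bsub>G\<^esub> = 1\<^sub>m n"
proof -
  interpret R: ring "ring_mat TYPE(complex) n ()" by (rule ring_mat)
  have "group_hom G (units_of (ring_mat TYPE(complex) n ())) \<rho>"
    using assms R.units_group unfolding representation_def group_hom_def group_hom_axioms_def by auto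
  from group_hom.hom_one[OF this] show ?thesis by (simp add: units_of_def ring_mat_simps)
qed

lemma representation_inv:
  assumes "group G" and "representation G n \<rho>" and "g \<in> carrier G"
  shows "\<rho> g * \<rho> (inv\<^bsub>G\<^esub> g) = 1\<^sub>m n" and "\<rho> (inv\<^bsub>G\<^esub> g) * \<rho> g = 1\<^sub>m n"
proof -
  interpret group G by fact
  show "\<rho> g * \<rho> (inv\<^bsub>G\<^esub> g) = 1\<^sub>m n" "\<rho> (inv\<^bsub>G\<^esub> g) * \<rho> g = 1\<^sub>m n"
    using representationD(3)[OF assms(2), symmetric] assms representation_one[OF assms(1,2)]
    by simp_all
qed

lemma representationI:
  assumes "group G" and "n > 0" and c: "\<And>g. g \<in> carrier G \<Longrightarrow> \<rho> g \<in> carrier_mat n n"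
    and m: "\<And>g h. g \<in> carrier G \<Longrightarrow> h \<in> carrier G \<Longrightarrow> \<rho> (g \<otimes>\<^bsub>G\<^esub> h) = \<rho> g * \<rho> h"
    and one: "\<rho> \<one>\<^bsub>G\<^esub> = 1\<^sub>m n"
  shows "representation G n \<rho>"
proof -
  interpret group G by fact
  have "\<rho> g \<in> Units (ring_mat TYPE(complex) n ())" if g: "g \<in> carrier G" for g
  proof -
    have "\<rho> (inv\<^bsub>G\<^esub> g) * \<rho> g = 1\<^sub>m n" "\<rho> g * \<rho> (inv\<^bsub>G\<^esub> g) = 1\<^sub>m n"
      using m[symmetric] one g by simp_all
    then show ?thesis using c g unfolding Units_def by (auto simp: ring_mat_simps)
  qed
  then show ?thesis using m \<open>n > 0\<close>
    unfolding representation_def hom_def units_of_def by (auto simp: ring_mat_simps)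
qed

lemma irreducible_representationD:
  assumes "irreducible_representation G n \<rho>"
  shows "representation G n \<rho>"
    and "\<lbrakk>W \<subseteq> carrier_vec n; 0\<^sub>v n \<in> W; \<And>v w. v \<in> W \<Longrightarrow> w \<in> W \<Longrightarrow> v + w \<in> W;
          \<And>c v. v \<in> W \<Longrightarrow> c \<cdot>\<^sub>v v \<in> W; \<And>g v. g \<in> carrier G \<Longrightarrow> v \<in> W \<Longrightarrow> \<rho> g *\<^sub>v v \<in> W\<rbrakk>
         \<Longrightarrow> W = {0\<^sub>v n} \<or> W = carrier_vec n"
  using assms unfolding irreducible_representation_def subspace_vec_iff by auto

lemma nonzero_mat_vec:
  assumes X: "(X :: complex mat) \<in> carrier_mat r n" and "X \<noteq> 0\<^sub>m r n"
  shows "\<exists>v\<in>carrier_vec n. X *\<^sub>v v \<noteq> 0\<^sub>v r"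
proof (rule ccontr)
  assume z: "\<not> ?thesis"
  have "X = 0\<^sub>m r n"
  proof (rule eq_matI)
    fix i j assume ij: "i < dim_row (0\<^sub>m r n :: complex mat)" "j < dim_col (0\<^sub>m r n :: complex mat)"
    have "X *\<^sub>v unit_vec n j = 0\<^sub>v r" using z by auto
    moreover have "(X *\<^sub>v unit_vec n j) $ i = X $$ (i, j)" using X ij by simp
    ultimately show "X $$ (i, j) = 0\<^sub>m r n $$ (i, j)" using ij by simp
  qed (use X in auto)
  with assms show False by simp
qed

text \<open>
  The two halves of Schur's lemma: the range of \<open>X\<close> is an invariant subspace, hence everything, and
  the kernel is an invariant subspace, hence zero.
\<close>

lemma irreducible_target_right_inverse:
  assumes irr: "irreducible_representation G r \<rho>"
    and X: "X \<in> carrier_mat r n" "X \<noteq> 0\<^sub>m r n"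
    and inv: "\<And>g. g \<in> carrier G \<Longrightarrow> \<exists>B\<in>carrier_mat n n. \<rho> g * X = X * B"
  shows "\<exists>Z\<in>carrier_mat n r. X * Z = 1\<^sub>m r"
proof -
  let ?W = "(\<lambda>v. X *\<^sub>v v) ` carrier_vec n"
  note D = irreducible_representationD[OF irr]
  note c = representationD(2)[OF D(1)]
  have "?W = {0\<^sub>v r} \<or> ?W = carrier_vec r"
  proof (rule D(2))
    show "?W \<subseteq> carrier_vec r" using X by auto
    show "0\<^sub>v r \<in> ?W" by (rule image_eqI[of _ _ "0\<^sub>v n"]) (use X in auto)
    show "v + w \<in> ?W" if vw: "v \<in> ?W" "w \<in> ?W" for v w
    proof -
      obtain a b where ab: "a \<in> carrier_vec n" "b \<in> carrier_vec n" "v = X *\<^sub>v a" "w = X *\<^sub>v b"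
        using vw by auto
      then show ?thesis
        by (intro image_eqI[of _ _ "a + b"]) (simp_all add: mult_add_distrib_mat_vec[OF X(1)])
    qed
    show "k \<cdot>\<^sub>v v \<in> ?W" if v: "v \<in> ?W" for k v
    proof -
      obtain a where "a \<in> carrier_vec n" "v = X *\<^sub>v a" using v by auto
      then show ?thesis by (intro image_eqI[of _ _ "k \<cdot>\<^sub>v a"]) (simp_all add: mult_mat_vec[OF X(1)])
    qed
    show "\<rho> g *\<^sub>v v \<in> ?W" if g: "g \<in> carrier G" and v: "v \<in> ?W" for g v
    proof -
      obtain a where a: "a \<in> carrier_vec n" "v = X *\<^sub>v a" using v by auto
      obtain B where B: "B \<in> carrier_mat n n" "\<rho> g * X = X * B" using inv[OF g] by auto
      have "\<rho> g *\<^sub>v v = (\<rho> g * X) *\<^sub>v a" using assoc_mult_mat_vec[OF c[OF g] X(1) a(1)] a by simp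
      also have "\<dots> = X *\<^sub>v (B *\<^sub>v a)" using B assoc_mult_mat_vec[OF X(1) B(1) a(1)] by simp
      finally show ?thesis using B a by auto
    qed
  qed
  moreover obtain v where "v \<in> carrier_vec n" "X *\<^sub>v v \<noteq> 0\<^sub>v r" using nonzero_mat_vec[OF X] by auto
  ultimately have W: "?W = carrier_vec r" by blast
  have "\<forall>j. \<exists>v. v \<in> carrier_vec n \<and> X *\<^sub>v v = unit_vec r j"
  proof
    fix j
    have "unit_vec r j \<in> ?W" unfolding W by simp
    then show "\<exists>v. v \<in> carrier_vec n \<and> X *\<^sub>v v = unit_vec r j" by auto
  qed
  then obtain z where z: "\<And>j. z j \<in> carrier_vec n" "\<And>j. X *\<^sub>v z j = unit_vec r j" by metis
  define Z where "Z = mat n r (\<lambda>(i, j). z j $ i)"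
  have col: "col Z j = z j" if "j < r" for j using z(1)[of j] that unfolding Z_def by (intro eq_vecI) auto
  have "X * Z = 1\<^sub>m r"
  proof (rule eq_matI)
    fix i j assume ij: "i < dim_row (1\<^sub>m r :: complex mat)" "j < dim_col (1\<^sub>m r :: complex mat)"
    have "(X * Z) $$ (i, j) = (X *\<^sub>v col Z j) $ i" using ij X by (simp add: Z_def)
    also have "\<dots> = 1\<^sub>m r $$ (i, j)" using ij z(2)[of j] col by simp
    finally show "(X * Z) $$ (i, j) = 1\<^sub>m r $$ (i, j)" .
  qed (use X in \<open>auto simp: Z_def\<close>)
  then show ?thesis by (intro bexI[of _ Z]) (auto simp: Z_def)
qed

lemma irreducible_source_injective:
  assumes irr: "irreducible_representation G n \<rho>"
    and X: "X \<in> carrier_mat r n" "X \<noteq> 0\<^sub>m r n"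
    and inv: "\<And>g. g \<in> carrier G \<Longrightarrow> \<exists>B\<in>carrier_mat r r. X * \<rho> g = B * X"
    and v: "v \<in> carrier_vec n" "X *\<^sub>v v = 0\<^sub>v r"
  shows "v = 0\<^sub>v n"
proof -
  let ?W = "{v \<in> carrier_vec n. X *\<^sub>v v = 0\<^sub>v r}"
  note D = irreducible_representationD[OF irr]
  note c = representationD(2)[OF D(1)]
  have "?W = {0\<^sub>v n} \<or> ?W = carrier_vec n"
  proof (rule D(2))
    show "?W \<subseteq> carrier_vec n" by auto
    show "0\<^sub>v n \<in> ?W" using X by auto
    show "v + w \<in> ?W" if "v \<in> ?W" "w \<in> ?W" for v w
      using that by (simp add: mult_add_distrib_mat_vec[OF X(1)])
    show "k \<cdot>\<^sub>v v \<in> ?W" if "v \<in> ?W" for k v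
    proof -
      have "k \<cdot>\<^sub>v 0\<^sub>v r = (0\<^sub>v r :: complex vec)" by (intro eq_vecI) auto
      then show ?thesis using that by (simp add: mult_mat_vec[OF X(1)])
    qed
    show "\<rho> g *\<^sub>v w \<in> ?W" if g: "g \<in> carrier G" and w: "w \<in> ?W" for g w
    proof -
      obtain B where B: "B \<in> carrier_mat r r" "X * \<rho> g = B * X" using inv[OF g] by auto
      have w': "w \<in> carrier_vec n" "X *\<^sub>v w = 0\<^sub>v r" using w by auto
      have "X *\<^sub>v (\<rho> g *\<^sub>v w) = B *\<^sub>v (X *\<^sub>v w)"
        using assoc_mult_mat_vec[OF X(1) c[OF g] w'(1)] assoc_mult_mat_vec[OF B(1) X(1) w'(1)] B by simp
      also have "\<dots> = 0\<^sub>v r" unfolding w'(2) using B(1) by (intro eq_vecI) auto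
      finally show ?thesis using w' c[OF g] by simp
    qed
  qed
  moreover obtain w where "w \<in> carrier_vec n" "X *\<^sub>v w \<noteq> 0\<^sub>v r" using nonzero_mat_vec[OF X] by auto
  ultimately show ?thesis using v by blast
qed

lemma injective_right_inverse_left_inverse:
  assumes X: "(X :: complex mat) \<in> carrier_mat r n" and Z: "Z \<in> carrier_mat n r" "X * Z = 1\<^sub>m r"
    and inj: "\<And>v. v \<in> carrier_vec n \<Longrightarrow> X *\<^sub>v v = 0\<^sub>v r \<Longrightarrow> v = 0\<^sub>v n"
  shows "Z * X = 1\<^sub>m n"
proof -
  have "X * (Z * X - 1\<^sub>m n) = X * (Z * X) - X * 1\<^sub>m n"
    using X Z by (intro mult_minus_distrib_mat) auto
  also have "X * (Z * X) = X" using X Z by (subst assoc_mult_mat[symmetric, of _ r n _ r _ n]) auto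
  finally have e: "X * (Z * X - 1\<^sub>m n) = 0\<^sub>m r n" using X by auto
  have "Z * X - 1\<^sub>m n = 0\<^sub>m n n"
  proof (rule ccontr)
    assume "Z * X - 1\<^sub>m n \<noteq> 0\<^sub>m n n"
    moreover have c: "Z * X - 1\<^sub>m n \<in> carrier_mat n n" using X Z by auto
    ultimately obtain v where v: "v \<in> carrier_vec n" "(Z * X - 1\<^sub>m n) *\<^sub>v v \<noteq> 0\<^sub>v n"
      using nonzero_mat_vec by blast
    have w: "(Z * X - 1\<^sub>m n) *\<^sub>v v \<in> carrier_vec n" using c v by auto
    have "X *\<^sub>v ((Z * X - 1\<^sub>m n) *\<^sub>v v) = 0\<^sub>m r n *\<^sub>v v"
      using assoc_mult_mat_vec[OF X c v(1)] e by simp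
    also have "\<dots> = 0\<^sub>v r" using v by auto
    finally show False using inj[OF w] v by auto
  qed
  then have ij: "(Z * X - 1\<^sub>m n) $$ (i, j) = 0" if "i < n" "j < n" for i j using that by simp
  show ?thesis
  proof (rule eq_matI)
    fix i j assume "i < dim_row (1\<^sub>m n :: complex mat)" "j < dim_col (1\<^sub>m n :: complex mat)"
    then show "(Z * X) $$ (i, j) = 1\<^sub>m n $$ (i, j)" using ij[of i j] X Z by auto
  qed (use X Z in auto)
qed

lemma intertwined_traces:
  assumes R: "R \<in> carrier_mat r r" and S: "S \<in> carrier_mat n n" and X: "X \<in> carrier_mat r n"
    and Z: "Z \<in> carrier_mat n r" "X * Z = 1\<^sub>m r" "Z * X = 1\<^sub>m n" and i: "R * X = X * S"
  shows "mat_trace R = mat_trace S"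
proof -
  have "mat_trace R = mat_trace (R * (X * Z))" using R Z by simp
  also have "R * (X * Z) = X * S * Z" using assoc_mult_mat[OF R X Z(1)] i by simp
  also have "mat_trace \<dots> = mat_trace (Z * (X * S))" using X Z S by (intro mat_trace_mult_comm) auto
  also have "Z * (X * S) = S" using assoc_mult_mat[OF Z(1) X S] Z S by simp
  finally show ?thesis .
qed

lemma schur_scalar:
  assumes irr: "irreducible_representation G n \<rho>" and A: "A \<in> carrier_mat n n"
    and comm: "\<And>g. g \<in> carrier G \<Longrightarrow> \<rho> g * A = A * \<rho> g"
  shows "\<exists>c. A = c \<cdot>\<^sub>m 1\<^sub>m n"
proof -
  note D = irreducible_representationD[OF irr]
  note c = representationD(2)[OF D(1)]
  have n: "n > 0" using representationD(1)[OF D(1)] .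
  obtain k where "k \<in> spectrum A" using spectrum_non_empty[OF A n] by auto
  then obtain v where v: "v \<in> carrier_vec n" "v \<noteq> 0\<^sub>v n" "A *\<^sub>v v = k \<cdot>\<^sub>v v"
    using A unfolding spectrum_def eigenvalue_def eigenvector_def by auto
  let ?X = "A - k \<cdot>\<^sub>m 1\<^sub>m n"
  have X: "?X \<in> carrier_mat n n" using A by auto
  have "?X = 0\<^sub>m n n"
  proof (rule ccontr)
    assume nz: "?X \<noteq> 0\<^sub>m n n"
    have "?X * \<rho> g = \<rho> g * ?X" if g: "g \<in> carrier G" for g
    proof -
      have "?X * \<rho> g = A * \<rho> g - k \<cdot>\<^sub>m \<rho> g" using A c[OF g] by (subst minus_mult_distrib_mat) auto
      also have "\<dots> = \<rho> g * ?X" using A c[OF g] comm[OF g] by (subst mult_minus_distrib_mat) auto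
      finally show ?thesis .
    qed
    then have "\<exists>B\<in>carrier_mat n n. ?X * \<rho> g = B * ?X" if "g \<in> carrier G" for g using c that by auto
    moreover have "?X *\<^sub>v v = 0\<^sub>v n"
    proof -
      have "?X *\<^sub>v v = A *\<^sub>v v - (k \<cdot>\<^sub>m 1\<^sub>m n) *\<^sub>v v"
        using A v by (intro minus_mult_distrib_mat_vec) auto
      also have "(k \<cdot>\<^sub>m 1\<^sub>m n) *\<^sub>v v = k \<cdot>\<^sub>v v"
      proof (rule eq_vecI)
        fix i assume i: "i < dim_vec (k \<cdot>\<^sub>v v)"
        then have i': "i < n" using v by simp
        have "((k \<cdot>\<^sub>m 1\<^sub>m n) *\<^sub>v v) $ i = (\<Sum>j = 0..<n. k * (if j = i then 1 else 0) * v $ j)"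
          using i' v by (auto simp: scalar_prod_def)
        also have "\<dots> = (\<Sum>j = 0..<n. if j = i then k * v $ j else 0)"
          by (rule sum.cong) auto
        also have "\<dots> = (k \<cdot>\<^sub>v v) $ i" using i' v by simp
        finally show "((k \<cdot>\<^sub>m 1\<^sub>m n) *\<^sub>v v) $ i = (k \<cdot>\<^sub>v v) $ i" .
      qed (use v in auto)
      finally show ?thesis using v by auto
    qed
    ultimately have "v = 0\<^sub>v n" using irreducible_source_injective[OF irr X nz _ v(1)] by blast
    with v show False by simp
  qed
  then have z: "?X $$ (i, j) = 0" if "i < n" "j < n" for i j using that by simp
  have "A = k \<cdot>\<^sub>m 1\<^sub>m n"
  proof (rule eq_matI)
    fix i j assume "i < dim_row (k \<cdot>\<^sub>m 1\<^sub>m n :: complex mat)" "j < dim_col (k \<cdot>\<^sub>m 1\<^sub>m n :: complex mat)"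
    then show "A $$ (i, j) = (k \<cdot>\<^sub>m 1\<^sub>m n) $$ (i, j)" using z[of i j] A by auto
  qed (use A in auto)
  then show ?thesis by blast
qed

section \<open>Orthogonality of irreducible characters\<close>

text \<open>
  With \<open>h(x\<inverse>)\<close> in place of the complex conjugate of \<open>h(x)\<close> the form is bilinear. On characters it is the
  usual inner product.
\<close>

definition char_prod :: "('a, 'b) monoid_scheme \<Rightarrow> ('a \<Rightarrow> complex) \<Rightarrow> ('a \<Rightarrow> complex) \<Rightarrow> complex" where
  "char_prod G f h = (\<Sum>x\<in>carrier G. f x * h (inv\<^bsub>G\<^esub> x)) / of_nat (card (carrier G))"

locale finite_group = group G for G :: "('a, 'b) monoid_scheme" (structure) +
  assumes fin: "finite (carrier G)"
begin

lemma card_pos: "card (carrier G) > 0"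
  using fin one_closed by (auto simp: card_gt_0_iff)

lemma sum_left_translate:
  assumes "h \<in> carrier G"
  shows "(\<Sum>g\<in>carrier G. F (h \<otimes> g)) = (\<Sum>g\<in>carrier G. F g)"
  by (rule sum.reindex_bij_witness[of _ "\<lambda>g. inv h \<otimes> g" "\<lambda>g. h \<otimes> g"])
     (use assms in \<open>auto simp: m_assoc[symmetric]\<close>)

lemma sum_right_translate:
  assumes "h \<in> carrier G"
  shows "(\<Sum>g\<in>carrier G. F (g \<otimes> h)) = (\<Sum>g\<in>carrier G. F g)"
  by (rule sum.reindex_bij_witness[of _ "\<lambda>g. g \<otimes> inv h" "\<lambda>g. g \<otimes> h"])
     (use assms in \<open>auto simp: m_assoc\<close>)

lemma sum_conjugate:
  assumes "h \<in> carrier G"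
  shows "(\<Sum>g\<in>carrier G. F (h \<otimes> g \<otimes> inv h)) = (\<Sum>g\<in>carrier G. F g)"
  using sum_left_translate[OF assms, of "\<lambda>g. F (g \<otimes> inv h)"] sum_right_translate[of "inv h" F] assms
  by simp

lemma sum_inverse: "(\<Sum>g\<in>carrier G. F (inv g)) = (\<Sum>g\<in>carrier G. F g)"
  by (rule sum.reindex_bij_witness[of _ "\<lambda>g. inv g" "\<lambda>g. inv g"]) auto

lemma char_prod_commute: "char_prod G f h = char_prod G h f"
  using sum_inverse[of "\<lambda>x. f x * h (inv x)"] by (simp add: char_prod_def mult.commute)

text \<open>
  Averaging the matrix unit \<open>E\<^sub>k\<^sub>l\<close> over the group, \<open>\<Sum>\<^sub>g R g E\<^sub>k\<^sub>l S (g\<inverse>)\<close>, written out in coordinates.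
\<close>

definition average :: "nat \<Rightarrow> nat \<Rightarrow> ('a \<Rightarrow> complex mat) \<Rightarrow> ('a \<Rightarrow> complex mat) \<Rightarrow> nat \<Rightarrow> nat \<Rightarrow> complex mat" where
  "average r n R S k l = mat r n (\<lambda>(i, j). \<Sum>g\<in>carrier G. R g $$ (i, k) * S (inv g) $$ (l, j))"

lemma average_carrier: "average r n R S k l \<in> carrier_mat r n"
  by (simp add: average_def)

lemma average_intertwines:
  assumes R: "representation G r R" and S: "representation G n S" and kl: "k < r" "l < n"
    and h: "h \<in> carrier G"
  shows "R h * average r n R S k l = average r n R S k l * S h"
proof (rule eq_matI)
  let ?X = "average r n R S k l"
  note R' = representationD[OF R] and S' = representationD[OF S]
  fix i j assume "i < dim_row (?X * S h)" "j < dim_col (?X * S h)"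
  then have ij: "i < r" "j < n" using S'(2)[OF h] by (auto simp: average_def)
  have ent: "(A * B) $$ (a, b) = (\<Sum>c<q. A $$ (a, c) * B $$ (c, b))"
    if "A \<in> carrier_mat p q" "B \<in> carrier_mat q s" "a < p" "b < s"
    for A B :: "complex mat" and a b p q s
    using that by (simp add: scalar_prod_def atLeast0LessThan)
  have "(R h * ?X) $$ (i, j) = (\<Sum>a<r. R h $$ (i, a) * (\<Sum>g\<in>carrier G. R g $$ (a, k) * S (inv g) $$ (l, j)))"
    using ij R'(2)[OF h] by (subst ent[of _ r r _ n]) (auto simp: average_def)
  also have "\<dots> = (\<Sum>g\<in>carrier G. (\<Sum>a<r. R h $$ (i, a) * R g $$ (a, k)) * S (inv g) $$ (l, j))"
    by (simp add: sum_distrib_left sum_distrib_right mult.assoc) (rule sum.swap)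
  also have "\<dots> = (\<Sum>g\<in>carrier G. R (h \<otimes> g) $$ (i, k) * S (inv (h \<otimes> g) \<otimes> h) $$ (l, j))"
  proof (rule sum.cong[OF refl])
    fix g assume g: "g \<in> carrier G"
    have "inv (h \<otimes> g) \<otimes> h = inv g" using g h by (simp add: inv_mult_group m_assoc)
    then show "(\<Sum>a<r. R h $$ (i, a) * R g $$ (a, k)) * S (inv g) $$ (l, j) =
      R (h \<otimes> g) $$ (i, k) * S (inv (h \<otimes> g) \<otimes> h) $$ (l, j)"
      using R'(3)[OF h g] ent[OF R'(2)[OF h] R'(2)[OF g], of i k] ij kl by simp
  qed
  also have "\<dots> = (\<Sum>g\<in>carrier G. R g $$ (i, k) * S (inv g \<otimes> h) $$ (l, j))"
    by (rule sum_left_translate[OF h])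
  also have "\<dots> = (\<Sum>g\<in>carrier G. R g $$ (i, k) * (\<Sum>a<n. S (inv g) $$ (l, a) * S h $$ (a, j)))"
  proof (rule sum.cong[OF refl])
    fix g assume g: "g \<in> carrier G"
    then show "R g $$ (i, k) * S (inv g \<otimes> h) $$ (l, j) =
       R g $$ (i, k) * (\<Sum>a<n. S (inv g) $$ (l, a) * S h $$ (a, j))"
      using S'(3)[of "inv g" h] ent[OF S'(2)[of "inv g"] S'(2)[OF h], of l j] ij kl h by simp
  qed
  also have "\<dots> = (\<Sum>a<n. (\<Sum>g\<in>carrier G. R g $$ (i, k) * S (inv g) $$ (l, a)) * S h $$ (a, j))"
    by (simp add: sum_distrib_left sum_distrib_right mult.assoc) (rule sum.swap)
  also have "\<dots> = (?X * S h) $$ (i, j)"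
    using ij S'(2)[OF h] by (subst ent[of _ r n _ n]) (auto simp: average_def)
  finally show "(R h * ?X) $$ (i, j) = (?X * S h) $$ (i, j)" .
qed (use representationD(2)[OF R h] representationD(2)[OF S h] in \<open>auto simp: average_def\<close>)

lemma char_sum_eq_average:
  assumes R: "representation G r R" and S: "representation G n S"
  shows "(\<Sum>g\<in>carrier G. mat_trace (R g) * mat_trace (S (inv g))) =
    (\<Sum>k<r. \<Sum>l<n. average r n R S k l $$ (k, l))"
proof -
  have "(\<Sum>g\<in>carrier G. mat_trace (R g) * mat_trace (S (inv g))) =
    (\<Sum>g\<in>carrier G. \<Sum>k<r. \<Sum>l<n. R g $$ (k, k) * S (inv g) $$ (l, l))"
  proof (rule sum.cong[OF refl])
    fix g assume g: "g \<in> carrier G"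
    show "mat_trace (R g) * mat_trace (S (inv g)) = (\<Sum>k<r. \<Sum>l<n. R g $$ (k, k) * S (inv g) $$ (l, l))"
      using representationD(2)[OF R g] representationD(2)[OF S, of "inv g"] g
      by (simp add: mat_trace_def sum_product)
  qed
  also have "\<dots> = (\<Sum>k<r. \<Sum>g\<in>carrier G. \<Sum>l<n. R g $$ (k, k) * S (inv g) $$ (l, l))"
    by (rule sum.swap)
  also have "\<dots> = (\<Sum>k<r. \<Sum>l<n. \<Sum>g\<in>carrier G. R g $$ (k, k) * S (inv g) $$ (l, l))"
    by (intro sum.cong[OF refl] sum.swap)
  also have "\<dots> = (\<Sum>k<r. \<Sum>l<n. average r n R S k l $$ (k, l))"
    by (simp add: average_def)
  finally show ?thesis .
qed

text \<open>
  The product of two characters is a sum of entries of averaged matrix units, so it can be nonzero only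
  if one of these intertwiners is.
\<close>

lemma nonzero_intertwiner_exists:
  assumes R: "representation G r R" and S: "representation G n S"
    and nz: "char_prod G (rep_character G R) (rep_character G S) \<noteq> 0"
  shows "\<exists>X\<in>carrier_mat r n. X \<noteq> 0\<^sub>m r n \<and> (\<forall>g\<in>carrier G. R g * X = X * S g)"
proof -
  have "(\<Sum>k<r. \<Sum>l<n. average r n R S k l $$ (k, l)) \<noteq> 0"
    using nz char_sum_eq_average[OF R S] by (auto simp: char_prod_def rep_character_def)
  then obtain k where k: "k < r" "(\<Sum>l<n. average r n R S k l $$ (k, l)) \<noteq> 0"
    by (meson lessThan_iff sum.not_neutral_contains_not_neutral)
  then obtain l where l: "l < n" "average r n R S k l $$ (k, l) \<noteq> 0"
    by (meson lessThan_iff sum.not_neutral_contains_not_neutral)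
  then have "average r n R S k l \<noteq> 0\<^sub>m r n" using k by auto
  then show ?thesis using average_intertwines[OF R S k(1) l(1)] average_carrier by blast
qed

lemma irreducible_intertwiner_invertible:
  assumes R: "irreducible_representation G r R" and S: "irreducible_representation G n S"
    and X: "X \<in> carrier_mat r n" "X \<noteq> 0\<^sub>m r n" "\<And>g. g \<in> carrier G \<Longrightarrow> R g * X = X * S g"
  shows "\<exists>Z\<in>carrier_mat n r. X * Z = 1\<^sub>m r \<and> Z * X = 1\<^sub>m n"
proof -
  note R' = representationD(2)[OF irreducible_representationD(1)[OF R]]
  note S' = representationD(2)[OF irreducible_representationD(1)[OF S]]
  obtain Z where Z: "Z \<in> carrier_mat n r" "X * Z = 1\<^sub>m r"
    using irreducible_target_right_inverse[OF R X(1,2)] X(3) S' by metis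
  have "Z * X = 1\<^sub>m n"
  proof (rule injective_right_inverse_left_inverse[OF X(1) Z])
    show "v = 0\<^sub>v n" if "v \<in> carrier_vec n" "X *\<^sub>v v = 0\<^sub>v r" for v
      using irreducible_source_injective[OF S X(1,2) _ that] X(3)[symmetric] R' by metis
  qed
  with Z show ?thesis by blast
qed

lemma irreducible_characters_eq:
  assumes R: "irreducible_representation G r R" and S: "irreducible_representation G n S"
    and nz: "char_prod G (rep_character G R) (rep_character G S) \<noteq> 0"
  shows "rep_character G R = rep_character G S"
proof -
  note Rr = irreducible_representationD(1)[OF R] and Sr = irreducible_representationD(1)[OF S]
  obtain X where X: "X \<in> carrier_mat r n" "X \<noteq> 0\<^sub>m r n" "\<And>g. g \<in> carrier G \<Longrightarrow> R g * X = X * S g"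
    using nonzero_intertwiner_exists[OF Rr Sr nz] by blast
  obtain Z where Z: "Z \<in> carrier_mat n r" "X * Z = 1\<^sub>m r" "Z * X = 1\<^sub>m n"
    using irreducible_intertwiner_invertible[OF R S X] by blast
  show ?thesis
    unfolding rep_character_def
    using intertwined_traces[OF representationD(2)[OF Rr] representationD(2)[OF Sr] X(1) Z X(3)]
    by (intro restrict_ext) auto
qed

text \<open>Schur's orthogonality relations for the matrix entries of one irreducible representation.\<close>

lemma average_entries:
  assumes R: "irreducible_representation G n R" and kl: "k < n" "l < n" and ij: "i < n" "j < n"
  shows "average n n R R k l $$ (i, j) =
    (if k = l \<and> i = j then of_nat (card (carrier G)) / of_nat n else 0)"
proof -
  note Rr = irreducible_representationD(1)[OF R]
  note R' = representationD[OF Rr]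
  let ?a = "average n n R R k l"
  obtain c where c: "?a = c \<cdot>\<^sub>m 1\<^sub>m n"
    using schur_scalar[OF R average_carrier] average_intertwines[OF Rr Rr kl] by blast
  have "mat_trace (?a) = (\<Sum>i<n. \<Sum>g\<in>carrier G. R g $$ (i, k) * R (inv g) $$ (l, i))"
    by (simp add: average_def mat_trace_def)
  also have "\<dots> = (\<Sum>g\<in>carrier G. \<Sum>i<n. R (inv g) $$ (l, i) * R g $$ (i, k))"
    by (subst sum.swap) (simp add: mult.commute)
  also have "\<dots> = (\<Sum>g\<in>carrier G. (R (inv g) * R g) $$ (l, k))"
  proof (rule sum.cong[OF refl])
    fix g assume g: "g \<in> carrier G"
    show "(\<Sum>i<n. R (inv g) $$ (l, i) * R g $$ (i, k)) = (R (inv g) * R g) $$ (l, k)"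
      using R'(2)[OF g] R'(2)[of "inv g"] g kl by (simp add: scalar_prod_def atLeast0LessThan)
  qed
  also have "\<dots> = (if k = l then of_nat (card (carrier G)) else 0)"
    using representation_inv(2)[OF is_group Rr] kl by simp
  finally have "mat_trace (?a) = (if k = l then of_nat (card (carrier G)) else 0)" .
  moreover have "mat_trace (?a) = c * of_nat n" unfolding c by (simp add: mat_trace_def)
  ultimately have "c * of_nat n = (if k = l then of_nat (card (carrier G)) else 0)" by simp
  moreover have "?a $$ (i, j) = (if i = j then c else 0)" unfolding c using ij by simp
  ultimately show ?thesis using R'(1) by (auto simp: field_simps)
qed

lemma irreducible_character_norm:
  assumes R: "irreducible_representation G n R"
  shows "char_prod G (rep_character G R) (rep_character G R) = 1"
proof -
  note Rr = irreducible_representationD(1)[OF R]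
  note R' = representationD[OF Rr]
  have "(\<Sum>g\<in>carrier G. mat_trace (R g) * mat_trace (R (inv g))) =
    (\<Sum>k<n. \<Sum>l<n. if k = l then of_nat (card (carrier G)) / of_nat n else 0)"
    unfolding char_sum_eq_average[OF Rr Rr] by (intro sum.cong refl) (simp add: average_entries[OF R])
  also have "\<dots> = of_nat (card (carrier G))" using R'(1) by simp
  finally show ?thesis using card_pos by (simp add: char_prod_def rep_character_def)
qed

text \<open>The image of the group algebra element \<open>\<Sum>\<^sub>c f(c) c\<close>.\<close>

definition algebra_mat :: "nat \<Rightarrow> 'a set \<Rightarrow> ('a \<Rightarrow> complex) \<Rightarrow> ('a \<Rightarrow> complex mat) \<Rightarrow> complex mat" where
  "algebra_mat n A f R = mat n n (\<lambda>(i, j). \<Sum>c\<in>A. f c * R c $$ (i, j))"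

lemma algebra_mat_carrier: "algebra_mat n A f R \<in> carrier_mat n n"
  by (simp add: algebra_mat_def)

lemma algebra_mat_mult:
  assumes R: "representation G n R" and A: "A \<subseteq> carrier G" and g: "g \<in> carrier G" and ij: "i < n" "j < n"
  shows "(R g * algebra_mat n A f R) $$ (i, j) = (\<Sum>c\<in>A. f c * R (g \<otimes> c) $$ (i, j))"
    and "(algebra_mat n A f R * R g) $$ (i, j) = (\<Sum>c\<in>A. f c * R (c \<otimes> g) $$ (i, j))"
proof -
  note R' = representationD[OF R]
  have c: "R (g \<otimes> c) $$ (i, j) = (\<Sum>a<n. R g $$ (i, a) * R c $$ (a, j))"
    "R (c \<otimes> g) $$ (i, j) = (\<Sum>a<n. R c $$ (i, a) * R g $$ (a, j))" if "c \<in> A" for c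
  proof -
    have c: "c \<in> carrier G" using that A by auto
    show "R (g \<otimes> c) $$ (i, j) = (\<Sum>a<n. R g $$ (i, a) * R c $$ (a, j))"
      "R (c \<otimes> g) $$ (i, j) = (\<Sum>a<n. R c $$ (i, a) * R g $$ (a, j))"
      using R'(3)[OF g c] R'(3)[OF c g] R'(2)[OF g] R'(2)[OF c] ij
      by (simp_all add: scalar_prod_def atLeast0LessThan)
  qed
  have "(R g * algebra_mat n A f R) $$ (i, j) = (\<Sum>a<n. R g $$ (i, a) * (\<Sum>c\<in>A. f c * R c $$ (a, j)))"
    using ij R'(2)[OF g] by (simp add: algebra_mat_def scalar_prod_def atLeast0LessThan)
  also have "\<dots> = (\<Sum>c\<in>A. f c * (\<Sum>a<n. R g $$ (i, a) * R c $$ (a, j)))"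
    by (simp add: sum_distrib_left mult.left_commute) (rule sum.swap)
  finally show "(R g * algebra_mat n A f R) $$ (i, j) = (\<Sum>c\<in>A. f c * R (g \<otimes> c) $$ (i, j))"
    using c(1) by (simp cong: sum.cong)
  have "(algebra_mat n A f R * R g) $$ (i, j) = (\<Sum>a<n. (\<Sum>c\<in>A. f c * R c $$ (i, a)) * R g $$ (a, j))"
    using ij R'(2)[OF g] by (simp add: algebra_mat_def scalar_prod_def atLeast0LessThan)
  also have "\<dots> = (\<Sum>c\<in>A. f c * (\<Sum>a<n. R c $$ (i, a) * R g $$ (a, j)))"
    by (simp add: sum_distrib_left sum_distrib_right mult.assoc) (rule sum.swap)
  finally show "(algebra_mat n A f R * R g) $$ (i, j) = (\<Sum>c\<in>A. f c * R (c \<otimes> g) $$ (i, j))"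
    using c(2) by (simp cong: sum.cong)
qed

text \<open>The element \<open>\<Sum>\<^sub>g f(g) g\<inverse>\<close> of the group algebra is central, so that \<open>R\<close> maps it to a scalar.\<close>

lemma class_function_convolution:
  assumes R: "irreducible_representation G n R"
    and cl: "\<And>g x. g \<in> carrier G \<Longrightarrow> x \<in> carrier G \<Longrightarrow> f (g \<otimes> x \<otimes> inv g) = f x"
    and h: "h \<in> carrier G"
  shows "mat_trace (R \<one>) * (\<Sum>g\<in>carrier G. f g * mat_trace (R (h \<otimes> inv g))) =
    (\<Sum>g\<in>carrier G. f g * mat_trace (R (inv g))) * mat_trace (R h)"
proof -
  note Rr = irreducible_representationD(1)[OF R]
  note R' = representationD[OF Rr]
  define B where "B = algebra_mat n (carrier G) (\<lambda>g. f (inv g)) R"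
  have B: "B \<in> carrier_mat n n" unfolding B_def by (rule algebra_mat_carrier)
  note mult = algebra_mat_mult[OF Rr order_refl, where f = "\<lambda>g. f (inv g)", folded B_def]
  have "R x * B = B * R x" if x: "x \<in> carrier G" for x
  proof (rule eq_matI)
    fix i j assume "i < dim_row (B * R x)" "j < dim_col (B * R x)"
    then have ij: "i < n" "j < n" using B R'(2)[OF x] by auto
    have "(B * R x) $$ (i, j) = (\<Sum>g\<in>carrier G. f (inv (x \<otimes> g \<otimes> inv x)) * R (x \<otimes> g \<otimes> inv x \<otimes> x) $$ (i, j))"
      unfolding mult(2)[OF x ij] by (rule sum_conjugate[OF x, symmetric])
    also have "\<dots> = (R x * B) $$ (i, j)"
      unfolding mult(1)[OF x ij]
    proof (rule sum.cong[OF refl])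
      fix g assume g: "g \<in> carrier G"
      have "inv (x \<otimes> g \<otimes> inv x) = x \<otimes> inv g \<otimes> inv x" "x \<otimes> g \<otimes> inv x \<otimes> x = x \<otimes> g"
        using g x by (simp_all add: inv_mult_group m_assoc)
      then show "f (inv (x \<otimes> g \<otimes> inv x)) * R (x \<otimes> g \<otimes> inv x \<otimes> x) $$ (i, j) = f (inv g) * R (x \<otimes> g) $$ (i, j)"
        using cl[OF x, of "inv g"] g by simp
    qed
    finally show "(R x * B) $$ (i, j) = (B * R x) $$ (i, j)" ..
  qed (use B R'(2)[OF x] in auto)
  then obtain c where c: "B = c \<cdot>\<^sub>m 1\<^sub>m n" using schur_scalar[OF R B] by blast
  have tr: "(\<Sum>g\<in>carrier G. f g * mat_trace (R (x \<otimes> inv g))) = c * mat_trace (R x)"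
    if x: "x \<in> carrier G" for x
  proof -
    have "(\<Sum>g\<in>carrier G. f g * mat_trace (R (x \<otimes> inv g))) = (\<Sum>g\<in>carrier G. f (inv g) * mat_trace (R (x \<otimes> g)))"
      by (subst sum_inverse[symmetric]) simp
    also have "\<dots> = (\<Sum>g\<in>carrier G. \<Sum>i<n. f (inv g) * R (x \<otimes> g) $$ (i, i))"
    proof (rule sum.cong[OF refl])
      fix g assume g: "g \<in> carrier G"
      show "f (inv g) * mat_trace (R (x \<otimes> g)) = (\<Sum>i<n. f (inv g) * R (x \<otimes> g) $$ (i, i))"
        using R'(2)[of "x \<otimes> g"] x g by (simp add: mat_trace_def sum_distrib_left)
    qed
    also have "\<dots> = (\<Sum>i<n. (R x * B) $$ (i, i))"
      by (subst sum.swap) (simp add: mult(1)[OF x])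
    also have "\<dots> = (\<Sum>i<n. c * R x $$ (i, i))"
    proof -
      have "R x * B = c \<cdot>\<^sub>m R x" unfolding c
        using mult_smult_distrib[OF R'(2)[OF x] one_carrier_mat] R'(2)[OF x] by simp
      then show ?thesis using R'(2)[OF x] by simp
    qed
    also have "\<dots> = c * mat_trace (R x)"
      using R'(2)[OF x] by (simp add: mat_trace_def sum_distrib_left)
    finally show ?thesis .
  qed
  have "(\<Sum>g\<in>carrier G. f g * mat_trace (R (inv g))) = (\<Sum>g\<in>carrier G. f g * mat_trace (R (\<one> \<otimes> inv g)))"
    by (rule sum.cong) auto
  then show ?thesis using tr[OF h] tr[OF one_closed] by simp
qed

end

section \<open>Decomposition of characters into irreducible ones\<close>

text \<open>
  Linearly independent vectors \<open>v\<close> are accompanied by dual functionals \<open>l\<close>. Then the coordinates are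
  given by \<open>l\<close>, and a basis is extended by an explicit formula.
\<close>

definition dual_system :: "nat \<Rightarrow> nat \<Rightarrow> (nat \<Rightarrow> complex vec) \<Rightarrow> (nat \<Rightarrow> complex vec) \<Rightarrow> bool" where
  "dual_system n k l v \<longleftrightarrow> (\<forall>i<k. l i \<in> carrier_vec n \<and> v i \<in> carrier_vec n) \<and>
     (\<forall>i<k. \<forall>j<k. (\<Sum>a<n. l i $ a * v j $ a) = (if i = j then 1 else 0))"

lemma dual_system_le:
  assumes "dual_system n k l v"
  shows "k \<le> n"
proof (rule ccontr)
  assume kn: "\<not> k \<le> n"
  define B where "B = mat k k (\<lambda>(a, j). if a < n then v j $ a else 0)"
  define A where "A = mat k k (\<lambda>(i, a). if a < n then l i $ a else 0)"
  have split: "{..<k} = {..<n} \<union> {n..<k}" using kn by auto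
  have "A * B = 1\<^sub>m k"
  proof (rule eq_matI)
    fix i j assume ij: "i < dim_row (1\<^sub>m k :: complex mat)" "j < dim_col (1\<^sub>m k :: complex mat)"
    then have "(A * B) $$ (i, j) = (\<Sum>a<k. (if a < n then l i $ a else 0) * (if a < n then v j $ a else 0))"
      by (simp add: A_def B_def scalar_prod_def atLeast0LessThan)
    also have "\<dots> = (\<Sum>a<n. l i $ a * v j $ a)"
      unfolding split by (subst sum.union_disjoint) auto
    finally show "(A * B) $$ (i, j) = 1\<^sub>m k $$ (i, j)" using assms ij by (simp add: dual_system_def)
  qed (auto simp: A_def B_def)
  moreover have A: "A \<in> carrier_mat k k" and B: "B \<in> carrier_mat k k" by (simp_all add: A_def B_def)
  ultimately have BA: "B * A = 1\<^sub>m k" using mat_mult_left_right_inverse by blast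
  have "(B * A) $$ (n, n) = (\<Sum>a<k. B $$ (n, a) * A $$ (a, n))"
    using A B kn by (simp add: scalar_prod_def atLeast0LessThan)
  also have "\<dots> = 0" using kn by (intro sum.neutral) (simp add: B_def)
  finally show False using kn unfolding BA by simp
qed

text \<open>
  If \<open>w \<in> W\<close> is not in the span, its residue \<open>u = w - \<Sum>\<^sub>i l\<^sub>i(w) v\<^sub>i\<close> is killed by all \<open>l\<^sub>i\<close> and has an entry
  \<open>u\<^sub>a \<noteq> 0\<close>. So \<open>u / u\<^sub>a\<close> can be added to \<open>v\<close>, with the \<open>a\<close>-th coordinate of the residue as its functional.
\<close>

lemma dual_system_extend:
  assumes W: "W \<subseteq> carrier_vec n" "\<And>v w. v \<in> W \<Longrightarrow> w \<in> W \<Longrightarrow> v + w \<in> W"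
      "\<And>c v. v \<in> W \<Longrightarrow> c \<cdot>\<^sub>v v \<in> W"
    and "dual_system n k l v" and "\<And>i. i < k \<Longrightarrow> v i \<in> W"
  shows "\<exists>k' l' v'. k \<le> k' \<and> dual_system n k' l' v' \<and> (\<forall>i<k. l' i = l i \<and> v' i = v i) \<and>
    (\<forall>i<k'. v' i \<in> W) \<and> (\<forall>w\<in>W. \<forall>a<n. w $ a = (\<Sum>i<k'. (\<Sum>b<n. l' i $ b * w $ b) * v' i $ a))"
  using assms(4,5)
proof (induction "n - k" arbitrary: k l v rule: less_induct)
  case less
  note ds = less.prems(1) and vW = less.prems(2)
  show ?case
  proof (cases "\<forall>w\<in>W. \<forall>a<n. w $ a = (\<Sum>i<k. (\<Sum>b<n. l i $ b * w $ b) * v i $ a)")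
    case True
    with ds vW show ?thesis by (intro exI[of _ k] exI[of _ l] exI[of _ v] conjI) blast+
  next
    case False
    then obtain w a where wa: "w \<in> W" "a < n" "w $ a \<noteq> (\<Sum>i<k. (\<Sum>b<n. l i $ b * w $ b) * v i $ a)"
      by auto
    define c where "c i = (\<Sum>b<n. l i $ b * w $ b)" for i
    define u where "u = vec n (\<lambda>a. w $ a - (\<Sum>i<k. c i * v i $ a))"
    have w: "w \<in> carrier_vec n" using wa W by auto
    have vc: "v i \<in> carrier_vec n" "l i \<in> carrier_vec n" if "i < k" for i
      using ds that by (auto simp: dual_system_def)
    have dual: "(\<Sum>b<n. l i $ b * v j $ b) = (if i = j then 1 else 0)" if "i < k" "j < k" for i j
      using ds that by (auto simp: dual_system_def)
    have "vec n (\<lambda>a. w $ a - (\<Sum>i<m. c i * v i $ a)) \<in> W" if "m \<le> k" for m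
      using that
    proof (induction m)
      case 0
      have "vec n (\<lambda>a. w $ a - (\<Sum>i<0. c i * v i $ a)) = w" using w by auto
      then show ?case using wa by simp
    next
      case (Suc m)
      have "vec n (\<lambda>a. w $ a - (\<Sum>i<Suc m. c i * v i $ a)) =
        vec n (\<lambda>a. w $ a - (\<Sum>i<m. c i * v i $ a)) + (- c m) \<cdot>\<^sub>v v m"
        using vc[of m] Suc by (intro eq_vecI) (auto simp: algebra_simps)
      then show ?case using Suc vW W by simp
    qed
    then have uW: "u \<in> W" by (simp add: u_def)
    have ua: "u $ a \<noteq> 0" using wa by (simp add: u_def c_def)
    have un: "u $ b = w $ b - (\<Sum>i<k. c i * v i $ b)" if "b < n" for b using that by (simp add: u_def)
    have lu: "(\<Sum>b<n. l i $ b * u $ b) = 0" if i: "i < k" for i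
    proof -
      have "(\<Sum>b<n. l i $ b * u $ b) = (\<Sum>b<n. l i $ b * w $ b - (\<Sum>j<k. c j * (l i $ b * v j $ b)))"
        by (rule sum.cong) (auto simp: un algebra_simps sum_distrib_left)
      also have "\<dots> = c i - (\<Sum>j<k. c j * (\<Sum>b<n. l i $ b * v j $ b))"
        unfolding sum_subtractf c_def[symmetric] sum_distrib_left by (subst sum.swap) simp
      also have "(\<Sum>j<k. c j * (\<Sum>b<n. l i $ b * v j $ b)) = (\<Sum>j<k. if j = i then c j else 0)"
        using i by (intro sum.cong) (auto simp: dual)
      finally show ?thesis using i by simp
    qed
    define v' where "v' = v(k := (1 / u $ a) \<cdot>\<^sub>v u)"
    define l' where "l' = l(k := vec n (\<lambda>b. (if b = a then 1 else 0) - (\<Sum>i<k. v i $ a * l i $ b)))"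
    have un': "u \<in> carrier_vec n" using uW W by auto
    have lk: "(\<Sum>b<n. l' k $ b * x b) = x a - (\<Sum>i<k. v i $ a * (\<Sum>b<n. l i $ b * x b))" for x
    proof -
      have "(\<Sum>b<n. l' k $ b * x b) = (\<Sum>b<n. (if b = a then x b else 0) - (\<Sum>i<k. v i $ a * (l i $ b * x b)))"
        by (rule sum.cong) (auto simp: l'_def algebra_simps sum_distrib_left)
      also have "\<dots> = x a - (\<Sum>i<k. v i $ a * (\<Sum>b<n. l i $ b * x b))"
        unfolding sum_subtractf sum_distrib_left using \<open>a < n\<close> by (subst sum.swap) simp
      finally show ?thesis .
    qed
    have "dual_system n (Suc k) l' v'"
      unfolding dual_system_def
    proof (intro conjI allI impI)
      fix i j assume ij: "i < Suc k" "j < Suc k"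
      have uk: "(\<Sum>b<n. x b * v' k $ b) = (\<Sum>b<n. x b * u $ b) / u $ a" for x
        unfolding sum_divide_distrib using un' by (intro sum.cong) (auto simp: v'_def)
      show "(\<Sum>b<n. l' i $ b * v' j $ b) = (if i = j then 1 else 0)"
      proof (cases "i = k"; cases "j = k")
        assume "i = k" "j = k"
        have "(\<Sum>b<n. l' k $ b * u $ b) = u $ a" unfolding lk by (simp add: lu)
        then show ?thesis using uk[of "\<lambda>b. l' k $ b"] ua \<open>i = k\<close> \<open>j = k\<close> by simp
      next
        assume "i = k" "j \<noteq> k"
        then have j: "j < k" "v' j = v j" using ij by (auto simp: v'_def)
        have "(\<Sum>i<k. v i $ a * (\<Sum>b<n. l i $ b * v j $ b)) = (\<Sum>i<k. if i = j then v i $ a else 0)"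
          using j by (intro sum.cong) (auto simp: dual)
        then show ?thesis using lk[of "\<lambda>b. v j $ b"] j \<open>i = k\<close> by simp
      next
        assume "i \<noteq> k" "j = k"
        then have i: "i < k" "l' i = l i" using ij by (auto simp: l'_def)
        then show ?thesis using uk[of "\<lambda>b. l i $ b"] lu[OF i(1)] \<open>j = k\<close> by simp
      next
        assume "i \<noteq> k" "j \<noteq> k"
        then show ?thesis using ij dual by (simp add: l'_def v'_def)
      qed
    qed (use vc un' in \<open>auto simp: l'_def v'_def less_Suc_eq\<close>)
    moreover have "v' i \<in> W" if "i < Suc k" for i
      using that vW uW W(3) by (auto simp: v'_def less_Suc_eq)
    moreover have "n - Suc k < n - k" using dual_system_le[OF calculation(1)] by simp
    ultimately obtain k' l'' v'' where *: "Suc k \<le> k'" "dual_system n k' l'' v''"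
      "\<forall>i<Suc k. l'' i = l' i \<and> v'' i = v' i" "\<forall>i<k'. v'' i \<in> W"
      "\<forall>w\<in>W. \<forall>a<n. w $ a = (\<Sum>i<k'. (\<Sum>b<n. l'' i $ b * w $ b) * v'' i $ a)"
      using less.hyps[of "Suc k" l' v'] by blast
    have "\<forall>i<k. l'' i = l i \<and> v'' i = v i" using *(3) by (auto simp: l'_def v'_def)
    moreover have "k \<le> k'" using *(1) by simp
    ultimately show ?thesis using *(2,4,5) by blast
  qed
qed

text \<open>
  In a basis that begins with a basis of \<open>W\<close> the matrices are block triangular, and both diagonal
  blocks are representations; the blocks off the diagonal do not contribute to the trace.
\<close>

lemma invariant_subspace_splits_trace:
  assumes "group G" and R: "representation G n \<rho>"
    and W: "W \<subseteq> carrier_vec n" "0\<^sub>v n \<in> W" "\<And>v w. v \<in> W \<Longrightarrow> w \<in> W \<Longrightarrow> v + w \<in> W"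
      "\<And>c v. v \<in> W \<Longrightarrow> c \<cdot>\<^sub>v v \<in> W"
    and inv: "\<And>g v. g \<in> carrier G \<Longrightarrow> v \<in> W \<Longrightarrow> \<rho> g *\<^sub>v v \<in> W"
    and nontriv: "W \<noteq> {0\<^sub>v n}" "W \<noteq> carrier_vec n"
  shows "\<exists>k \<rho>\<^sub>1 \<rho>\<^sub>2. 0 < k \<and> k < n \<and> representation G k \<rho>\<^sub>1 \<and> representation G (n - k) \<rho>\<^sub>2 \<and>
    (\<forall>g\<in>carrier G. mat_trace (\<rho> g) = mat_trace (\<rho>\<^sub>1 g) + mat_trace (\<rho>\<^sub>2 g))"
proof -
  note R' = representationD[OF R]
  obtain k l\<^sub>0 v\<^sub>0 where k: "dual_system n k l\<^sub>0 v\<^sub>0" "\<forall>i<k. v\<^sub>0 i \<in> W"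
    "\<forall>w\<in>W. \<forall>a<n. w $ a = (\<Sum>i<k. (\<Sum>b<n. l\<^sub>0 i $ b * w $ b) * v\<^sub>0 i $ a)"
    using dual_system_extend[OF W(1,3,4), of 0 undefined undefined]
    unfolding dual_system_def[of n 0] by blast
  have "\<exists>m l v. k \<le> m \<and> dual_system n m l v \<and> (\<forall>i<k. l i = l\<^sub>0 i \<and> v i = v\<^sub>0 i) \<and>
    (\<forall>i<m. v i \<in> carrier_vec n) \<and>
    (\<forall>w\<in>carrier_vec n. \<forall>a<n. w $ a = (\<Sum>i<m. (\<Sum>b<n. l i $ b * w $ b) * v i $ a))"
    by (rule dual_system_extend) (use k(1) in \<open>auto simp: dual_system_def\<close>)
  then obtain m l v where m: "k \<le> m" "dual_system n m l v" "\<forall>i<k. l i = l\<^sub>0 i \<and> v i = v\<^sub>0 i"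
    "\<forall>w\<in>carrier_vec n. \<forall>a<n. w $ a = (\<Sum>i<m. (\<Sum>b<n. l i $ b * w $ b) * v i $ a)"
    by blast
  have dual: "(\<Sum>b<n. l i $ b * v j $ b) = (if i = j then 1 else 0)" if "i < m" "j < m" for i j
    using m(2) that by (auto simp: dual_system_def)
  have vc: "v i \<in> carrier_vec n" if "i < m" for i using m(2) that by (auto simp: dual_system_def)
  define P where "P = mat n m (\<lambda>(a, i). v i $ a)"
  define Q where "Q = mat m n (\<lambda>(i, a). l i $ a)"
  have P: "P \<in> carrier_mat n m" and Q: "Q \<in> carrier_mat m n" by (auto simp: P_def Q_def)
  have QP: "Q * P = 1\<^sub>m m"
    by (rule eq_matI) (auto simp: P_def Q_def scalar_prod_def atLeast0LessThan dual)
  have PQ: "P * Q = 1\<^sub>m n"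
  proof (rule eq_matI)
    fix a b assume ab: "a < dim_row (1\<^sub>m n :: complex mat)" "b < dim_col (1\<^sub>m n :: complex mat)"
    have "(unit_vec n b :: complex vec) $ a = (\<Sum>i<m. (\<Sum>c<n. l i $ c * unit_vec n b $ c) * v i $ a)"
      by (rule m(4)[rule_format]) (use ab in auto)
    also have "\<dots> = (\<Sum>i<m. l i $ b * v i $ a)"
    proof (rule sum.cong[OF refl])
      fix i
      have "(\<Sum>c<n. l i $ c * unit_vec n b $ c) = (\<Sum>c<n. if c = b then l i $ c else 0)"
        using ab by (intro sum.cong) auto
      then show "(\<Sum>c<n. l i $ c * unit_vec n b $ c) * v i $ a = l i $ b * v i $ a" using ab by simp
    qed
    finally show "(P * Q) $$ (a, b) = 1\<^sub>m n $$ (a, b)"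
      using ab by (auto simp: P_def Q_def scalar_prod_def atLeast0LessThan mult.commute)
  qed (auto simp: P_def Q_def)
  have "of_nat n = (of_nat m :: complex)"
    using mat_trace_mult_comm[OF P Q] by (simp add: PQ QP mat_trace_one)
  then have mn: "m = n" by simp
  have lW: "(\<Sum>b<n. l i $ b * w $ b) = 0" if w: "w \<in> W" and i: "k \<le> i" "i < n" for w i
  proof -
    have "(\<Sum>b<n. l i $ b * w $ b) = (\<Sum>b<n. \<Sum>j<k. (\<Sum>c<n. l\<^sub>0 j $ c * w $ c) * (l i $ b * v j $ b))"
    proof (rule sum.cong[OF refl])
      fix b assume "b \<in> {..<n}"
      then have "w $ b = (\<Sum>j<k. (\<Sum>c<n. l\<^sub>0 j $ c * w $ c) * v\<^sub>0 j $ b)"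
        by (intro k(3)[rule_format] w) simp
      also have "\<dots> = (\<Sum>j<k. (\<Sum>c<n. l\<^sub>0 j $ c * w $ c) * v j $ b)" using m(3) by simp
      finally show "l i $ b * w $ b = (\<Sum>j<k. (\<Sum>c<n. l\<^sub>0 j $ c * w $ c) * (l i $ b * v j $ b))"
        by (simp add: sum_distrib_left mult.left_commute)
    qed
    also have "\<dots> = (\<Sum>j<k. (\<Sum>c<n. l\<^sub>0 j $ c * w $ c) * (\<Sum>b<n. l i $ b * v j $ b))"
      unfolding sum_distrib_left[of _ "\<lambda>b. l i $ b * v _ $ b"] by (rule sum.swap)
    also have "\<dots> = 0" using i mn m(1) by (intro sum.neutral) (auto simp: dual)
    finally show ?thesis .
  qed
  have k0: "0 < k"
  proof (rule ccontr)
    assume "\<not> 0 < k"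
    then have "w $ a = 0" if "w \<in> W" "a < n" for w a using k(3)[rule_format, OF that] by simp
    then have "w = 0\<^sub>v n" if "w \<in> W" for w using that W(1) by (intro eq_vecI) auto
    then have "W = {0\<^sub>v n}" using W(2) by blast
    with nontriv show False by simp
  qed
  have kn: "k < n"
  proof (rule ccontr)
    assume "\<not> k < n"
    then have "k = n" using m(1) mn by simp
    have "w \<in> W" if w: "w \<in> carrier_vec n" for w
    proof -
      have vW: "v i \<in> W" if "i < n" for i using that k(2) m(3) \<open>k = n\<close> by simp
      have "vec n (\<lambda>a. \<Sum>i<j. (\<Sum>b<n. l i $ b * w $ b) * v i $ a) \<in> W" if "j \<le> n" for j
        using that
      proof (induction j)
        case 0
        have "vec n (\<lambda>a. \<Sum>i<0. (\<Sum>b<n. l i $ b * w $ b) * v i $ a) = 0\<^sub>v n" by auto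
        then show ?case using W by simp
      next
        case (Suc j)
        have "vec n (\<lambda>a. \<Sum>i<Suc j. (\<Sum>b<n. l i $ b * w $ b) * v i $ a) =
          vec n (\<lambda>a. \<Sum>i<j. (\<Sum>b<n. l i $ b * w $ b) * v i $ a) + (\<Sum>b<n. l j $ b * w $ b) \<cdot>\<^sub>v v j"
          using vc[of j] Suc mn by (intro eq_vecI) auto
        then show ?case using Suc vW[of j] W by simp
      qed
      from this[of n] have "vec n (\<lambda>a. \<Sum>i<n. (\<Sum>b<n. l i $ b * w $ b) * v i $ a) \<in> W" by simp
      also have "vec n (\<lambda>a. \<Sum>i<n. (\<Sum>b<n. l i $ b * w $ b) * v i $ a) = w"
      proof (rule eq_vecI)
        fix a assume "a < dim_vec w"
        then have a: "a < n" using w by simp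
        then show "vec n (\<lambda>a. \<Sum>i<n. (\<Sum>b<n. l i $ b * w $ b) * v i $ a) $ a = w $ a"
          unfolding index_vec[OF a] using m(4)[rule_format, OF w a] mn by (metis (no_types))
      qed (use w in simp)
      finally show "w \<in> W" .
    qed
    then show False using nontriv W(1) by blast
  qed
  define S where "S g = Q * \<rho> g * P" for g
  have PQ': "P \<in> carrier_mat n n" "Q \<in> carrier_mat n n" using P Q mn by auto
  have S: "S g \<in> carrier_mat n n" if "g \<in> carrier G" for g using PQ' R'(2)[OF that] by (auto simp: S_def)
  have Sm: "S (g \<otimes>\<^bsub>G\<^esub> h) = S g * S h" if "g \<in> carrier G" "h \<in> carrier G" for g h
  proof -
    note c = R'(2)[OF that(1)] R'(2)[OF that(2)]
    have "S g * S h = Q * \<rho> g * (P * (Q * (\<rho> h * P)))"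
      unfolding S_def using c PQ' by (simp add: assoc_mult_mat[of _ n n _ n _ n])
    also have "P * (Q * (\<rho> h * P)) = \<rho> h * P"
    proof -
      have "P * (Q * (\<rho> h * P)) = (P * Q) * (\<rho> h * P)"
        by (rule assoc_mult_mat[symmetric, of _ n n _ n _ n]) (use c PQ' in auto)
      then show ?thesis using c(2) PQ' by (simp add: PQ)
    qed
    also have "Q * \<rho> g * (\<rho> h * P) = S (g \<otimes>\<^bsub>G\<^esub> h)"
      unfolding S_def R'(3)[OF that] using c PQ' by (simp add: assoc_mult_mat[of _ n n _ n _ n])
    finally show ?thesis ..
  qed
  have S1: "S \<one>\<^bsub>G\<^esub> = 1\<^sub>m n"
    using PQ' QP mn representation_one[OF assms(1) R] by (simp add: S_def)
  have St: "mat_trace (S g) = mat_trace (\<rho> g)" if g: "g \<in> carrier G" for g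
  proof -
    have "mat_trace (S g) = mat_trace (P * (Q * \<rho> g))"
      unfolding S_def using PQ' R'(2)[OF g] by (intro mat_trace_mult_comm) auto
    also have "P * (Q * \<rho> g) = \<rho> g"
    proof -
      have "P * (Q * \<rho> g) = (P * Q) * \<rho> g"
        by (rule assoc_mult_mat[symmetric, of _ n n _ n _ n]) (use R'(2)[OF g] PQ' in auto)
      then show ?thesis using R'(2)[OF g] by (simp add: PQ)
    qed
    finally show ?thesis .
  qed
  have S0: "S g $$ (i, j) = 0" if g: "g \<in> carrier G" and ij: "k \<le> i" "i < n" "j < k" for g i j
  proof -
    have col: "col P j = v j" using ij kn vc[of j] mn by (intro eq_vecI) (auto simp: P_def)
    have "\<rho> g *\<^sub>v v j \<in> W" using inv[OF g] k(2) m(3) ij by simp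
    then have "(\<Sum>b<n. l i $ b * (\<rho> g *\<^sub>v v j) $ b) = 0" using lW ij by blast
    also have "(\<Sum>b<n. l i $ b * (\<rho> g *\<^sub>v v j) $ b) = (Q * (\<rho> g * P)) $$ (i, j)"
      using ij kn R'(2)[OF g] col mn
      by (simp add: Q_def P_def scalar_prod_def atLeast0LessThan)
    finally show ?thesis using PQ' R'(2)[OF g] by (simp add: S_def assoc_mult_mat[of _ n n _ n _ n])
  qed
  have prod: "S (g \<otimes>\<^bsub>G\<^esub> h) $$ (i, j) = (\<Sum>a<k. S g $$ (i, a) * S h $$ (a, j)) +
      (\<Sum>a<n - k. S g $$ (i, a + k) * S h $$ (a + k, j))"
    if "g \<in> carrier G" "h \<in> carrier G" "i < n" "j < n" for g h i j
  proof -
    have "S (g \<otimes>\<^bsub>G\<^esub> h) $$ (i, j) = (\<Sum>a = 0..<n. S g $$ (i, a) * S h $$ (a, j))"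
      using that Sm S[of g] S[of h] by (simp add: scalar_prod_def)
    also have "\<dots> = (\<Sum>a = 0..<k. S g $$ (i, a) * S h $$ (a, j)) + (\<Sum>a = k..<n. S g $$ (i, a) * S h $$ (a, j))"
      using kn by (intro sum.atLeastLessThan_concat[symmetric]) auto
    also have "(\<Sum>a = k..<n. S g $$ (i, a) * S h $$ (a, j)) = (\<Sum>a<n - k. S g $$ (i, a + k) * S h $$ (a + k, j))"
      using sum.shift_bounds_nat_ivl[of "\<lambda>a. S g $$ (i, a) * S h $$ (a, j)" 0 k "n - k"] kn
      by (simp add: atLeast0LessThan)
    finally show ?thesis by (simp add: atLeast0LessThan)
  qed
  define \<rho>\<^sub>1 where "\<rho>\<^sub>1 g = mat k k (\<lambda>(i, j). S g $$ (i, j))" for g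
  define \<rho>\<^sub>2 where "\<rho>\<^sub>2 g = mat (n - k) (n - k) (\<lambda>(i, j). S g $$ (i + k, j + k))" for g
  have "representation G k \<rho>\<^sub>1"
  proof (rule representationI[OF assms(1) k0])
    show "\<rho>\<^sub>1 (g \<otimes>\<^bsub>G\<^esub> h) = \<rho>\<^sub>1 g * \<rho>\<^sub>1 h" if "g \<in> carrier G" "h \<in> carrier G" for g h
      by (rule eq_matI)
        (use that kn in \<open>auto simp: \<rho>\<^sub>1_def scalar_prod_def atLeast0LessThan prod S0\<close>)
    show "\<rho>\<^sub>1 \<one>\<^bsub>G\<^esub> = 1\<^sub>m k" unfolding \<rho>\<^sub>1_def S1 using kn by (intro eq_matI) auto
  qed (simp add: \<rho>\<^sub>1_def)
  moreover have "representation G (n - k) \<rho>\<^sub>2"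
  proof (rule representationI[OF assms(1)])
    show "\<rho>\<^sub>2 (g \<otimes>\<^bsub>G\<^esub> h) = \<rho>\<^sub>2 g * \<rho>\<^sub>2 h" if "g \<in> carrier G" "h \<in> carrier G" for g h
      by (rule eq_matI)
        (use that kn in \<open>auto simp: \<rho>\<^sub>2_def scalar_prod_def atLeast0LessThan prod S0\<close>)
    show "\<rho>\<^sub>2 \<one>\<^bsub>G\<^esub> = 1\<^sub>m (n - k)" unfolding \<rho>\<^sub>2_def S1 using kn by (intro eq_matI) auto
  qed (use kn in \<open>auto simp: \<rho>\<^sub>2_def\<close>)
  moreover have "mat_trace (\<rho> g) = mat_trace (\<rho>\<^sub>1 g) + mat_trace (\<rho>\<^sub>2 g)" if g: "g \<in> carrier G" for g
  proof -
    have "mat_trace (\<rho> g) = (\<Sum>a = 0..<n. S g $$ (a, a))"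
      using St[OF g] S[OF g] by (simp add: mat_trace_def atLeast0LessThan)
    also have "\<dots> = (\<Sum>a = 0..<k. S g $$ (a, a)) + (\<Sum>a = k..<n. S g $$ (a, a))"
      using kn by (intro sum.atLeastLessThan_concat[symmetric]) auto
    also have "(\<Sum>a = k..<n. S g $$ (a, a)) = (\<Sum>a<n - k. S g $$ (a + k, a + k))"
      using sum.shift_bounds_nat_ivl[of "\<lambda>a. S g $$ (a, a)" 0 k "n - k"] kn
      by (simp add: atLeast0LessThan)
    finally show ?thesis by (simp add: mat_trace_def \<rho>\<^sub>1_def \<rho>\<^sub>2_def atLeast0LessThan)
  qed
  ultimately show ?thesis using k0 kn by blast
qed

lemma representation_trace_sum_Irr:
  assumes "group G" and "representation G n \<rho>"
  shows "\<exists>cs. cs \<noteq> [] \<and> set cs \<subseteq> Irr G \<and> (\<forall>g\<in>carrier G. mat_trace (\<rho> g) = (\<Sum>\<chi>\<leftarrow>cs. \<chi> g))"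
  using assms(2)
proof (induction n arbitrary: \<rho> rule: less_induct)
  case (less n)
  show ?case
  proof (cases "irreducible_representation G n \<rho>")
    case True
    then have "rep_character G \<rho> \<in> Irr G" unfolding Irr_def by blast
    then show ?thesis by (intro exI[of _ "[rep_character G \<rho>]"]) (auto simp: rep_character_def)
  next
    case False
    then obtain W where W': "W \<subseteq> carrier_vec n \<and> 0\<^sub>v n \<in> W \<and>
        (\<forall>v\<in>W. \<forall>w\<in>W. v + w \<in> W) \<and> (\<forall>c. \<forall>v\<in>W. c \<cdot>\<^sub>v v \<in> W)"
      "\<forall>g\<in>carrier G. \<forall>w\<in>W. \<rho> g *\<^sub>v w \<in> W" "\<not> (W = {0\<^sub>v n} \<or> W = carrier_vec n)"
      using less.prems unfolding irreducible_representation_def subspace_vec_iff by blast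
    then have W: "W \<subseteq> carrier_vec n" "0\<^sub>v n \<in> W" "\<And>v w. v \<in> W \<Longrightarrow> w \<in> W \<Longrightarrow> v + w \<in> W"
      "\<And>c v. v \<in> W \<Longrightarrow> c \<cdot>\<^sub>v v \<in> W" "\<And>g v. g \<in> carrier G \<Longrightarrow> v \<in> W \<Longrightarrow> \<rho> g *\<^sub>v v \<in> W"
      "W \<noteq> {0\<^sub>v n}" "W \<noteq> carrier_vec n"
      by simp_all
    obtain k \<rho>\<^sub>1 \<rho>\<^sub>2 where k: "0 < k" "k < n" "representation G k \<rho>\<^sub>1" "representation G (n - k) \<rho>\<^sub>2"
      "\<forall>g\<in>carrier G. mat_trace (\<rho> g) = mat_trace (\<rho>\<^sub>1 g) + mat_trace (\<rho>\<^sub>2 g)"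
      using invariant_subspace_splits_trace[OF assms(1) less.prems W] by blast
    obtain as bs where "as \<noteq> []" "set as \<subseteq> Irr G" "\<forall>g\<in>carrier G. mat_trace (\<rho>\<^sub>1 g) = (\<Sum>\<chi>\<leftarrow>as. \<chi> g)"
      "set bs \<subseteq> Irr G" "\<forall>g\<in>carrier G. mat_trace (\<rho>\<^sub>2 g) = (\<Sum>\<chi>\<leftarrow>bs. \<chi> g)"
      using less.IH[OF k(2,3)] less.IH[OF _ k(4)] k(1,2) by fastforce
    then show ?thesis using k(5) by (intro exI[of _ "as @ bs"]) auto
  qed
qed

section \<open>Multiplicities and degrees\<close>

lemma direct_sum_representation:
  assumes "group G" and R: "representation G r R" and S: "representation G n S"
  shows "representation G (r + n) (\<lambda>g. four_block_mat (R g) (0\<^sub>m r n) (0\<^sub>m n r) (S g))"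
proof (rule representationI[OF assms(1)])
  note R' = representationD[OF R] and S' = representationD[OF S]
  show "r + n > 0" using R' by simp
  show "four_block_mat (R g) (0\<^sub>m r n) (0\<^sub>m n r) (S g) \<in> carrier_mat (r + n) (r + n)"
    if "g \<in> carrier G" for g using R'(2)[OF that] S'(2)[OF that] by simp
  show "four_block_mat (R (g \<otimes>\<^bsub>G\<^esub> h)) (0\<^sub>m r n) (0\<^sub>m n r) (S (g \<otimes>\<^bsub>G\<^esub> h)) =
    four_block_mat (R g) (0\<^sub>m r n) (0\<^sub>m n r) (S g) * four_block_mat (R h) (0\<^sub>m r n) (0\<^sub>m n r) (S h)"
    if gh: "g \<in> carrier G" "h \<in> carrier G" for g h
    using R'(2)[OF gh(1)] S'(2)[OF gh(1)] R'(2)[OF gh(2)] S'(2)[OF gh(2)]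
    by (subst mult_four_block_mat[of _ r r _ n _ n _ _ r _ n]) (simp_all add: R'(3)[OF gh] S'(3)[OF gh])
  show "four_block_mat (R \<one>\<^bsub>G\<^esub>) (0\<^sub>m r n) (0\<^sub>m n r) (S \<one>\<^bsub>G\<^esub>) = 1\<^sub>m (r + n)"
    using representation_one[OF assms(1) R] representation_one[OF assms(1) S] by simp
qed

lemma characters_add:
  assumes "group G" and "\<chi> \<in> characters G" and "\<psi> \<in> characters G"
  shows "(\<lambda>g\<in>carrier G. \<chi> g + \<psi> g) \<in> characters G"
proof -
  obtain r R n S where R: "representation G r R" "\<chi> = rep_character G R"
    and S: "representation G n S" "\<psi> = rep_character G S"
    using assms(2,3) unfolding characters_def by blast
  let ?D = "\<lambda>g. four_block_mat (R g) (0\<^sub>m r n) (0\<^sub>m n r) (S g)"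
  have "mat_trace (?D g) = mat_trace (R g) + mat_trace (S g)" if g: "g \<in> carrier G" for g
  proof -
    note c = representationD(2)[OF R(1) g] representationD(2)[OF S(1) g]
    have "mat_trace (?D g) = (\<Sum>i = 0..<r + n. ?D g $$ (i, i))"
      using c by (simp add: mat_trace_def atLeast0LessThan)
    also have "\<dots> = (\<Sum>i = 0..<r. ?D g $$ (i, i)) + (\<Sum>i = r..<r + n. ?D g $$ (i, i))"
      by (intro sum.atLeastLessThan_concat[symmetric]) auto
    also have "(\<Sum>i = r..<r + n. ?D g $$ (i, i)) = (\<Sum>i<n. ?D g $$ (i + r, i + r))"
      using sum.shift_bounds_nat_ivl[of "\<lambda>i. ?D g $$ (i, i)" 0 r n] by (simp add: atLeast0LessThan add.commute)
    finally show ?thesis using c by (simp add: mat_trace_def atLeast0LessThan)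
  qed
  then have "(\<lambda>g\<in>carrier G. \<chi> g + \<psi> g) = rep_character G ?D"
    by (auto simp: R S rep_character_def)
  then show ?thesis
    unfolding characters_def using direct_sum_representation[OF assms(1) R(1) S(1)] by blast
qed

lemma Irr_subset_characters: "Irr G \<subseteq> characters G"
  unfolding Irr_def characters_def irreducible_representation_def by blast

lemma Irr_character: "\<chi> \<in> Irr G \<Longrightarrow> \<chi> \<in> characters G"
  using Irr_subset_characters by blast

lemma characters_extensional: "\<chi> \<in> characters G \<Longrightarrow> \<chi> \<in> extensional (carrier G)"
  unfolding characters_def rep_character_def by auto

lemma characters_eqI:
  assumes "\<chi> \<in> characters G" and "\<psi> \<in> characters G" and "\<And>g. g \<in> carrier G \<Longrightarrow> \<chi> g = \<psi> g"
  shows "\<chi> = \<psi>"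
  using assms characters_extensional extensionalityI by metis

text \<open>
  Multiplicities and degrees of characters are natural numbers; the rounding turns the complex
  value into one. Here \<open>\<chi>\<close> may be a function on a larger group, whose restriction is meant.
\<close>

definition char_multiplicity :: "('a, 'b) monoid_scheme \<Rightarrow> ('a \<Rightarrow> complex) \<Rightarrow> ('a \<Rightarrow> complex) \<Rightarrow> nat" where
  "char_multiplicity G \<chi> \<psi> = nat \<lfloor>Re (char_prod G \<chi> \<psi>)\<rfloor>"

definition degree_nat :: "('a, 'b) monoid_scheme \<Rightarrow> ('a \<Rightarrow> complex) \<Rightarrow> nat" where
  "degree_nat G \<chi> = nat \<lfloor>Re (\<chi> \<one>\<^bsub>G\<^esub>)\<rfloor>"

context finite_group
begin

lemma char_prod_cong:
  assumes "\<And>g. g \<in> carrier G \<Longrightarrow> f g = f' g" and "\<And>g. g \<in> carrier G \<Longrightarrow> h g = h' g"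
  shows "char_prod G f h = char_prod G f' h'"
  using assms by (simp add: char_prod_def cong: sum.cong)

lemma char_prod_sum_left:
  assumes "finite A"
  shows "char_prod G (\<lambda>g. \<Sum>\<psi>\<in>A. c \<psi> * F \<psi> g) h = (\<Sum>\<psi>\<in>A. c \<psi> * char_prod G (F \<psi>) h)"
proof -
  have "(\<Sum>x\<in>carrier G. (\<Sum>\<psi>\<in>A. c \<psi> * F \<psi> x) * h (inv x)) =
    (\<Sum>\<psi>\<in>A. c \<psi> * (\<Sum>x\<in>carrier G. F \<psi> x * h (inv x)))"
    by (simp add: sum_distrib_left sum_distrib_right mult.assoc) (rule sum.swap)
  then show ?thesis by (simp only: char_prod_def sum_divide_distrib[of _ A] times_divide_eq_right)
qed

lemma char_prod_sum_list_left:
  "char_prod G (\<lambda>g. \<Sum>\<psi>\<leftarrow>xs. \<psi> g) h = (\<Sum>\<psi>\<leftarrow>xs. char_prod G \<psi> h)"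
  by (induction xs) (simp_all add: char_prod_def distrib_right sum.distrib add_divide_distrib)

lemma Irr_orthonormal:
  assumes "\<chi> \<in> Irr G" and "\<psi> \<in> Irr G"
  shows "char_prod G \<chi> \<psi> = (if \<chi> = \<psi> then 1 else 0)"
proof -
  obtain n R where R: "irreducible_representation G n R" "\<chi> = rep_character G R"
    using assms(1) unfolding Irr_def by blast
  obtain m S where S: "irreducible_representation G m S" "\<psi> = rep_character G S"
    using assms(2) unfolding Irr_def by blast
  show ?thesis
    using irreducible_characters_eq[OF R(1) S(1)] irreducible_character_norm[OF R(1)] R(2) S(2) by argo
qed

lemma character_one:
  assumes "\<chi> \<in> characters G"
  shows "\<exists>n>0. \<chi> \<one> = of_nat n"
proof -
  obtain n R where R: "representation G n R" "\<chi> = rep_character G R"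
    using assms unfolding characters_def by blast
  then have "\<chi> \<one> = of_nat n"
    using representation_one[OF is_group R(1)] by (simp add: rep_character_def mat_trace_one)
  with representationD(1)[OF R(1)] show ?thesis by blast
qed

lemma of_nat_degree: "\<chi> \<in> characters G \<Longrightarrow> of_nat (degree_nat G \<chi>) = \<chi> \<one>"
  and degree_pos: "\<chi> \<in> characters G \<Longrightarrow> degree_nat G \<chi> > 0"
proof -
  assume "\<chi> \<in> characters G"
  then obtain n where "n > 0" "\<chi> \<one> = of_nat n" using character_one by blast
  then show "of_nat (degree_nat G \<chi>) = \<chi> \<one>" "degree_nat G \<chi> > 0" by (simp_all add: degree_nat_def)
qed

lemma character_class_function:
  assumes "\<chi> \<in> characters G" and g: "g \<in> carrier G" and x: "x \<in> carrier G"
  shows "\<chi> (g \<otimes> x \<otimes> inv g) = \<chi> x"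
proof -
  obtain n R where R: "representation G n R" and \<chi>: "\<chi> = rep_character G R"
    using assms(1) unfolding characters_def by blast
  note R' = representationD[OF R]
  have "R (g \<otimes> x \<otimes> inv g) = R g * (R x * R (inv g))"
    using R'(3)[of "g \<otimes> x" "inv g"] R'(3)[of g x] R'(2)[OF g] R'(2)[OF x] R'(2)[of "inv g"] g x by simp
  also have "mat_trace \<dots> = mat_trace ((R x * R (inv g)) * R g)"
    using R'(2)[OF g] R'(2)[OF x] R'(2)[of "inv g"] g by (intro mat_trace_mult_comm) auto
  also have "(R x * R (inv g)) * R g = R x"
    using R'(2)[OF g] R'(2)[OF x] R'(2)[of "inv g"] representation_inv(2)[OF is_group R g] g by simp
  finally show ?thesis using g x by (simp add: \<chi> rep_character_def)
qed

text \<open>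
  The map \<open>h \<mapsto> \<Sum>\<^sub>g f(g) \<chi>(h g\<inverse>)\<close> is the multiple of \<open>\<chi>\<close> by which the central element attached to
  \<open>f\<close> acts; this is how class functions are compared with characters below.
\<close>

lemma Irr_convolution:
  assumes "\<chi> \<in> Irr G"
    and "\<And>g x. g \<in> carrier G \<Longrightarrow> x \<in> carrier G \<Longrightarrow> f (g \<otimes> x \<otimes> inv g) = f x" and h: "h \<in> carrier G"
  shows "\<chi> \<one> * (\<Sum>g\<in>carrier G. f g * \<chi> (h \<otimes> inv g)) = of_nat (card (carrier G)) * char_prod G f \<chi> * \<chi> h"
proof -
  obtain n R where "irreducible_representation G n R" and \<chi>: "\<chi> = rep_character G R"
    using assms(1) unfolding Irr_def by blast
  from class_function_convolution[OF this(1) assms(2) h] show ?thesis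
    using h card_pos by (simp add: \<chi> rep_character_def char_prod_def cong: sum.cong)
qed

lemma character_sum_list_Irr:
  assumes "\<chi> \<in> characters G"
  shows "\<exists>cs. cs \<noteq> [] \<and> set cs \<subseteq> Irr G \<and> (\<forall>g\<in>carrier G. \<chi> g = (\<Sum>\<psi>\<leftarrow>cs. \<psi> g))"
proof -
  obtain n R where R: "representation G n R" "\<chi> = rep_character G R"
    using assms unfolding characters_def by blast
  have "\<chi> g = mat_trace (R g)" if "g \<in> carrier G" for g
    using that by (simp add: R(2) rep_character_def)
  with representation_trace_sum_Irr[OF is_group R(1)] show ?thesis by simp
qed

lemma char_prod_character_Irr:
  assumes "\<chi> \<in> characters G" and "\<psi> \<in> Irr G"
  shows "\<exists>n. char_prod G \<chi> \<psi> = of_nat n"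
proof -
  obtain cs where cs: "set cs \<subseteq> Irr G" "\<And>g. g \<in> carrier G \<Longrightarrow> \<chi> g = (\<Sum>\<psi>\<leftarrow>cs. \<psi> g)"
    using character_sum_list_Irr[OF assms(1)] by blast
  have "char_prod G \<chi> \<psi> = (\<Sum>\<phi>\<leftarrow>cs. char_prod G \<phi> \<psi>)"
    unfolding char_prod_sum_list_left[symmetric] by (rule char_prod_cong) (use cs in auto)
  also have "\<dots> = of_nat (count_list cs \<psi>)"
    using cs(1) assms(2) by (induction cs) (auto simp: Irr_orthonormal)
  finally show ?thesis by blast
qed

lemma of_nat_multiplicity:
  "\<chi> \<in> characters G \<Longrightarrow> \<psi> \<in> Irr G \<Longrightarrow> of_nat (char_multiplicity G \<chi> \<psi>) = char_prod G \<chi> \<psi>"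
proof -
  assume "\<chi> \<in> characters G" "\<psi> \<in> Irr G"
  then obtain n where "char_prod G \<chi> \<psi> = of_nat n" using char_prod_character_Irr by blast
  then show ?thesis by (simp add: char_multiplicity_def)
qed

lemma regular_character: "(\<lambda>g\<in>carrier G. if g = \<one> then of_nat (card (carrier G)) else 0) \<in> characters G"
proof -
  define N where "N = card (carrier G)"
  obtain e where e: "bij_betw e {..<N} (carrier G)"
    using ex_bij_betw_nat_finite[OF fin] by (auto simp: N_def atLeast0LessThan)
  have ec: "e i \<in> carrier G" if "i < N" for i using e that by (auto simp: bij_betw_def)
  have einj: "e i = e j \<longleftrightarrow> i = j" if "i < N" "j < N" for i j
    using e that by (auto simp: bij_betw_def inj_on_def)
  define R where "R g = mat N N (\<lambda>(i, j). if e i = g \<otimes> e j then 1 else (0 :: complex))" for g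
  have "representation G N R"
  proof (rule representationI[OF is_group])
    show "N > 0" using card_pos by (simp add: N_def)
    show "R \<one> = 1\<^sub>m N" by (rule eq_matI) (auto simp: R_def ec einj)
    show "R (g \<otimes> h) = R g * R h" if gh: "g \<in> carrier G" "h \<in> carrier G" for g h
    proof (rule eq_matI)
      fix i j assume "i < dim_row (R g * R h)" "j < dim_col (R g * R h)"
      then have ij: "i < N" "j < N" by (auto simp: R_def)
      have "h \<otimes> e j \<in> e ` {..<N}" using e gh ec[OF ij(2)] by (simp add: bij_betw_def)
      then obtain m where m: "m < N" "e m = h \<otimes> e j" by force
      have em: "e a = h \<otimes> e j \<longleftrightarrow> a = m" if "a < N" for a using m einj[OF that m(1)] by auto
      have "(R g * R h) $$ (i, j) = (\<Sum>a<N. (if e i = g \<otimes> e a then 1 else 0) * (if e a = h \<otimes> e j then 1 else 0))"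
        using ij by (simp add: R_def scalar_prod_def atLeast0LessThan)
      also have "\<dots> = (\<Sum>a<N. if a = m then (if e i = g \<otimes> e m then 1 else 0) else 0)"
        by (intro sum.cong) (auto simp: em m)
      also have "\<dots> = (if e i = g \<otimes> e m then 1 else 0)" using m by simp
      finally show "R (g \<otimes> h) $$ (i, j) = (R g * R h) $$ (i, j)"
        using ij m gh ec[OF ij(2)] by (simp add: R_def m_assoc)
    qed (auto simp: R_def)
  qed (simp add: R_def)
  moreover have "rep_character G R = (\<lambda>g\<in>carrier G. if g = \<one> then of_nat (card (carrier G)) else 0)"
    unfolding rep_character_def
  proof (rule restrict_ext)
    fix g assume g: "g \<in> carrier G"
    have "mat_trace (R g) = (\<Sum>i<N. if g = \<one> then 1 else 0)"
      unfolding mat_trace_def using g ec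
      by (intro sum.cong) (auto simp: R_def)
    then show "mat_trace (R g) = (if g = \<one> then of_nat (card (carrier G)) else 0)" by (simp add: N_def)
  qed
  ultimately show ?thesis unfolding characters_def mem_Collect_eq by metis
qed

lemma char_prod_regular:
  "char_prod G (\<lambda>g\<in>carrier G. if g = \<one> then of_nat (card (carrier G)) else 0) h = h \<one>"
proof -
  have "(\<Sum>x\<in>carrier G. (\<lambda>g\<in>carrier G. if g = \<one> then of_nat (card (carrier G)) else 0) x * h (inv x)) =
    (\<Sum>x\<in>carrier G. if x = \<one> then of_nat (card (carrier G)) * h x else 0)"
    by (rule sum.cong) auto
  then show ?thesis using fin one_closed by (auto simp: char_prod_def card_eq_0_iff)
qed

text \<open>
  As \<open>[\<rho>, \<psi>] = \<psi>(1) \<noteq> 0\<close> for the regular character \<open>\<rho>\<close>, each irreducible \<open>\<psi>\<close> occurs in a fixed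
  decomposition of \<open>\<rho>\<close>.
\<close>

lemma finite_Irr: "finite (Irr G)"
proof -
  let ?reg = "\<lambda>g\<in>carrier G. if g = \<one> then of_nat (card (carrier G)) else 0"
  obtain cs where cs: "set cs \<subseteq> Irr G" "\<And>g. g \<in> carrier G \<Longrightarrow> ?reg g = (\<Sum>\<psi>\<leftarrow>cs. \<psi> g)"
    using character_sum_list_Irr[OF regular_character] by blast
  have "\<psi> \<in> set cs" if \<psi>: "\<psi> \<in> Irr G" for \<psi>
  proof (rule ccontr)
    assume n: "\<psi> \<notin> set cs"
    have "\<psi> \<one> = char_prod G ?reg \<psi>" by (rule char_prod_regular[symmetric])
    also have "\<dots> = (\<Sum>\<phi>\<leftarrow>cs. char_prod G \<phi> \<psi>)"
      unfolding char_prod_sum_list_left[symmetric] by (rule char_prod_cong) (use cs in auto)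
    also have "\<dots> = 0" using cs(1) \<psi> n by (induction cs) (auto simp: Irr_orthonormal)
    finally show False using character_one[of \<psi>] Irr_subset_characters \<psi> by auto
  qed
  then have "Irr G \<subseteq> set cs" by blast
  then show ?thesis by (rule finite_subset) simp
qed

lemma character_decomposition:
  assumes "\<chi> \<in> characters G" and g: "g \<in> carrier G"
  shows "\<chi> g = (\<Sum>\<psi>\<in>Irr G. of_nat (char_multiplicity G \<chi> \<psi>) * \<psi> g)"
proof -
  obtain cs where cs: "set cs \<subseteq> Irr G" "\<And>g. g \<in> carrier G \<Longrightarrow> \<chi> g = (\<Sum>\<psi>\<leftarrow>cs. \<psi> g)"
    using character_sum_list_Irr[OF assms(1)] by blast
  have "char_prod G \<chi> \<psi> = of_nat (count_list cs \<psi>)" if "\<psi> \<in> Irr G" for \<psi>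
  proof -
    have "char_prod G \<chi> \<psi> = (\<Sum>\<phi>\<leftarrow>cs. char_prod G \<phi> \<psi>)"
      unfolding char_prod_sum_list_left[symmetric] by (rule char_prod_cong) (use cs in auto)
    also have "\<dots> = of_nat (count_list cs \<psi>)"
      using cs(1) that by (induction cs) (auto simp: Irr_orthonormal)
    finally show ?thesis .
  qed
  then have "(\<Sum>\<psi>\<in>Irr G. of_nat (char_multiplicity G \<chi> \<psi>) * \<psi> g) = (\<Sum>\<psi>\<in>Irr G. of_nat (count_list cs \<psi>) * \<psi> g)"
    using of_nat_multiplicity[OF assms(1)] by (intro sum.cong) auto
  also have "\<dots> = (\<Sum>\<psi>\<leftarrow>cs. \<psi> g)"
    using cs(1)
  proof (induction cs)
    case (Cons \<phi> cs)
    have "(\<Sum>\<psi>\<in>Irr G. of_nat (count_list (\<phi> # cs) \<psi>) * \<psi> g) =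
      (\<Sum>\<psi>\<in>Irr G. (if \<psi> = \<phi> then \<psi> g else 0) + of_nat (count_list cs \<psi>) * \<psi> g)"
      by (rule sum.cong) (auto simp: algebra_simps)
    then show ?case using Cons finite_Irr by (simp add: sum.distrib)
  qed simp
  finally show ?thesis using cs(2)[OF g] by simp
qed

lemma degree_decomposition:
  assumes "\<chi> \<in> characters G"
  shows "degree_nat G \<chi> = (\<Sum>\<psi>\<in>Irr G. char_multiplicity G \<chi> \<psi> * degree_nat G \<psi>)"
proof -
  have "complex_of_nat (degree_nat G \<chi>) = (\<Sum>\<psi>\<in>Irr G. of_nat (char_multiplicity G \<chi> \<psi>) * \<psi> \<one>)"
    using of_nat_degree[OF assms] character_decomposition[OF assms one_closed] by (rule trans)
  also have "\<dots> = (\<Sum>\<psi>\<in>Irr G. of_nat (char_multiplicity G \<chi> \<psi> * degree_nat G \<psi>))"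
  proof (rule sum.cong[OF refl])
    fix \<psi> assume "\<psi> \<in> Irr G"
    then have "\<psi> \<in> characters G" using Irr_subset_characters[of G] by blast
    then show "of_nat (char_multiplicity G \<chi> \<psi>) * \<psi> \<one> = complex_of_nat (char_multiplicity G \<chi> \<psi> * degree_nat G \<psi>)"
      by (simp add: of_nat_degree)
  qed
  finally have "complex_of_nat (degree_nat G \<chi>) = of_nat (\<Sum>\<psi>\<in>Irr G. char_multiplicity G \<chi> \<psi> * degree_nat G \<psi>)"
    by (simp only: of_nat_sum)
  then show ?thesis by (simp only: of_nat_eq_iff)
qed

lemma multiplicity_Irr:
  assumes "\<chi> \<in> Irr G" and "\<psi> \<in> Irr G"
  shows "char_multiplicity G \<chi> \<psi> = (if \<chi> = \<psi> then 1 else 0)"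
  using Irr_orthonormal[OF assms] by (simp add: char_multiplicity_def)

text \<open>A combination of irreducible characters with natural coefficients is zero or a character.\<close>

lemma natural_combination_zero_or_character:
  assumes "finite A" and "A \<subseteq> Irr G"
  shows "(\<forall>g\<in>carrier G. (\<Sum>\<psi>\<in>A. of_nat (m \<psi>) * \<psi> g) = 0) \<or>
    (\<lambda>g\<in>carrier G. \<Sum>\<psi>\<in>A. of_nat (m \<psi>) * \<psi> g) \<in> characters G"
  using assms
proof (induction A rule: finite_induct)
  case (insert \<phi> A)
  have \<phi>: "\<phi> \<in> characters G" using insert Irr_subset_characters by auto
  have multiple: "(\<lambda>g\<in>carrier G. of_nat (Suc k) * \<phi> g) \<in> characters G" for k
  proof (induction k)
    case 0
    have "(\<lambda>g\<in>carrier G. of_nat (Suc 0) * \<phi> g) = \<phi>"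
      using characters_extensional[OF \<phi>] by (auto simp: extensional_def restrict_def)
    then show ?case using \<phi> by simp
  next
    case (Suc k)
    have eq: "(\<lambda>g\<in>carrier G. of_nat (Suc (Suc k)) * \<phi> g) =
      (\<lambda>g\<in>carrier G. \<phi> g + (\<lambda>g\<in>carrier G. of_nat (Suc k) * \<phi> g) g)"
      by (intro restrict_ext) (simp add: algebra_simps)
    show ?case by (subst eq) (rule characters_add[OF is_group \<phi> Suc])
  qed
  let ?f = "\<lambda>g. \<Sum>\<psi>\<in>A. of_nat (m \<psi>) * \<psi> g"
  have ins: "(\<Sum>\<psi>\<in>insert \<phi> A. of_nat (m \<psi>) * \<psi> g) = of_nat (m \<phi>) * \<phi> g + ?f g" for g
    using insert by simp
  show ?case
  proof (cases "m \<phi>")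
    case 0
    then show ?thesis using insert by simp
  next
    case (Suc k)
    have c: "(\<lambda>g\<in>carrier G. of_nat (m \<phi>) * \<phi> g) \<in> characters G" unfolding Suc by (rule multiple)
    from insert consider "\<forall>g\<in>carrier G. ?f g = 0" | "(\<lambda>g\<in>carrier G. ?f g) \<in> characters G" by blast
    then show ?thesis
    proof cases
      case 1
      then have "(\<lambda>g\<in>carrier G. \<Sum>\<psi>\<in>insert \<phi> A. of_nat (m \<psi>) * \<psi> g) = (\<lambda>g\<in>carrier G. of_nat (m \<phi>) * \<phi> g)"
        unfolding ins by (intro restrict_ext) simp
      then show ?thesis using c by (simp only: simp_thms)
    next
      case 2
      have "(\<lambda>g\<in>carrier G. \<Sum>\<psi>\<in>insert \<phi> A. of_nat (m \<psi>) * \<psi> g) =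
        (\<lambda>g\<in>carrier G. (\<lambda>g\<in>carrier G. of_nat (m \<phi>) * \<phi> g) g + (\<lambda>g\<in>carrier G. ?f g) g)"
        unfolding ins by (intro restrict_ext) simp
      then show ?thesis using characters_add[OF is_group c 2] by (simp only: simp_thms)
    qed
  qed
qed simp

lemma constituent_iff_multiplicity:
  assumes \<chi>: "\<chi> \<in> characters G" and \<theta>: "\<theta> \<in> Irr G"
  shows "constituent G \<theta> \<chi> \<longleftrightarrow> char_multiplicity G \<chi> \<theta> > 0"
proof
  have \<theta>': "\<theta> \<in> characters G" using \<theta> Irr_subset_characters by auto
  assume "constituent G \<theta> \<chi>"
  then consider "\<forall>g\<in>carrier G. \<chi> g = \<theta> g" | \<psi> where "\<psi> \<in> characters G" "\<forall>g\<in>carrier G. \<chi> g = \<theta> g + \<psi> g"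
    unfolding constituent_def by blast
  then show "char_multiplicity G \<chi> \<theta> > 0"
  proof cases
    case 1
    then have "\<chi> = \<theta>" by (intro characters_eqI[OF \<chi> \<theta>']) auto
    then show ?thesis using multiplicity_Irr[OF \<theta> \<theta>] by simp
  next
    case 2
    have "char_prod G \<chi> \<theta> = char_prod G (\<lambda>g. \<theta> g + \<psi> g) \<theta>" using 2 by (intro char_prod_cong) auto
    also have "\<dots> = char_prod G \<theta> \<theta> + char_prod G \<psi> \<theta>"
      by (simp add: char_prod_def distrib_right sum.distrib add_divide_distrib)
    finally have "of_nat (char_multiplicity G \<chi> \<theta>) = (of_nat (1 + char_multiplicity G \<psi> \<theta>) :: complex)"
      using of_nat_multiplicity[OF \<chi> \<theta>] of_nat_multiplicity[OF 2(1) \<theta>] Irr_orthonormal[OF \<theta> \<theta>] by simp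
    then show ?thesis by (simp only: of_nat_eq_iff)
  qed
next
  assume pos: "char_multiplicity G \<chi> \<theta> > 0"
  let ?m = "\<lambda>\<psi>. if \<psi> = \<theta> then char_multiplicity G \<chi> \<psi> - 1 else char_multiplicity G \<chi> \<psi>"
  have eq: "\<chi> g = \<theta> g + (\<Sum>\<psi>\<in>Irr G. of_nat (?m \<psi>) * \<psi> g)" if g: "g \<in> carrier G" for g
  proof -
    have "\<chi> g = (\<Sum>\<psi>\<in>Irr G. (if \<psi> = \<theta> then \<psi> g else 0) + of_nat (?m \<psi>) * \<psi> g)"
      unfolding character_decomposition[OF \<chi> g] using pos
      by (intro sum.cong) (auto simp: of_nat_diff algebra_simps)
    then show ?thesis using finite_Irr \<theta> by (simp add: sum.distrib)
  qed
  from natural_combination_zero_or_character[OF finite_Irr order_refl, of ?m]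
  show "constituent G \<theta> \<chi>"
  proof
    assume "\<forall>g\<in>carrier G. (\<Sum>\<psi>\<in>Irr G. of_nat (?m \<psi>) * \<psi> g) = 0"
    then show ?thesis unfolding constituent_def using eq by simp
  next
    assume "(\<lambda>g\<in>carrier G. \<Sum>\<psi>\<in>Irr G. of_nat (?m \<psi>) * \<psi> g) \<in> characters G"
    then show ?thesis unfolding constituent_def using eq by (intro disjI2 bexI) auto
  qed
qed

end

section \<open>Restriction to subgroups and Clifford theory\<close>

lemma degree_nat_subgroup [simp]: "degree_nat (G\<lparr>carrier := H\<rparr>) = degree_nat G"
  by (simp add: degree_nat_def fun_eq_iff)

lemma sum_mult_pos_iff:
  "finite A \<Longrightarrow> (0::nat) < (\<Sum>x\<in>A. f x * g x) \<longleftrightarrow> (\<exists>x\<in>A. f x > 0 \<and> g x > 0)"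
  by (induction rule: finite_induct) auto

lemma (in group) cancel_inv:
  "x \<in> carrier G \<Longrightarrow> y \<in> carrier G \<Longrightarrow> x \<otimes> (inv x \<otimes> y) = y"
  "x \<in> carrier G \<Longrightarrow> y \<in> carrier G \<Longrightarrow> inv x \<otimes> (x \<otimes> y) = y"
  by (simp_all add: m_assoc[symmetric])

context finite_group
begin

lemma subgroup_finite_group: "subgroup H G \<Longrightarrow> finite_group (G\<lparr>carrier := H\<rparr>)"
  using subgroup.subgroup_is_group[OF _ is_group] finite_subset[OF subgroup.subset fin]
  by (simp add: finite_group_def finite_group_axioms_def)

lemma card_subgroup_pos: "subgroup H G \<Longrightarrow> card H > 0"
  using finite_group.card_pos[OF subgroup_finite_group] by simp

lemma char_prod_subgroup:
  "subgroup H G \<Longrightarrow> char_prod (G\<lparr>carrier := H\<rparr>) f h = (\<Sum>x\<in>H. f x * h (inv x)) / of_nat (card H)"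
  by (simp add: char_prod_def cong: sum.cong)

lemma restrict_character:
  assumes H: "subgroup H G" and "\<chi> \<in> characters G"
  shows "restrict \<chi> H \<in> characters (G\<lparr>carrier := H\<rparr>)"
proof -
  have sub: "H \<subseteq> carrier G" using subgroup.subset[OF H] .
  obtain n R where R: "representation G n R" "\<chi> = rep_character G R"
    using assms(2) unfolding characters_def by blast
  note R' = representationD[OF R(1)]
  have "representation (G\<lparr>carrier := H\<rparr>) n R"
    by (rule representationI)
      (use R' sub subgroup.subgroup_is_group[OF H is_group] representation_one[OF is_group R(1)] in auto)
  moreover have "restrict \<chi> H = rep_character (G\<lparr>carrier := H\<rparr>) R"
    unfolding R(2) rep_character_def using sub by (auto simp: restrict_def fun_eq_iff)
  ultimately show ?thesis unfolding characters_def by blast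
qed

lemma multiplicity_restrict:
  assumes "subgroup H G"
  shows "char_multiplicity (G\<lparr>carrier := H\<rparr>) (restrict \<chi> H) = char_multiplicity (G\<lparr>carrier := H\<rparr>) \<chi>"
  by (rule ext) (simp add: char_multiplicity_def char_prod_subgroup[OF assms] cong: sum.cong)

lemma of_nat_multiplicity_subgroup:
  assumes H: "subgroup H G" and "\<chi> \<in> characters G" and "\<psi> \<in> Irr (G\<lparr>carrier := H\<rparr>)"
  shows "of_nat (char_multiplicity (G\<lparr>carrier := H\<rparr>) \<chi> \<psi>) = char_prod (G\<lparr>carrier := H\<rparr>) \<chi> \<psi>"
proof -
  have "of_nat (char_multiplicity (G\<lparr>carrier := H\<rparr>) (restrict \<chi> H) \<psi>) =
      char_prod (G\<lparr>carrier := H\<rparr>) (restrict \<chi> H) \<psi>"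
    using finite_group.of_nat_multiplicity[OF subgroup_finite_group[OF H]]
      restrict_character[OF H assms(2)] assms(3) by blast
  then show ?thesis
    unfolding multiplicity_restrict[OF H] by (simp add: char_prod_subgroup[OF H] cong: sum.cong)
qed

lemma restriction_decomposition:
  assumes H: "subgroup H G" and "\<chi> \<in> characters G" and x: "x \<in> H"
  shows "\<chi> x = (\<Sum>\<psi>\<in>Irr (G\<lparr>carrier := H\<rparr>). of_nat (char_multiplicity (G\<lparr>carrier := H\<rparr>) \<chi> \<psi>) * \<psi> x)"
  using finite_group.character_decomposition[OF subgroup_finite_group[OF H] restrict_character[OF H assms(2)], of x] x
  unfolding multiplicity_restrict[OF H] by simp

lemma restriction_degree:
  assumes H: "subgroup H G" and "\<chi> \<in> characters G"
  shows "degree_nat G \<chi> = (\<Sum>\<psi>\<in>Irr (G\<lparr>carrier := H\<rparr>). char_multiplicity (G\<lparr>carrier := H\<rparr>) \<chi> \<psi> * degree_nat G \<psi>)"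
proof -
  have "degree_nat G (restrict \<chi> H) = degree_nat G \<chi>"
    using subgroup.one_closed[OF H] by (simp add: degree_nat_def)
  then show ?thesis
    using finite_group.degree_decomposition[OF subgroup_finite_group[OF H] restrict_character[OF H assms(2)]]
    unfolding multiplicity_restrict[OF H] by simp
qed

lemma finite_Irr_subgroup: "subgroup H G \<Longrightarrow> finite (Irr (G\<lparr>carrier := H\<rparr>))"
  using finite_group.finite_Irr[OF subgroup_finite_group] .

lemma degree_Irr_subgroup_pos: "subgroup H G \<Longrightarrow> \<psi> \<in> Irr (G\<lparr>carrier := H\<rparr>) \<Longrightarrow> degree_nat G \<psi> > 0"
  using finite_group.degree_pos[OF subgroup_finite_group, of H \<psi>] Irr_subset_characters by fastforce

lemma multiplicity_trans:
  assumes H: "subgroup H G" and K: "subgroup K G" and HK: "H \<subseteq> K" and \<chi>: "\<chi> \<in> characters G"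
    and \<eta>: "\<eta> \<in> Irr (G\<lparr>carrier := H\<rparr>)"
  shows "char_multiplicity (G\<lparr>carrier := H\<rparr>) \<chi> \<eta> =
    (\<Sum>\<psi>\<in>Irr (G\<lparr>carrier := K\<rparr>). char_multiplicity (G\<lparr>carrier := K\<rparr>) \<chi> \<psi> * char_multiplicity (G\<lparr>carrier := H\<rparr>) \<psi> \<eta>)"
proof -
  interpret K: finite_group "G\<lparr>carrier := K\<rparr>" by (rule subgroup_finite_group[OF K])
  interpret H: finite_group "G\<lparr>carrier := H\<rparr>" by (rule subgroup_finite_group[OF H])
  have HK': "subgroup H (G\<lparr>carrier := K\<rparr>)" using subgroup_incl[OF H K HK] .
  let ?m = "\<lambda>\<psi>. of_nat (char_multiplicity (G\<lparr>carrier := K\<rparr>) \<chi> \<psi>) :: complex"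
  have "of_nat (char_multiplicity (G\<lparr>carrier := H\<rparr>) \<chi> \<eta>) = char_prod (G\<lparr>carrier := H\<rparr>) \<chi> \<eta>"
    by (rule of_nat_multiplicity_subgroup[OF H \<chi> \<eta>])
  also have "\<dots> = char_prod (G\<lparr>carrier := H\<rparr>) (\<lambda>x. \<Sum>\<psi>\<in>Irr (G\<lparr>carrier := K\<rparr>). ?m \<psi> * \<psi> x) \<eta>"
    using restriction_decomposition[OF K \<chi>] HK by (intro H.char_prod_cong) auto
  also have "\<dots> = (\<Sum>\<psi>\<in>Irr (G\<lparr>carrier := K\<rparr>). ?m \<psi> * char_prod (G\<lparr>carrier := H\<rparr>) \<psi> \<eta>)"
    by (rule H.char_prod_sum_left[OF K.finite_Irr])
  also have "\<dots> = (\<Sum>\<psi>\<in>Irr (G\<lparr>carrier := K\<rparr>). ?m \<psi> * of_nat (char_multiplicity (G\<lparr>carrier := H\<rparr>) \<psi> \<eta>))"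
  proof (rule sum.cong[OF refl])
    fix \<psi> assume "\<psi> \<in> Irr (G\<lparr>carrier := K\<rparr>)"
    then have "\<psi> \<in> characters (G\<lparr>carrier := K\<rparr>)" using Irr_subset_characters by blast
    with K.of_nat_multiplicity_subgroup[OF HK' this] \<eta>
    show "?m \<psi> * char_prod (G\<lparr>carrier := H\<rparr>) \<psi> \<eta> = ?m \<psi> * of_nat (char_multiplicity (G\<lparr>carrier := H\<rparr>) \<psi> \<eta>)"
      by simp
  qed
  finally have "of_nat (char_multiplicity (G\<lparr>carrier := H\<rparr>) \<chi> \<eta>) =
    (of_nat (\<Sum>\<psi>\<in>Irr (G\<lparr>carrier := K\<rparr>). char_multiplicity (G\<lparr>carrier := K\<rparr>) \<chi> \<psi> * char_multiplicity (G\<lparr>carrier := H\<rparr>) \<psi> \<eta>) :: complex)"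
    by (simp only: of_nat_sum of_nat_mult)
  then show ?thesis by (simp only: of_nat_eq_iff)
qed

lemma multiplicity_trans_le:
  assumes "subgroup H G" "subgroup K G" "H \<subseteq> K" "\<chi> \<in> characters G" "\<eta> \<in> Irr (G\<lparr>carrier := H\<rparr>)"
    and A: "A \<subseteq> Irr (G\<lparr>carrier := K\<rparr>)"
  shows "(\<Sum>\<psi>\<in>A. char_multiplicity (G\<lparr>carrier := K\<rparr>) \<chi> \<psi> * char_multiplicity (G\<lparr>carrier := H\<rparr>) \<psi> \<eta>)
    \<le> char_multiplicity (G\<lparr>carrier := H\<rparr>) \<chi> \<eta>"
  unfolding multiplicity_trans[OF assms(1-5)]
  by (rule sum_mono2[OF finite_Irr_subgroup[OF assms(2)] A]) simp

lemma multiplicity_trans_pos: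
  assumes "subgroup H G" "subgroup K G" "H \<subseteq> K" "\<chi> \<in> characters G" "\<eta> \<in> Irr (G\<lparr>carrier := H\<rparr>)"
  shows "char_multiplicity (G\<lparr>carrier := H\<rparr>) \<chi> \<eta> > 0 \<longleftrightarrow>
    (\<exists>\<psi>\<in>Irr (G\<lparr>carrier := K\<rparr>). char_multiplicity (G\<lparr>carrier := K\<rparr>) \<chi> \<psi> > 0 \<and> char_multiplicity (G\<lparr>carrier := H\<rparr>) \<psi> \<eta> > 0)"
  unfolding multiplicity_trans[OF assms] by (rule sum_mult_pos_iff[OF finite_Irr_subgroup[OF assms(2)]])

lemma multiplicity_regular:
  "\<chi> \<in> Irr G \<Longrightarrow>
    char_multiplicity G (\<lambda>g\<in>carrier G. if g = \<one> then of_nat (card (carrier G)) else 0) \<chi> = degree_nat G \<chi>"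
  by (simp only: char_multiplicity_def char_prod_regular degree_nat_def)

text \<open>
  This is the degree of the induced character \<open>\<psi>\<^sup>G\<close>, decomposed by Frobenius reciprocity. It results from
  restricting the regular character of \<open>G\<close> to \<open>H\<close>.
\<close>

lemma induction_degree:
  assumes H: "subgroup H G" and \<psi>: "\<psi> \<in> Irr (G\<lparr>carrier := H\<rparr>)"
  shows "card H * (\<Sum>\<chi>\<in>Irr G. char_multiplicity (G\<lparr>carrier := H\<rparr>) \<chi> \<psi> * degree_nat G \<chi>) =
    card (carrier G) * degree_nat G \<psi>"
proof -
  interpret H: finite_group "G\<lparr>carrier := H\<rparr>" by (rule subgroup_finite_group[OF H])
  let ?r = "\<lambda>g\<in>carrier G. if g = \<one> then of_nat (card (carrier G)) else (0 :: complex)"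
  have sub: "H \<subseteq> carrier G" using subgroup.subset[OF H] .
  have \<psi>c: "\<psi> \<in> characters (G\<lparr>carrier := H\<rparr>)" by (rule Irr_character[OF \<psi>])
  have "(\<Sum>x\<in>H. ?r x * \<psi> (inv x)) = (\<Sum>x\<in>H. if x = \<one> then of_nat (card (carrier G)) * \<psi> \<one> else 0)"
    by (rule sum.cong) (use sub in auto)
  also have "\<dots> = of_nat (card (carrier G)) * of_nat (degree_nat G \<psi>)"
    using H.of_nat_degree[OF \<psi>c] subgroup.one_closed[OF H] H.fin by simp
  finally have "of_nat (card H) * char_prod (G\<lparr>carrier := H\<rparr>) ?r \<psi> = of_nat (card (carrier G) * degree_nat G \<psi>)"
    using card_subgroup_pos[OF H] by (simp add: char_prod_subgroup[OF H])
  moreover have "char_prod (G\<lparr>carrier := H\<rparr>) ?r \<psi> =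
    of_nat (\<Sum>\<chi>\<in>Irr G. char_multiplicity (G\<lparr>carrier := H\<rparr>) \<chi> \<psi> * degree_nat G \<chi>)"
  proof -
    have "char_prod (G\<lparr>carrier := H\<rparr>) ?r \<psi> =
      char_prod (G\<lparr>carrier := H\<rparr>) (\<lambda>x. \<Sum>\<chi>\<in>Irr G. of_nat (degree_nat G \<chi>) * \<chi> x) \<psi>"
    proof (rule H.char_prod_cong)
      fix x assume "x \<in> carrier (G\<lparr>carrier := H\<rparr>)"
      then have x: "x \<in> carrier G" using sub by auto
      show "?r x = (\<Sum>\<chi>\<in>Irr G. of_nat (degree_nat G \<chi>) * \<chi> x)"
        using character_decomposition[OF regular_character x] multiplicity_regular by (simp cong: sum.cong)
    qed simp
    also have "\<dots> = (\<Sum>\<chi>\<in>Irr G. of_nat (degree_nat G \<chi>) * char_prod (G\<lparr>carrier := H\<rparr>) \<chi> \<psi>)"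
      by (rule H.char_prod_sum_left[OF finite_Irr])
    also have "\<dots> = (\<Sum>\<chi>\<in>Irr G. of_nat (char_multiplicity (G\<lparr>carrier := H\<rparr>) \<chi> \<psi> * degree_nat G \<chi>))"
    proof (rule sum.cong[OF refl])
      fix \<chi> assume "\<chi> \<in> Irr G"
      then have "\<chi> \<in> characters G" using Irr_subset_characters by blast
      from of_nat_multiplicity_subgroup[OF H this \<psi>]
      show "of_nat (degree_nat G \<chi>) * char_prod (G\<lparr>carrier := H\<rparr>) \<chi> \<psi> =
        of_nat (char_multiplicity (G\<lparr>carrier := H\<rparr>) \<chi> \<psi> * degree_nat G \<chi>)" by simp
    qed
    finally show ?thesis by simp
  qed
  ultimately have "complex_of_nat (card H * (\<Sum>\<chi>\<in>Irr G. char_multiplicity (G\<lparr>carrier := H\<rparr>) \<chi> \<psi> * degree_nat G \<chi>)) =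
    of_nat (card (carrier G) * degree_nat G \<psi>)" by (simp only: of_nat_mult)
  then show ?thesis by (simp only: of_nat_eq_iff)
qed

lemma lies_above_iff_multiplicity:
  assumes H: "subgroup H G" and "\<chi> \<in> characters G" and "\<theta> \<in> Irr (G\<lparr>carrier := H\<rparr>)"
  shows "lies_above G H \<chi> \<theta> \<longleftrightarrow> char_multiplicity (G\<lparr>carrier := H\<rparr>) \<chi> \<theta> > 0"
  unfolding lies_above_def multiplicity_restrict[OF H, of \<chi>, symmetric]
  by (rule finite_group.constituent_iff_multiplicity[OF subgroup_finite_group[OF H] restrict_character[OF H assms(2)] assms(3)])

lemma Irr_above_eq:
  assumes "subgroup H G" and "\<theta> \<in> Irr (G\<lparr>carrier := H\<rparr>)"
  shows "Irr_above G H \<theta> = {\<chi> \<in> Irr G. char_multiplicity (G\<lparr>carrier := H\<rparr>) \<chi> \<theta> > 0}"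
  unfolding Irr_above_def using lies_above_iff_multiplicity[OF assms(1) _ assms(2)] Irr_subset_characters by blast

lemma Irr_above_nonempty:
  assumes H: "subgroup H G" and \<theta>: "\<theta> \<in> Irr (G\<lparr>carrier := H\<rparr>)"
  shows "Irr_above G H \<theta> \<noteq> {}"
proof
  assume "Irr_above G H \<theta> = {}"
  then have "char_multiplicity (G\<lparr>carrier := H\<rparr>) \<chi> \<theta> = 0" if "\<chi> \<in> Irr G" for \<chi>
    using that Irr_above_eq[OF assms] by auto
  then have "card (carrier G) * degree_nat G \<theta> = 0" using induction_degree[OF assms] by simp
  then show False using card_pos degree_Irr_subgroup_pos[OF assms] by simp
qed

definition conj_char :: "'a set \<Rightarrow> 'a \<Rightarrow> ('a \<Rightarrow> complex) \<Rightarrow> 'a \<Rightarrow> complex" where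
  "conj_char N g \<eta> = (\<lambda>x\<in>N. \<eta> (g \<otimes> x \<otimes> inv g))"

definition stabilizer :: "'a set \<Rightarrow> ('a \<Rightarrow> complex) \<Rightarrow> 'a set" where
  "stabilizer N \<eta> = {g \<in> carrier G. \<forall>x\<in>N. \<eta> (g \<otimes> x \<otimes> inv g) = \<eta> x}"

definition char_orbit :: "'a set \<Rightarrow> ('a \<Rightarrow> complex) \<Rightarrow> ('a \<Rightarrow> complex) set" where
  "char_orbit N \<eta> = (\<lambda>g. conj_char N g \<eta>) ` carrier G"

end

locale finite_group_normal = finite_group +
  fixes N assumes normal: "N \<lhd> G"

lemma (in finite_group) finite_group_normalI: "K \<lhd> G \<Longrightarrow> finite_group_normal G K"
  using finite_group_axioms by (simp add: finite_group_normal_def finite_group_normal_axioms_def)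

context finite_group_normal
begin

lemma subgroup_N: "subgroup N G"
  using normal by (rule normal_imp_subgroup)

lemma N_subset: "N \<subseteq> carrier G"
  using subgroup.subset[OF subgroup_N] .

lemma finite_group_N: "finite_group (G\<lparr>carrier := N\<rparr>)"
  by (rule subgroup_finite_group[OF subgroup_N])

lemma conj_closed: "g \<in> carrier G \<Longrightarrow> x \<in> N \<Longrightarrow> g \<otimes> x \<otimes> inv g \<in> N"
  using normal by (rule normal.inv_op_closed2)

lemma sum_conjugate_N:
  assumes "g \<in> carrier G"
  shows "(\<Sum>x\<in>N. F (g \<otimes> x \<otimes> inv g)) = (\<Sum>x\<in>N. F x)"
proof (rule sum.reindex_bij_witness[of _ "\<lambda>x. inv g \<otimes> x \<otimes> inv (inv g)" "\<lambda>x. g \<otimes> x \<otimes> inv g"])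
  fix x assume "x \<in> N"
  moreover from this have "x \<in> carrier G" using N_subset by auto
  ultimately show "inv g \<otimes> (g \<otimes> x \<otimes> inv g) \<otimes> inv (inv g) = x" "g \<otimes> x \<otimes> inv g \<in> N"
    "g \<otimes> (inv g \<otimes> x \<otimes> inv (inv g)) \<otimes> inv g = x" "inv g \<otimes> x \<otimes> inv (inv g) \<in> N"
    using assms conj_closed[of g x] conj_closed[of "inv g" x]
    by (simp_all add: m_assoc cancel_inv)
qed simp

lemma conj_irreducible_representation:
  assumes g: "g \<in> carrier G" and R: "irreducible_representation (G\<lparr>carrier := N\<rparr>) n R"
  shows "irreducible_representation (G\<lparr>carrier := N\<rparr>) n (R \<circ> (\<lambda>x. g \<otimes> x \<otimes> inv g))"
proof -
  interpret N: finite_group "G\<lparr>carrier := N\<rparr>" by (rule finite_group_N)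
  let ?c = "\<lambda>x. g \<otimes> x \<otimes> inv g"
  note D = irreducible_representationD[OF R]
  note R' = representationD[OF D(1)]
  have "representation (G\<lparr>carrier := N\<rparr>) n (R \<circ> ?c)"
  proof (rule representationI[OF N.is_group R'(1)])
    show "(R \<circ> ?c) x \<in> carrier_mat n n" if "x \<in> carrier (G\<lparr>carrier := N\<rparr>)" for x
      using R'(2)[of "?c x"] conj_closed[OF g] that by simp
    show "(R \<circ> ?c) (x \<otimes>\<^bsub>G\<lparr>carrier := N\<rparr>\<^esub> y) = (R \<circ> ?c) x * (R \<circ> ?c) y"
      if "x \<in> carrier (G\<lparr>carrier := N\<rparr>)" "y \<in> carrier (G\<lparr>carrier := N\<rparr>)" for x y
    proof -
      have xy: "x \<in> carrier G" "y \<in> carrier G" "x \<in> N" "y \<in> N" using that N_subset by auto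
      have "?c (x \<otimes> y) = ?c x \<otimes> ?c y"
        using g xy by (simp add: m_assoc cancel_inv)
      then show ?thesis using R'(3)[of "?c x" "?c y"] conj_closed[OF g] xy by simp
    qed
    have "?c \<one> = \<one>" using g by simp
    then show "(R \<circ> ?c) \<one>\<^bsub>G\<lparr>carrier := N\<rparr>\<^esub> = 1\<^sub>m n"
      using representation_one[OF N.is_group D(1)] by simp
  qed
  moreover have "W = {0\<^sub>v n} \<or> W = carrier_vec n"
    if W: "VectorSpace.subspace class_ring W (module_vec TYPE(complex) n)"
      and inv: "\<forall>x\<in>carrier (G\<lparr>carrier := N\<rparr>). \<forall>w\<in>W. (R \<circ> ?c) x *\<^sub>v w \<in> W" for W
  proof -
    have "R x *\<^sub>v w \<in> W" if x: "x \<in> N" "w \<in> W" for x w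
    proof -
      have x': "x \<in> carrier G" using x N_subset by auto
      have "inv g \<otimes> x \<otimes> g \<in> N" using conj_closed[of "inv g" x] g x by simp
      moreover have "?c (inv g \<otimes> x \<otimes> g) = x" using g x' by (simp add: m_assoc cancel_inv)
      ultimately show ?thesis using inv x(2) by force
    qed
    then show ?thesis using R W unfolding irreducible_representation_def by simp
  qed
  ultimately show ?thesis
    unfolding irreducible_representation_def by blast
qed

lemma conj_rep_character:
  assumes g: "g \<in> carrier G"
  shows "conj_char N g (rep_character (G\<lparr>carrier := N\<rparr>) R) =
    rep_character (G\<lparr>carrier := N\<rparr>) (R \<circ> (\<lambda>x. g \<otimes> x \<otimes> inv g))"
  unfolding conj_char_def rep_character_def using conj_closed[OF g] by (auto intro!: restrict_ext)

lemma conj_char_Irr: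
  assumes g: "g \<in> carrier G" and \<eta>: "\<eta> \<in> Irr (G\<lparr>carrier := N\<rparr>)"
  shows "conj_char N g \<eta> \<in> Irr (G\<lparr>carrier := N\<rparr>)"
proof -
  obtain n R where R: "irreducible_representation (G\<lparr>carrier := N\<rparr>) n R" and \<eta>': "\<eta> = rep_character (G\<lparr>carrier := N\<rparr>) R"
    using \<eta> unfolding Irr_def by blast
  show ?thesis
    unfolding \<eta>' conj_rep_character[OF g] Irr_def using conj_irreducible_representation[OF g R] by blast
qed

lemma conj_char_mult:
  assumes "g \<in> carrier G" and "h \<in> carrier G"
  shows "conj_char N h (conj_char N g \<eta>) = conj_char N (g \<otimes> h) \<eta>"
  unfolding conj_char_def
proof (rule restrict_ext)
  fix x assume x: "x \<in> N"
  then have "x \<in> carrier G" using N_subset by auto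
  then show "(\<lambda>x\<in>N. \<eta> (g \<otimes> x \<otimes> inv g)) (h \<otimes> x \<otimes> inv h) = \<eta> (g \<otimes> h \<otimes> x \<otimes> inv (g \<otimes> h))"
    using conj_closed[OF assms(2) x] assms by (simp add: m_assoc inv_mult_group)
qed

lemma multiplicity_conj_char:
  assumes g: "g \<in> carrier G" and \<chi>: "\<chi> \<in> characters G"
  shows "char_multiplicity (G\<lparr>carrier := N\<rparr>) \<chi> (conj_char N g \<eta>) = char_multiplicity (G\<lparr>carrier := N\<rparr>) \<chi> \<eta>"
proof -
  have "(\<Sum>x\<in>N. \<chi> x * conj_char N g \<eta> (inv x)) = (\<Sum>x\<in>N. \<chi> (g \<otimes> x \<otimes> inv g) * \<eta> (inv (g \<otimes> x \<otimes> inv g)))"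
  proof (rule sum.cong[OF refl])
    fix x assume x: "x \<in> N"
    then have x': "x \<in> carrier G" "inv x \<in> N" using N_subset subgroup.m_inv_closed[OF subgroup_N] by auto
    have "inv (g \<otimes> x \<otimes> inv g) = g \<otimes> inv x \<otimes> inv g" using g x' by (simp add: inv_mult_group m_assoc)
    then show "\<chi> x * conj_char N g \<eta> (inv x) = \<chi> (g \<otimes> x \<otimes> inv g) * \<eta> (inv (g \<otimes> x \<otimes> inv g))"
      using character_class_function[OF \<chi> g x'(1)] x' by (simp add: conj_char_def)
  qed
  also have "\<dots> = (\<Sum>x\<in>N. \<chi> x * \<eta> (inv x))" by (rule sum_conjugate_N[OF g, of "\<lambda>x. \<chi> x * \<eta> (inv x)"])
  finally show ?thesis by (simp add: char_multiplicity_def char_prod_subgroup[OF subgroup_N])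
qed

lemma degree_conj_char: "g \<in> carrier G \<Longrightarrow> degree_nat G (conj_char N g \<eta>) = degree_nat G \<eta>"
  using subgroup.one_closed[OF subgroup_N] by (simp add: degree_nat_def conj_char_def)

lemma conj_char_one:
  assumes "\<eta> \<in> Irr (G\<lparr>carrier := N\<rparr>)"
  shows "conj_char N \<one> \<eta> = \<eta>"
proof -
  have "\<eta> \<in> extensional N" using characters_extensional assms Irr_subset_characters by fastforce
  then show ?thesis unfolding conj_char_def using N_subset
    by (intro extensionalityI[of _ N]) (auto simp: subset_iff)
qed

text \<open>
  A set \<open>S\<close> of irreducible characters of \<open>N\<close> that is stable under \<open>G\<close> gives a class function
  \<open>\<Sum>\<^sub>\<eta> \<eta>\<close> of \<open>G\<close>, supported on \<open>N\<close>. Its convolution with \<open>\<chi>\<close> is a multiple of \<open>\<chi>\<close>, but it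
  also picks out the constituents of \<open>\<chi>\<^sub>N\<close> that belong to \<open>S\<close>.
\<close>

theorem constituents_in_stable_set:
  assumes S: "S \<subseteq> Irr (G\<lparr>carrier := N\<rparr>)" "\<And>g \<eta>. g \<in> carrier G \<Longrightarrow> \<eta> \<in> S \<Longrightarrow> conj_char N g \<eta> \<in> S"
    and \<chi>: "\<chi> \<in> Irr G" and \<eta>: "\<eta> \<in> S" "char_multiplicity (G\<lparr>carrier := N\<rparr>) \<chi> \<eta> > 0"
    and \<psi>: "\<psi> \<in> Irr (G\<lparr>carrier := N\<rparr>)" "char_multiplicity (G\<lparr>carrier := N\<rparr>) \<chi> \<psi> > 0"
  shows "\<psi> \<in> S"
proof (rule ccontr)
  assume n: "\<psi> \<notin> S"
  interpret N: finite_group "G\<lparr>carrier := N\<rparr>" by (rule finite_group_N)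
  let ?N = "G\<lparr>carrier := N\<rparr>"
  let ?m = "\<lambda>\<eta>. of_nat (char_multiplicity ?N \<chi> \<eta>) :: complex"
  have \<chi>c: "\<chi> \<in> characters G" by (rule Irr_character[OF \<chi>])
  have finO: "finite S" using S(1) N.finite_Irr finite_subset by blast
  have inj: "inj_on (conj_char N g) S" if g: "g \<in> carrier G" for g
  proof (rule inj_on_inverseI[of _ "conj_char N (inv g)"])
    show "conj_char N (inv g) (conj_char N g \<eta>) = \<eta>" if "\<eta> \<in> S" for \<eta>
      using conj_char_mult[of g "inv g" \<eta>] conj_char_one that S(1) g by auto
  qed
  have bij: "conj_char N g ` S = S" if g: "g \<in> carrier G" for g
    by (rule endo_inj_surj[OF finO _ inj[OF g]]) (use S(2) g in auto)
  define f where "f x = (if x \<in> N then \<Sum>\<eta>\<in>S. \<eta> x else 0)" for x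
  have cl: "f (g \<otimes> x \<otimes> inv g) = f x" if g: "g \<in> carrier G" and x: "x \<in> carrier G" for g x
  proof (cases "x \<in> N")
    case True
    have "(\<Sum>\<eta>\<in>S. \<eta> (g \<otimes> x \<otimes> inv g)) = (\<Sum>\<eta>\<in>S. conj_char N g \<eta> x)"
      using True by (simp add: conj_char_def)
    also have "\<dots> = (\<Sum>\<eta>\<in>conj_char N g ` S. \<eta> x)" by (subst sum.reindex[OF inj[OF g]]) simp
    finally show ?thesis using True conj_closed[OF g True] bij[OF g] by (simp add: f_def)
  next
    case False
    have "g \<otimes> x \<otimes> inv g \<notin> N"
    proof
      assume "g \<otimes> x \<otimes> inv g \<in> N"
      from conj_closed[of "inv g", OF _ this] have "x \<in> N"
        using g x by (simp add: m_assoc cancel_inv)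
      with False show False by simp
    qed
    then show ?thesis using False by (simp add: f_def)
  qed
  have fsum: "(\<Sum>g\<in>carrier G. f g * F g) = (\<Sum>\<eta>\<in>S. \<Sum>g\<in>N. \<eta> g * F g)" for F
  proof -
    have "(\<Sum>g\<in>carrier G. f g * F g) = (\<Sum>g\<in>N. f g * F g)"
      by (rule sum.mono_neutral_right[OF fin N_subset]) (simp add: f_def)
    also have "\<dots> = (\<Sum>g\<in>N. \<Sum>\<eta>\<in>S. \<eta> g * F g)" by (simp add: f_def sum_distrib_right)
    finally show ?thesis by (simp add: sum.swap[of _ S N])
  qed
  \<comment> \<open>By orthogonality, \<open>\<eta>\<close> picks the \<open>\<eta>\<close>-part out of \<open>\<chi>\<^sub>N\<close>.\<close>
  have inner: "(\<Sum>g\<in>N. \<eta> g * \<chi> (h \<otimes> inv g)) = of_nat (card N) * ?m \<eta> * \<eta> h / \<eta> \<one>"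
    if h: "h \<in> N" and \<eta>: "\<eta> \<in> Irr ?N" for h \<eta>
  proof -
    have \<eta>c: "\<eta> \<in> characters ?N" by (rule Irr_character[OF \<eta>])
    have "(\<Sum>g\<in>N. \<eta> g * \<chi> (h \<otimes> inv g)) = (\<Sum>g\<in>N. \<Sum>\<phi>\<in>Irr ?N. ?m \<phi> * (\<eta> g * \<phi> (h \<otimes> inv g)))"
    proof (rule sum.cong[OF refl])
      fix g assume "g \<in> N"
      then have "h \<otimes> inv g \<in> N" using h subgroup_N by (simp add: subgroup.m_closed subgroup.m_inv_closed)
      from restriction_decomposition[OF subgroup_N \<chi>c this]
      show "\<eta> g * \<chi> (h \<otimes> inv g) = (\<Sum>\<phi>\<in>Irr ?N. ?m \<phi> * (\<eta> g * \<phi> (h \<otimes> inv g)))"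
        by (simp add: sum_distrib_left mult.left_commute)
    qed
    also have "\<dots> = (\<Sum>\<phi>\<in>Irr ?N. ?m \<phi> * (\<Sum>g\<in>N. \<eta> g * \<phi> (h \<otimes> inv g)))"
      by (subst sum.swap) (simp add: sum_distrib_left)
    also have "\<dots> = (\<Sum>\<phi>\<in>Irr ?N. if \<phi> = \<eta> then ?m \<phi> * (of_nat (card N) * \<eta> h / \<eta> \<one>) else 0)"
    proof (rule sum.cong[OF refl])
      fix \<phi> assume \<phi>: "\<phi> \<in> Irr ?N"
      have nz: "\<phi> \<one> \<noteq> 0" using N.character_one[of \<phi>] \<phi> Irr_subset_characters by force
      have "\<phi> \<one> * (\<Sum>g\<in>N. \<eta> g * \<phi> (h \<otimes> inv g)) = of_nat (card N) * char_prod ?N \<eta> \<phi> * \<phi> h"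
        using N.Irr_convolution[OF \<phi> N.character_class_function[OF \<eta>c], of h] h subgroup_N
        by (simp cong: sum.cong)
      then have "\<phi> \<one> * (\<Sum>g\<in>N. \<eta> g * \<phi> (h \<otimes> inv g)) = (if \<phi> = \<eta> then of_nat (card N) * \<eta> h else 0)"
        using N.Irr_orthonormal[OF \<eta> \<phi>] by (cases "\<phi> = \<eta>") auto
      then show "?m \<phi> * (\<Sum>g\<in>N. \<eta> g * \<phi> (h \<otimes> inv g)) =
          (if \<phi> = \<eta> then ?m \<phi> * (of_nat (card N) * \<eta> h / \<eta> \<one>) else 0)"
        using nz by (auto simp: field_simps)
    qed
    also have "\<dots> = of_nat (card N) * ?m \<eta> * \<eta> h / \<eta> \<one>"
      using \<eta> N.finite_Irr by simp
    finally show ?thesis .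
  qed
  have key: "(\<Sum>\<eta>\<in>S. (\<chi> \<one> * ?m \<eta> / \<eta> \<one>) * \<eta> h) = (\<Sum>\<eta>\<in>S. ?m \<eta>) * \<chi> h" if h: "h \<in> N" for h
  proof -
    have hG: "h \<in> carrier G" using h N_subset by auto
    have "\<chi> \<one> * (\<Sum>\<eta>\<in>S. \<Sum>g\<in>N. \<eta> g * \<chi> (h \<otimes> inv g)) =
      of_nat (card (carrier G)) * char_prod G f \<chi> * \<chi> h"
      using Irr_convolution[OF \<chi> cl hG] by (simp only: fsum)
    also have "of_nat (card (carrier G)) * char_prod G f \<chi> = (\<Sum>\<eta>\<in>S. \<Sum>g\<in>N. \<eta> g * \<chi> (inv g))"
      using card_pos by (simp add: char_prod_def fsum)
    also have "\<dots> = of_nat (card N) * (\<Sum>\<eta>\<in>S. ?m \<eta>)"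
      unfolding sum_distrib_left
    proof (rule sum.cong[OF refl])
      fix \<eta> assume "\<eta> \<in> S"
      then have \<eta>: "\<eta> \<in> Irr ?N" using S by auto
      have "?m \<eta> = char_prod ?N \<eta> \<chi>"
        unfolding of_nat_multiplicity_subgroup[OF subgroup_N \<chi>c \<eta>] by (rule N.char_prod_commute)
      then show "(\<Sum>g\<in>N. \<eta> g * \<chi> (inv g)) = of_nat (card N) * ?m \<eta>"
        using card_subgroup_pos[OF subgroup_N] by (simp add: char_prod_subgroup[OF subgroup_N])
    qed
    finally have e1: "\<chi> \<one> * (\<Sum>\<eta>\<in>S. \<Sum>g\<in>N. \<eta> g * \<chi> (h \<otimes> inv g)) =
      of_nat (card N) * (\<Sum>\<eta>\<in>S. ?m \<eta>) * \<chi> h" .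
    have "\<chi> \<one> * (\<Sum>\<eta>\<in>S. \<Sum>g\<in>N. \<eta> g * \<chi> (h \<otimes> inv g)) =
      (\<Sum>\<eta>\<in>S. \<chi> \<one> * (\<Sum>g\<in>N. \<eta> g * \<chi> (h \<otimes> inv g)))" by (rule sum_distrib_left)
    also have "\<dots> = (\<Sum>\<eta>\<in>S. of_nat (card N) * ((\<chi> \<one> * ?m \<eta> / \<eta> \<one>) * \<eta> h))"
    proof (rule sum.cong[OF refl])
      fix \<eta> assume "\<eta> \<in> S"
      then have \<eta>: "\<eta> \<in> Irr ?N" using S by auto
      show "\<chi> \<one> * (\<Sum>g\<in>N. \<eta> g * \<chi> (h \<otimes> inv g)) = of_nat (card N) * ((\<chi> \<one> * ?m \<eta> / \<eta> \<one>) * \<eta> h)"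
        unfolding inner[OF h \<eta>] by (simp add: mult_ac)
    qed
    also have "\<dots> = of_nat (card N) * (\<Sum>\<eta>\<in>S. (\<chi> \<one> * ?m \<eta> / \<eta> \<one>) * \<eta> h)"
      by (rule sum_distrib_left[symmetric])
    finally have "\<chi> \<one> * (\<Sum>\<eta>\<in>S. \<Sum>g\<in>N. \<eta> g * \<chi> (h \<otimes> inv g)) =
      of_nat (card N) * (\<Sum>\<eta>\<in>S. (\<chi> \<one> * ?m \<eta> / \<eta> \<one>) * \<eta> h)" .
    with e1 have "of_nat (card N) * (\<Sum>\<eta>\<in>S. (\<chi> \<one> * ?m \<eta> / \<eta> \<one>) * \<eta> h) =
      of_nat (card N) * ((\<Sum>\<eta>\<in>S. ?m \<eta>) * \<chi> h)" by (simp only: mult.assoc)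
    then show ?thesis using card_subgroup_pos[OF subgroup_N] by simp
  qed
  \<comment> \<open>Both sides of \<open>key\<close> are paired with \<open>\<psi>\<close>: the combination of \<open>S\<close> is orthogonal to \<open>\<psi>\<close>, while \<open>\<chi>\<close> is not.\<close>
  have "char_prod ?N (\<lambda>h. (\<Sum>\<eta>\<in>S. ?m \<eta>) * \<chi> h) \<psi> =
    char_prod ?N (\<lambda>h. \<Sum>\<eta>\<in>S. (\<chi> \<one> * ?m \<eta> / \<eta> \<one>) * \<eta> h) \<psi>"
  proof (rule N.char_prod_cong)
    show "(\<Sum>\<eta>\<in>S. ?m \<eta>) * \<chi> h = (\<Sum>\<eta>\<in>S. (\<chi> \<one> * ?m \<eta> / \<eta> \<one>) * \<eta> h)" if "h \<in> carrier ?N" for h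
      using that by (intro key[symmetric]) simp
  qed simp
  also have "\<dots> = (\<Sum>\<eta>\<in>S. (\<chi> \<one> * ?m \<eta> / \<eta> \<one>) * char_prod ?N \<eta> \<psi>)"
    by (rule N.char_prod_sum_left[OF finO])
  also have "\<dots> = 0"
  proof (rule sum.neutral, rule ballI)
    fix \<eta> assume "\<eta> \<in> S"
    then show "(\<chi> \<one> * ?m \<eta> / \<eta> \<one>) * char_prod ?N \<eta> \<psi> = 0"
      using N.Irr_orthonormal[of \<eta> \<psi>] S(1) n \<psi>(1) by auto
  qed
  finally have "(\<Sum>\<eta>\<in>S. ?m \<eta>) * ?m \<psi> = 0"
    unfolding of_nat_multiplicity_subgroup[OF subgroup_N \<chi>c \<psi>(1)]
    by (simp add: char_prod_def sum_distrib_left mult.assoc)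
  then have "(\<Sum>\<eta>\<in>S. char_multiplicity ?N \<chi> \<eta>) = 0"
    using \<psi>(2) by (simp flip: of_nat_sum)
  then show False using \<eta> finO by simp
qed

lemma stabilizer_iff:
  assumes "\<eta> \<in> Irr (G\<lparr>carrier := N\<rparr>)"
  shows "g \<in> stabilizer N \<eta> \<longleftrightarrow> g \<in> carrier G \<and> conj_char N g \<eta> = \<eta>"
proof -
  have e: "\<eta> \<in> extensional N" using characters_extensional assms Irr_subset_characters by fastforce
  have "(\<forall>x\<in>N. \<eta> (g \<otimes> x \<otimes> inv g) = \<eta> x) \<longleftrightarrow> conj_char N g \<eta> = \<eta>"
  proof
    assume "\<forall>x\<in>N. \<eta> (g \<otimes> x \<otimes> inv g) = \<eta> x"
    then show "conj_char N g \<eta> = \<eta>"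
      using e by (intro extensionalityI[of _ N]) (auto simp: conj_char_def)
  next
    assume c: "conj_char N g \<eta> = \<eta>"
    show "\<forall>x\<in>N. \<eta> (g \<otimes> x \<otimes> inv g) = \<eta> x"
    proof
      fix x assume "x \<in> N"
      then show "\<eta> (g \<otimes> x \<otimes> inv g) = \<eta> x" using fun_cong[OF c, of x] by (simp add: conj_char_def)
    qed
  qed
  then show ?thesis unfolding stabilizer_def by blast
qed

lemma stabilizer_subgroup:
  assumes \<eta>: "\<eta> \<in> Irr (G\<lparr>carrier := N\<rparr>)"
  shows "subgroup (stabilizer N \<eta>) G"
proof (rule subgroupI)
  show "stabilizer N \<eta> \<subseteq> carrier G" by (auto simp: stabilizer_def)
  have "\<one> \<in> stabilizer N \<eta>" using conj_char_one[OF \<eta>] by (simp add: stabilizer_iff[OF \<eta>])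
  then show "stabilizer N \<eta> \<noteq> {}" by blast
  show "g \<otimes> h \<in> stabilizer N \<eta>" if "g \<in> stabilizer N \<eta>" "h \<in> stabilizer N \<eta>" for g h
    using that conj_char_mult[of g h \<eta>] by (simp add: stabilizer_iff[OF \<eta>])
  show "inv g \<in> stabilizer N \<eta>" if "g \<in> stabilizer N \<eta>" for g
    using that conj_char_mult[of g "inv g" \<eta>] conj_char_one[OF \<eta>] by (simp add: stabilizer_iff[OF \<eta>])
qed

lemma N_subset_stabilizer:
  assumes \<eta>: "\<eta> \<in> Irr (G\<lparr>carrier := N\<rparr>)"
  shows "N \<subseteq> stabilizer N \<eta>"
proof
  fix g assume g: "g \<in> N"
  have "\<eta> \<in> characters (G\<lparr>carrier := N\<rparr>)" by (rule Irr_character[OF \<eta>])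
  from finite_group.character_class_function[OF finite_group_N this]
  have "\<eta> (g \<otimes> x \<otimes> inv g) = \<eta> x" if "x \<in> N" for x using that g subgroup_N by simp
  then show "g \<in> stabilizer N \<eta>" using g N_subset by (auto simp: stabilizer_def)
qed

lemma char_orbit_subset:
  "\<eta> \<in> Irr (G\<lparr>carrier := N\<rparr>) \<Longrightarrow> char_orbit N \<eta> \<subseteq> Irr (G\<lparr>carrier := N\<rparr>)"
  using conj_char_Irr by (auto simp: char_orbit_def)

lemma self_in_char_orbit:
  assumes "\<eta> \<in> Irr (G\<lparr>carrier := N\<rparr>)" shows "\<eta> \<in> char_orbit N \<eta>"
  unfolding char_orbit_def by (rule image_eqI[of _ _ "\<one>"]) (use conj_char_one[OF assms] in auto)

lemma card_orbit_stabilizer: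
  assumes \<eta>: "\<eta> \<in> Irr (G\<lparr>carrier := N\<rparr>)"
  shows "card (char_orbit N \<eta>) * card (stabilizer N \<eta>) = card (carrier G)"
proof -
  let ?T = "stabilizer N \<eta>"
  have TG: "?T \<subseteq> carrier G" by (auto simp: stabilizer_def)
  have "card (carrier G) = (\<Sum>\<phi>\<in>char_orbit N \<eta>. card {g \<in> carrier G. conj_char N g \<eta> = \<phi>})"
    unfolding char_orbit_def using sum.image_gen[OF fin, of "\<lambda>_. 1::nat" "\<lambda>g. conj_char N g \<eta>"] by simp
  also have "\<dots> = (\<Sum>\<phi>\<in>char_orbit N \<eta>. card ?T)"
  proof (rule sum.cong[OF refl])
    fix \<phi> assume "\<phi> \<in> char_orbit N \<eta>"
    then obtain h where h: "h \<in> carrier G" "\<phi> = conj_char N h \<eta>" by (auto simp: char_orbit_def)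
    have "{g \<in> carrier G. conj_char N g \<eta> = \<phi>} = (\<lambda>t. t \<otimes> h) ` ?T"
    proof (intro equalityI subsetI)
      fix g assume "g \<in> {g \<in> carrier G. conj_char N g \<eta> = \<phi>}"
      then have g: "g \<in> carrier G" "conj_char N g \<eta> = conj_char N h \<eta>" using h by auto
      have "conj_char N (g \<otimes> inv h) \<eta> = conj_char N (h \<otimes> inv h) \<eta>"
        using conj_char_mult[OF g(1), of "inv h" \<eta>] conj_char_mult[OF h(1), of "inv h" \<eta>] g h by simp
      then have "g \<otimes> inv h \<in> ?T" using conj_char_one[OF \<eta>] g h by (simp add: stabilizer_iff[OF \<eta>])
      then show "g \<in> (\<lambda>t. t \<otimes> h) ` ?T" using g h by (intro image_eqI[of _ _ "g \<otimes> inv h"]) (simp_all add: m_assoc)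
    next
      fix g assume "g \<in> (\<lambda>t. t \<otimes> h) ` ?T"
      then obtain t where t: "t \<in> carrier G" "conj_char N t \<eta> = \<eta>" "g = t \<otimes> h" using stabilizer_iff[OF \<eta>] by auto
      then show "g \<in> {g \<in> carrier G. conj_char N g \<eta> = \<phi>}"
        using conj_char_mult[OF t(1) h(1), of \<eta>] h by simp
    qed
    moreover have "inj_on (\<lambda>t. t \<otimes> h) ?T"
      using TG h by (intro inj_onI) (metis right_cancel subsetD)
    ultimately show "card {g \<in> carrier G. conj_char N g \<eta> = \<phi>} = card ?T" by (simp add: card_image)
  qed
  finally show ?thesis by simp
qed

text \<open>
  The constituents of \<open>\<chi>\<^sub>N\<close> form one orbit, and conjugate constituents have the same multiplicity.
\<close>

theorem Clifford_degree:
  assumes \<eta>: "\<eta> \<in> Irr (G\<lparr>carrier := N\<rparr>)" and \<chi>: "\<chi> \<in> Irr G"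
    and pos: "char_multiplicity (G\<lparr>carrier := N\<rparr>) \<chi> \<eta> > 0"
  shows "degree_nat G \<chi> = char_multiplicity (G\<lparr>carrier := N\<rparr>) \<chi> \<eta> * card (char_orbit N \<eta>) * degree_nat G \<eta>"
proof -
  let ?N = "G\<lparr>carrier := N\<rparr>"
  have \<chi>c: "\<chi> \<in> characters G" by (rule Irr_character[OF \<chi>])
  have st: "conj_char N g \<phi> \<in> char_orbit N \<eta>" if "g \<in> carrier G" "\<phi> \<in> char_orbit N \<eta>" for g \<phi>
    using that conj_char_mult by (auto simp: char_orbit_def)
  have "degree_nat G \<chi> = (\<Sum>\<psi>\<in>Irr ?N. char_multiplicity ?N \<chi> \<psi> * degree_nat G \<psi>)"
    by (rule restriction_degree[OF subgroup_N \<chi>c])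
  also have "\<dots> = (\<Sum>\<psi>\<in>char_orbit N \<eta>. char_multiplicity ?N \<chi> \<psi> * degree_nat G \<psi>)"
  proof (rule sum.mono_neutral_right[OF finite_Irr_subgroup[OF subgroup_N] char_orbit_subset[OF \<eta>]], rule ballI)
    fix \<psi> assume "\<psi> \<in> Irr ?N - char_orbit N \<eta>"
    then have "char_multiplicity ?N \<chi> \<psi> = 0"
      using constituents_in_stable_set[OF char_orbit_subset[OF \<eta>] st \<chi> self_in_char_orbit[OF \<eta>] pos] by blast
    then show "char_multiplicity ?N \<chi> \<psi> * degree_nat G \<psi> = 0" by simp
  qed
  also have "\<dots> = (\<Sum>\<psi>\<in>char_orbit N \<eta>. char_multiplicity ?N \<chi> \<eta> * degree_nat G \<eta>)"
    by (rule sum.cong) (auto simp: char_orbit_def multiplicity_conj_char[OF _ \<chi>c] degree_conj_char)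
  finally show ?thesis by simp
qed

lemma invariant_orbit:
  assumes \<eta>: "\<eta> \<in> Irr (G\<lparr>carrier := N\<rparr>)" and inv: "invariant_character G N \<eta>"
  shows "char_orbit N \<eta> = {\<eta>}"
proof -
  have "conj_char N g \<eta> = \<eta>" if "g \<in> carrier G" for g
    using inv that stabilizer_iff[OF \<eta>, of g] by (auto simp: invariant_character_def stabilizer_def)
  then show ?thesis unfolding char_orbit_def using one_closed by auto
qed

lemma invariant_degree:
  assumes "\<eta> \<in> Irr (G\<lparr>carrier := N\<rparr>)" and "invariant_character G N \<eta>" and "\<chi> \<in> Irr_above G N \<eta>"
  shows "degree_nat G \<chi> = char_multiplicity (G\<lparr>carrier := N\<rparr>) \<chi> \<eta> * degree_nat G \<eta>"
  using Clifford_degree[OF assms(1), of \<chi>] invariant_orbit[OF assms(1,2)] assms(3)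
  unfolding Irr_above_eq[OF subgroup_N assms(1)] by simp

lemma invariant_restriction:
  assumes \<eta>: "\<eta> \<in> Irr (G\<lparr>carrier := N\<rparr>)" and inv: "invariant_character G N \<eta>"
    and above: "\<chi> \<in> Irr_above G N \<eta>" and x: "x \<in> N"
  shows "\<chi> x = of_nat (char_multiplicity (G\<lparr>carrier := N\<rparr>) \<chi> \<eta>) * \<eta> x"
proof -
  let ?N = "G\<lparr>carrier := N\<rparr>"
  have \<chi>: "\<chi> \<in> Irr G" "char_multiplicity ?N \<chi> \<eta> > 0" using above unfolding Irr_above_eq[OF subgroup_N \<eta>] by auto
  have \<chi>c: "\<chi> \<in> characters G" by (rule Irr_character[OF \<chi>(1)])
  have st: "conj_char N g \<phi> \<in> {\<eta>}" if "g \<in> carrier G" "\<phi> \<in> {\<eta>}" for g \<phi>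
    using that invariant_orbit[OF \<eta> inv] by (auto simp: char_orbit_def)
  have "\<chi> x = (\<Sum>\<psi>\<in>Irr ?N. of_nat (char_multiplicity ?N \<chi> \<psi>) * \<psi> x)"
    by (rule restriction_decomposition[OF subgroup_N \<chi>c x])
  also have "\<dots> = (\<Sum>\<psi>\<in>{\<eta>}. of_nat (char_multiplicity ?N \<chi> \<psi>) * \<psi> x)"
  proof (rule sum.mono_neutral_right[OF finite_Irr_subgroup[OF subgroup_N]], use \<eta> in blast, rule ballI)
    fix \<psi> assume "\<psi> \<in> Irr ?N - {\<eta>}"
    then have "char_multiplicity ?N \<chi> \<psi> = 0"
      using constituents_in_stable_set[OF _ st \<chi>(1) _ \<chi>(2), of \<psi>] \<eta> by blast
    then show "of_nat (char_multiplicity ?N \<chi> \<psi>) * \<psi> x = 0" by simp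
  qed
  finally show ?thesis by simp
qed

text \<open>
  Both sides count the degree of the character induced from \<open>\<eta>\<close>, divided by \<open>\<eta>(1)\<close>.
\<close>

lemma sum_squares_above:
  assumes \<eta>: "\<eta> \<in> Irr (G\<lparr>carrier := N\<rparr>)" and inv: "invariant_character G N \<eta>"
  shows "card N * (\<Sum>\<chi>\<in>Irr_above G N \<eta>. (char_multiplicity (G\<lparr>carrier := N\<rparr>) \<chi> \<eta>)\<^sup>2) = card (carrier G)"
proof -
  let ?m = "\<lambda>\<chi>. char_multiplicity (G\<lparr>carrier := N\<rparr>) \<chi> \<eta>"
  have "(\<Sum>\<chi>\<in>Irr G. ?m \<chi> * degree_nat G \<chi>) = (\<Sum>\<chi>\<in>Irr_above G N \<eta>. ?m \<chi> * degree_nat G \<chi>)"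
    by (rule sum.mono_neutral_right[OF finite_Irr]) (auto simp: Irr_above_eq[OF subgroup_N \<eta>])
  also have "\<dots> = (\<Sum>\<chi>\<in>Irr_above G N \<eta>. (?m \<chi>)\<^sup>2) * degree_nat G \<eta>"
    unfolding sum_distrib_right
    by (rule sum.cong) (simp_all add: invariant_degree[OF assms] power2_eq_square mult.assoc)
  finally have "card N * (\<Sum>\<chi>\<in>Irr_above G N \<eta>. (?m \<chi>)\<^sup>2) * degree_nat G \<eta> = card (carrier G) * degree_nat G \<eta>"
    using induction_degree[OF subgroup_N \<eta>] by (simp only: mult.assoc)
  then show ?thesis using degree_Irr_subgroup_pos[OF subgroup_N \<eta>] by simp
qed

lemma normal_in_intermediate:
  assumes "subgroup H G" and "N \<subseteq> H"
  shows "finite_group_normal (G\<lparr>carrier := H\<rparr>) N"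
  using subgroup_finite_group[OF assms(1)] normal_restrict_supergroup[OF assms(1) normal assms(2)]
  by (simp add: finite_group_normal_def finite_group_normal_axioms_def)

text \<open>
  Clifford's correspondence. Write \<open>a\<close>, \<open>e\<close> for the multiplicities of \<open>\<eta>\<close> in \<open>\<psi>\<close> and \<open>\<chi>\<close>, and \<open>k\<close>
  for that of \<open>\<psi>\<close> in \<open>\<chi>\<close>. Restricting gives \<open>k a \<le> e\<close>, and comparing the degree of \<open>\<chi>\<close> with
  that of \<open>\<psi>\<^sup>G\<close> gives \<open>k e \<le> a\<close>; hence \<open>k = 1\<close> and \<open>e = a\<close>.
\<close>

theorem Clifford_correspondence:
  assumes \<eta>: "\<eta> \<in> Irr (G\<lparr>carrier := N\<rparr>)" and T: "T = stabilizer N \<eta>"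
    and \<psi>: "\<psi> \<in> Irr_above (G\<lparr>carrier := T\<rparr>) N \<eta>"
    and \<chi>: "\<chi> \<in> Irr G" and pos: "char_multiplicity (G\<lparr>carrier := T\<rparr>) \<chi> \<psi> > 0"
  shows "degree_nat G \<chi> * card T = card (carrier G) * degree_nat G \<psi>"
    and "\<And>\<psi>'. \<psi>' \<in> Irr_above (G\<lparr>carrier := T\<rparr>) N \<eta> \<Longrightarrow>
      char_multiplicity (G\<lparr>carrier := T\<rparr>) \<chi> \<psi>' > 0 \<Longrightarrow> \<psi>' = \<psi>"
proof -
  let ?N = "G\<lparr>carrier := N\<rparr>" and ?T = "G\<lparr>carrier := T\<rparr>"
  have Tsub: "subgroup T G" and NT: "N \<subseteq> T"
    using stabilizer_subgroup[OF \<eta>] N_subset_stabilizer[OF \<eta>] by (simp_all add: T)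
  interpret T: finite_group_normal ?T N by (rule normal_in_intermediate[OF Tsub NT])
  have [simp]: "?T\<lparr>carrier := N\<rparr> = ?N" by simp
  have \<eta>T: "\<eta> \<in> Irr (?T\<lparr>carrier := N\<rparr>)" using \<eta> by simp
  have invT: "invariant_character ?T N \<eta>"
    unfolding invariant_character_def using m_inv_consistent[OF Tsub] by (auto simp: T stabilizer_def)
  have \<chi>c: "\<chi> \<in> characters G" by (rule Irr_character[OF \<chi>])
  let ?a = "\<lambda>\<psi>. char_multiplicity ?N \<psi> \<eta>" and ?k = "\<lambda>\<psi>. char_multiplicity ?T \<chi> \<psi>"
  have a: "\<psi>' \<in> Irr ?T" "?a \<psi>' > 0" "degree_nat G \<psi>' = ?a \<psi>' * degree_nat G \<eta>"
    if "\<psi>' \<in> Irr_above ?T N \<eta>" for \<psi>'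
    using that T.invariant_degree[OF \<eta>T invT that] unfolding T.Irr_above_eq[OF T.subgroup_N \<eta>T] by simp_all
  have e1: "(\<Sum>\<psi>\<in>A. ?k \<psi> * ?a \<psi>) \<le> ?a \<chi>" if "A \<subseteq> Irr ?T" for A
    by (rule multiplicity_trans_le[OF subgroup_N Tsub NT \<chi>c \<eta> that])
  have ka: "?k \<psi> * ?a \<psi> \<le> ?a \<chi>" using e1[of "{\<psi>}"] a(1)[OF \<psi>] by simp
  then have e: "?a \<chi> > 0" using pos a(2)[OF \<psi>] by (meson less_le_trans nat_0_less_mult_iff)
  define o' where "o' = card (char_orbit N \<eta>)"
  have orb: "o' * card T = card (carrier G)" unfolding o'_def T by (rule card_orbit_stabilizer[OF \<eta>])
  have d\<chi>: "degree_nat G \<chi> = ?a \<chi> * o' * degree_nat G \<eta>"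
    unfolding o'_def by (rule Clifford_degree[OF \<eta> \<chi> e])
  have d\<eta>: "degree_nat G \<eta> > 0" by (rule degree_Irr_subgroup_pos[OF subgroup_N \<eta>])
  have "?k \<psi> * degree_nat G \<chi> \<le> (\<Sum>\<chi>\<in>Irr G. char_multiplicity ?T \<chi> \<psi> * degree_nat G \<chi>)"
    using sum_mono2[OF finite_Irr, of "{\<chi>}" "\<lambda>\<chi>. char_multiplicity ?T \<chi> \<psi> * degree_nat G \<chi>"] \<chi> by simp
  then have "card T * (?k \<psi> * degree_nat G \<chi>) \<le> card (carrier G) * degree_nat G \<psi>"
    unfolding induction_degree[OF Tsub a(1)[OF \<psi>], symmetric] by (rule mult_le_mono2)
  then have "(card (carrier G) * degree_nat G \<eta>) * (?k \<psi> * ?a \<chi>) \<le> (card (carrier G) * degree_nat G \<eta>) * ?a \<psi>"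
    unfolding d\<chi> a(3)[OF \<psi>] orb[symmetric] by (simp only: mult_ac)
  then have ke: "?k \<psi> * ?a \<chi> \<le> ?a \<psi>" using card_pos d\<eta> by simp
  have "?a \<chi> \<le> ?k \<psi> * ?a \<chi>" "?a \<psi> \<le> ?k \<psi> * ?a \<psi>" using pos by simp_all
  then have eq: "?a \<chi> = ?a \<psi>" using ka ke by linarith
  show "degree_nat G \<chi> * card T = card (carrier G) * degree_nat G \<psi>"
    unfolding d\<chi> a(3)[OF \<psi>] orb[symmetric] eq by (simp only: mult_ac)
  show "\<psi>' = \<psi>" if \<psi>': "\<psi>' \<in> Irr_above ?T N \<eta>" "?k \<psi>' > 0" for \<psi>'
  proof (rule ccontr)
    assume "\<psi>' \<noteq> \<psi>"
    then have "?k \<psi> * ?a \<psi> + ?k \<psi>' * ?a \<psi>' \<le> ?a \<psi>"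
      using e1[of "{\<psi>, \<psi>'}"] a(1)[OF \<psi>] a(1)[OF \<psi>'(1)] eq by simp
    moreover have "?k \<psi>' * ?a \<psi>' > 0" using \<psi>'(2) a(2)[OF \<psi>'(1)] by simp
    ultimately show False using \<open>?a \<psi> \<le> ?k \<psi> * ?a \<psi>\<close> by linarith
  qed
qed

text \<open>
  Every \<open>\<psi>\<close> of \<open>T\<close> above \<open>\<eta>\<close> lies below a character of \<open>G\<close> of degree \<open>|G : T| \<psi>(1)\<close>, which in turn
  determines \<open>\<psi>\<close>.
\<close>

lemma Clifford_distinct_degrees:
  assumes \<eta>: "\<eta> \<in> Irr (G\<lparr>carrier := N\<rparr>)" and T: "T = stabilizer N \<eta>"
    and inj: "inj_on (degree_nat G) (Irr_above G N \<eta>)"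
  shows "inj_on (degree_nat G) (Irr_above (G\<lparr>carrier := T\<rparr>) N \<eta>)"
proof (rule inj_onI)
  let ?N = "G\<lparr>carrier := N\<rparr>" and ?T = "G\<lparr>carrier := T\<rparr>"
  fix \<psi> \<psi>' assume \<psi>: "\<psi> \<in> Irr_above ?T N \<eta>" and \<psi>': "\<psi>' \<in> Irr_above ?T N \<eta>" and d: "degree_nat G \<psi> = degree_nat G \<psi>'"
  have Tsub: "subgroup T G" and NT: "N \<subseteq> T"
    using stabilizer_subgroup[OF \<eta>] N_subset_stabilizer[OF \<eta>] by (simp_all add: T)
  interpret T: finite_group_normal ?T N by (rule normal_in_intermediate[OF Tsub NT])
  have ex: "\<exists>\<chi>\<in>Irr_above G N \<eta>. char_multiplicity ?T \<chi> \<phi> > 0 \<and> degree_nat G \<chi> * card T = card (carrier G) * degree_nat G \<phi>"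
    if \<phi>: "\<phi> \<in> Irr_above ?T N \<eta>" for \<phi>
  proof -
    have \<phi>': "\<phi> \<in> Irr ?T" "char_multiplicity ?N \<phi> \<eta> > 0"
      using \<phi> T.Irr_above_eq[OF T.subgroup_N, of \<eta>] \<eta> by auto
    obtain \<chi> where "\<chi> \<in> Irr_above G T \<phi>" using Irr_above_nonempty[OF Tsub \<phi>'(1)] by blast
    then have \<chi>: "\<chi> \<in> Irr G" "char_multiplicity ?T \<chi> \<phi> > 0" using Irr_above_eq[OF Tsub \<phi>'(1)] by auto
    then have "\<chi> \<in> Irr_above G N \<eta>"
      using multiplicity_trans_pos[OF subgroup_N Tsub NT _ \<eta>, of \<chi>] \<phi>' Irr_subset_characters[of G]
      unfolding Irr_above_eq[OF subgroup_N \<eta>] by blast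
    then show ?thesis using Clifford_correspondence(1)[OF \<eta> T \<phi> \<chi>] \<chi> by blast
  qed
  obtain \<chi> where \<chi>: "\<chi> \<in> Irr_above G N \<eta>" "char_multiplicity ?T \<chi> \<psi> > 0"
    "degree_nat G \<chi> * card T = card (carrier G) * degree_nat G \<psi>" using ex[OF \<psi>] by blast
  obtain \<chi>' where \<chi>': "\<chi>' \<in> Irr_above G N \<eta>" "char_multiplicity ?T \<chi>' \<psi>' > 0"
    "degree_nat G \<chi>' * card T = card (carrier G) * degree_nat G \<psi>'" using ex[OF \<psi>'] by blast
  have "degree_nat G \<chi> * card T = degree_nat G \<chi>' * card T" using \<chi>(3) \<chi>'(3) d by simp
  then have "degree_nat G \<chi> = degree_nat G \<chi>'" using card_subgroup_pos[OF Tsub] by simp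
  then have eq: "\<chi> = \<chi>'" using inj_onD[OF inj] \<chi>(1) \<chi>'(1) by blast
  have \<chi>I: "\<chi> \<in> Irr G" using \<chi>(1) by (simp add: Irr_above_def)
  show "\<psi> = \<psi>'"
    using Clifford_correspondence(2)[OF \<eta> T \<psi> \<chi>I \<chi>(2) \<psi>'] \<chi>'(2) eq by simp
qed

text \<open>
  A character \<open>\<chi>\<close> above \<open>\<eta>\<close> lies above \<open>\<psi>\<close> and has the full degree of \<open>\<psi>\<^sup>G\<close>, so \<open>\<psi>\<^sup>G\<close> has no room for
  a second one.
\<close>

lemma Clifford_unique:
  assumes \<eta>: "\<eta> \<in> Irr (G\<lparr>carrier := N\<rparr>)" and T: "T = stabilizer N \<eta>"
    and uniq: "Irr_above (G\<lparr>carrier := T\<rparr>) N \<eta> = {\<psi>}"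
  shows "\<exists>\<chi>. Irr_above G N \<eta> = {\<chi>} \<and> degree_nat G \<chi> * card T = card (carrier G) * degree_nat G \<psi>"
proof -
  let ?N = "G\<lparr>carrier := N\<rparr>" and ?T = "G\<lparr>carrier := T\<rparr>"
  have Tsub: "subgroup T G" and NT: "N \<subseteq> T"
    using stabilizer_subgroup[OF \<eta>] N_subset_stabilizer[OF \<eta>] by (simp_all add: T)
  interpret T: finite_group_normal ?T N by (rule normal_in_intermediate[OF Tsub NT])
  have \<psi>: "\<psi> \<in> Irr_above ?T N \<eta>" using uniq by simp
  have \<psi>I: "\<psi> \<in> Irr ?T" using \<psi> by (simp add: Irr_above_def)
  have above: "\<chi> \<in> Irr G" "char_multiplicity ?T \<chi> \<psi> > 0" "degree_nat G \<chi> * card T = card (carrier G) * degree_nat G \<psi>"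
    if \<chi>: "\<chi> \<in> Irr_above G N \<eta>" for \<chi>
  proof -
    have \<chi>': "\<chi> \<in> Irr G" "char_multiplicity ?N \<chi> \<eta> > 0" using \<chi> unfolding Irr_above_eq[OF subgroup_N \<eta>] by auto
    then obtain \<phi> where \<phi>: "\<phi> \<in> Irr ?T" "char_multiplicity ?T \<chi> \<phi> > 0" "char_multiplicity ?N \<phi> \<eta> > 0"
      using multiplicity_trans_pos[OF subgroup_N Tsub NT _ \<eta>, of \<chi>] Irr_subset_characters[of G] by blast
    then have "\<phi> \<in> Irr_above ?T N \<eta>" using T.Irr_above_eq[OF T.subgroup_N, of \<eta>] \<eta> by auto
    then have "\<phi> = \<psi>" using uniq by simp
    then show "\<chi> \<in> Irr G" "char_multiplicity ?T \<chi> \<psi> > 0" "degree_nat G \<chi> * card T = card (carrier G) * degree_nat G \<psi>"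
      using \<chi>' \<phi> Clifford_correspondence(1)[OF \<eta> T \<psi>] by auto
  qed
  obtain \<chi> where \<chi>: "\<chi> \<in> Irr_above G N \<eta>" using Irr_above_nonempty[OF subgroup_N \<eta>] by blast
  have "\<chi>' = \<chi>" if \<chi>': "\<chi>' \<in> Irr_above G N \<eta>" for \<chi>'
  proof (rule ccontr)
    assume ne: "\<chi>' \<noteq> \<chi>"
    let ?s = "\<lambda>\<chi>. char_multiplicity ?T \<chi> \<psi> * degree_nat G \<chi>"
    have "?s \<chi> + ?s \<chi>' \<le> (\<Sum>\<chi>\<in>Irr G. ?s \<chi>)"
      using sum_mono2[OF finite_Irr, of "{\<chi>, \<chi>'}" ?s] above(1)[OF \<chi>] above(1)[OF \<chi>'] ne by simp
    then have "card T * (?s \<chi> + ?s \<chi>') \<le> card (carrier G) * degree_nat G \<psi>"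
      unfolding induction_degree[OF Tsub \<psi>I, symmetric] by (rule mult_le_mono2)
    also have "\<dots> = card T * degree_nat G \<chi>" using above(3)[OF \<chi>] by (simp add: mult.commute)
    finally have "?s \<chi> + ?s \<chi>' \<le> degree_nat G \<chi>" using card_subgroup_pos[OF Tsub] by simp
    moreover have "?s \<chi> \<ge> degree_nat G \<chi>" using above(2)[OF \<chi>] by simp
    moreover have "?s \<chi>' > 0" using above(1,2)[OF \<chi>'] degree_pos[of \<chi>'] Irr_subset_characters[of G] by auto
    ultimately show False by linarith
  qed
  then have "Irr_above G N \<eta> = {\<chi>}" using \<chi> by blast
  then show ?thesis using above(3)[OF \<chi>] by blast
qed

end

section \<open>Twisting by linear characters\<close>

definition linear_char :: "('a, 'b) monoid_scheme \<Rightarrow> ('a \<Rightarrow> complex) \<Rightarrow> bool" where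
  "linear_char G \<mu> \<longleftrightarrow> \<mu> \<one>\<^bsub>G\<^esub> = 1 \<and>
     (\<forall>x\<in>carrier G. \<forall>y\<in>carrier G. \<mu> (x \<otimes>\<^bsub>G\<^esub> y) = \<mu> x * \<mu> y)"

definition twist :: "('a, 'b) monoid_scheme \<Rightarrow> ('a \<Rightarrow> complex) \<Rightarrow> ('a \<Rightarrow> complex) \<Rightarrow> 'a \<Rightarrow> complex" where
  "twist G \<mu> \<eta> = (\<lambda>x\<in>carrier G. \<mu> x * \<eta> x)"

lemma linear_char_power: "linear_char G \<mu> \<Longrightarrow> linear_char G (\<lambda>x. \<mu> x ^ i)"
  by (simp add: linear_char_def power_mult_distrib)

lemma (in group) linear_char_inv:
  "linear_char G \<mu> \<Longrightarrow> x \<in> carrier G \<Longrightarrow> \<mu> x * \<mu> (inv x) = 1"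
  unfolding linear_char_def by (metis inv_closed r_inv)

context finite_group
begin

lemma twist_representation:
  assumes \<mu>: "linear_char G \<mu>" and R: "representation G n R"
  shows "representation G n (\<lambda>x. \<mu> x \<cdot>\<^sub>m R x)"
proof (rule representationI[OF is_group representationD(1)[OF R]])
  note R' = representationD[OF R]
  show "\<mu> x \<cdot>\<^sub>m R x \<in> carrier_mat n n" if "x \<in> carrier G" for x using R'(2)[OF that] by simp
  show "\<mu> (x \<otimes> y) \<cdot>\<^sub>m R (x \<otimes> y) = (\<mu> x \<cdot>\<^sub>m R x) * (\<mu> y \<cdot>\<^sub>m R y)"
    if xy: "x \<in> carrier G" "y \<in> carrier G" for x y
  proof -
    note c = R'(2)[OF xy(1)] R'(2)[OF xy(2)]
    have "(\<mu> x \<cdot>\<^sub>m R x) * (\<mu> y \<cdot>\<^sub>m R y) = \<mu> x \<cdot>\<^sub>m (R x * (\<mu> y \<cdot>\<^sub>m R y))"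
      using c by (intro mult_smult_assoc_mat) auto
    also have "R x * (\<mu> y \<cdot>\<^sub>m R y) = \<mu> y \<cdot>\<^sub>m (R x * R y)"
      using c by (intro mult_smult_distrib) auto
    also have "\<mu> x \<cdot>\<^sub>m (\<mu> y \<cdot>\<^sub>m (R x * R y)) = \<mu> (x \<otimes> y) \<cdot>\<^sub>m R (x \<otimes> y)"
      using \<mu> xy c R'(3)[OF xy] by (intro eq_matI) (auto simp: linear_char_def)
    finally show ?thesis ..
  qed
  show "\<mu> \<one> \<cdot>\<^sub>m R \<one> = 1\<^sub>m n"
    using \<mu> representation_one[OF is_group R] by (intro eq_matI) (auto simp: linear_char_def)
qed

lemma twist_rep_character:
  assumes "representation G n R"
  shows "twist G \<mu> (rep_character G R) = rep_character G (\<lambda>x. \<mu> x \<cdot>\<^sub>m R x)"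
  unfolding twist_def rep_character_def
proof (rule restrict_ext)
  fix x assume x: "x \<in> carrier G"
  show "\<mu> x * (\<lambda>g\<in>carrier G. mat_trace (R g)) x = mat_trace (\<mu> x \<cdot>\<^sub>m R x)"
    using x representationD(2)[OF assms x] by (simp add: mat_trace_def sum_distrib_left)
qed

lemma twist_characters:
  assumes "linear_char G \<mu>" and "\<eta> \<in> characters G"
  shows "twist G \<mu> \<eta> \<in> characters G"
proof -
  obtain n R where R: "representation G n R" "\<eta> = rep_character G R"
    using assms(2) unfolding characters_def by blast
  show ?thesis
    unfolding R(2) twist_rep_character[OF R(1)] characters_def
    using twist_representation[OF assms(1) R(1)] by blast
qed

lemma twist_Irr:
  assumes \<mu>: "linear_char G \<mu>" and "\<eta> \<in> Irr G"
  shows "twist G \<mu> \<eta> \<in> Irr G"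
proof -
  obtain n R where R: "irreducible_representation G n R" and \<eta>: "\<eta> = rep_character G R"
    using assms(2) unfolding Irr_def by blast
  note Rr = irreducible_representationD(1)[OF R]
  note R' = representationD[OF Rr]
  let ?R = "\<lambda>x. \<mu> x \<cdot>\<^sub>m R x"
  have "W = {0\<^sub>v n} \<or> W = carrier_vec n"
    if W: "VectorSpace.subspace class_ring W (module_vec TYPE(complex) n)"
      and inv: "\<forall>x\<in>carrier G. \<forall>w\<in>W. ?R x *\<^sub>v w \<in> W" for W
  proof -
    have sub: "W \<subseteq> carrier_vec n" "\<And>c v. v \<in> W \<Longrightarrow> c \<cdot>\<^sub>v v \<in> W"
      using W by (auto simp: subspace_vec_iff)
    have "R x *\<^sub>v w \<in> W" if x: "x \<in> carrier G" and w: "w \<in> W" for x w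
    proof -
      have nz: "\<mu> (inv x) * \<mu> x = 1" using linear_char_inv[OF \<mu> x] by (simp add: mult.commute)
      have "R x *\<^sub>v w = \<mu> (inv x) \<cdot>\<^sub>v (?R x *\<^sub>v w)"
      proof (rule eq_vecI)
        fix i assume "i < dim_vec (\<mu> (inv x) \<cdot>\<^sub>v (?R x *\<^sub>v w))"
        then have i: "i < n" using R'(2)[OF x] by simp
        have wc: "w \<in> carrier_vec n" using w sub by auto
        have "(?R x *\<^sub>v w) $ i = (\<Sum>a<n. \<mu> x * (R x $$ (i, a) * w $ a))"
          using i R'(2)[OF x] wc by (simp add: scalar_prod_def atLeast0LessThan mult.assoc)
        also have "\<dots> = \<mu> x * (R x *\<^sub>v w) $ i"
          using i R'(2)[OF x] wc by (simp add: scalar_prod_def atLeast0LessThan sum_distrib_left)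
        finally have "(\<mu> (inv x) \<cdot>\<^sub>v (?R x *\<^sub>v w)) $ i = \<mu> (inv x) * \<mu> x * (R x *\<^sub>v w) $ i"
          using i R'(2)[OF x] by simp
        then show "(R x *\<^sub>v w) $ i = (\<mu> (inv x) \<cdot>\<^sub>v (?R x *\<^sub>v w)) $ i" by (simp add: nz)
      qed (use R'(2)[OF x] in auto)
      then show ?thesis using inv x w sub(2) by simp
    qed
    then show ?thesis using R W unfolding irreducible_representation_def by blast
  qed
  then have "irreducible_representation G n ?R"
    using twist_representation[OF \<mu> Rr] unfolding irreducible_representation_def by blast
  then show ?thesis unfolding \<eta> twist_rep_character[OF Rr] Irr_def by blast
qed

end

section \<open>Cyclic quotients\<close>

lemma (in group) conj_nat_pow:
  assumes "g \<in> carrier G" and "x \<in> carrier G"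
  shows "g \<otimes> x [^] (i::nat) \<otimes> inv g = (g \<otimes> x \<otimes> inv g) [^] i"
proof (induction i)
  case (Suc i)
  have "(g \<otimes> x \<otimes> inv g) [^] Suc i = (g \<otimes> x [^] i \<otimes> inv g) \<otimes> (g \<otimes> x \<otimes> inv g)"
    unfolding Suc by simp
  also have "\<dots> = g \<otimes> x [^] Suc i \<otimes> inv g" using assms by (simp add: m_assoc cancel_inv)
  finally show ?case ..
qed (use assms in simp)

lemma (in finite_group) inv_pow_eq_pow:
  assumes x: "x \<in> carrier G"
  shows "\<exists>k::nat. inv (x [^] (i::nat)) = x [^] k"
proof -
  let ?k = "(Coset.order G - 1) * i"
  have "Coset.order G > 0" using card_pos by (simp add: Coset.order_def)
  then have k: "?k + i = Coset.order G * i" by (cases "Coset.order G") auto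
  have "x [^] ?k \<otimes> x [^] i = x [^] (Coset.order G * i)"
    using nat_pow_mult[OF x, of ?k i] unfolding k .
  also have "\<dots> = \<one>"
    using nat_pow_pow[OF x, of "Coset.order G" i] pow_order_eq_1[OF x] nat_pow_one[of i] by simp
  finally have "inv (x [^] i) = x [^] ?k" using x by (intro inv_equality) auto
  then show ?thesis by blast
qed

context finite_group_normal
begin

lemma pow_mod_N_iff:
  fixes i :: nat
  assumes x: "x \<in> carrier G" and n: "n > 0" "x [^] n \<in> N" and least: "\<And>m. m > 0 \<Longrightarrow> x [^] m \<in> N \<Longrightarrow> n \<le> m"
  shows "x [^] i \<in> N \<longleftrightarrow> n dvd i"
proof -
  have mult: "x [^] (n * k) \<in> N" for k :: nat
  proof (induction k)
    case 0
    then show ?case using subgroup.one_closed[OF subgroup_N] by simp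
  next
    case (Suc k)
    have "x [^] (n * Suc k) = x [^] n \<otimes> x [^] (n * k)"
      using nat_pow_mult[OF x, of n "n * k"] by simp
    then show ?case using subgroup.m_closed[OF subgroup_N n(2) Suc] by simp
  qed
  let ?a = "x [^] (n * (i div n))" and ?b = "x [^] (i mod n)"
  have split: "x [^] i = ?a \<otimes> ?b"
    using nat_pow_mult[OF x, of "n * (i div n)" "i mod n"] by simp
  have "x [^] i \<in> N \<longleftrightarrow> ?b \<in> N"
  proof
    assume "?b \<in> N"
    then show "x [^] i \<in> N" unfolding split using subgroup.m_closed[OF subgroup_N mult] by simp
  next
    assume i: "x [^] i \<in> N"
    have "?b = inv ?a \<otimes> x [^] i" unfolding split using x by (simp add: cancel_inv)
    then show "?b \<in> N"
      using subgroup.m_closed[OF subgroup_N subgroup.m_inv_closed[OF subgroup_N mult] i] by simp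
  qed
  also have "\<dots> \<longleftrightarrow> i mod n = 0"
  proof
    assume b: "?b \<in> N"
    show "i mod n = 0"
    proof (rule ccontr)
      assume "i mod n \<noteq> 0"
      then have "n \<le> i mod n" using least[OF _ b] by simp
      then show False using n(1) mod_less_divisor[of n i] by linarith
    qed
  qed (use subgroup.one_closed[OF subgroup_N] in simp)
  finally show ?thesis by (simp add: mod_eq_0_iff_dvd)
qed

lemma order_mod_N_exists:
  assumes "x \<in> carrier G"
  shows "\<exists>n>0. x [^] (n::nat) \<in> N \<and> (\<forall>m>0. x [^] m \<in> N \<longrightarrow> n \<le> m)"
proof -
  have "\<exists>n>0. x [^] (n::nat) \<in> N"
    using pow_order_eq_1[OF assms] card_pos subgroup.one_closed[OF subgroup_N]
    by (intro exI[of _ "Coset.order G"]) (simp add: Coset.order_def)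
  then show ?thesis
    using LeastI_ex[of "\<lambda>n. n > 0 \<and> x [^] (n::nat) \<in> N"] Least_le[of "\<lambda>n. n > 0 \<and> x [^] (n::nat) \<in> N"] by blast
qed

lemma pow_diff_in_N:
  fixes i j :: nat
  assumes x: "x \<in> carrier G" and le: "i \<le> j" and yz: "y \<in> N" "z \<in> N" and eq: "x [^] i \<otimes> y = x [^] j \<otimes> z"
  shows "x [^] (j - i) \<in> N" and "y = x [^] (j - i) \<otimes> z"
proof -
  have c: "y \<in> carrier G" "z \<in> carrier G" using yz N_subset by auto
  have "x [^] j = x [^] i \<otimes> x [^] (j - i)" using x le by (simp add: nat_pow_mult)
  then have "x [^] i \<otimes> y = x [^] i \<otimes> (x [^] (j - i) \<otimes> z)" using eq x c by (simp add: m_assoc)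
  then show y: "y = x [^] (j - i) \<otimes> z" using x c by simp
  then have "x [^] (j - i) = y \<otimes> inv z" using x c by (simp add: m_assoc)
  then show "x [^] (j - i) \<in> N" using yz subgroup_N by (simp add: subgroup.m_closed subgroup.m_inv_closed)
qed

lemma card_powers_mod_N:
  fixes n :: nat
  assumes x: "x \<in> carrier G" and n: "n > 0" "x [^] n \<in> N" and least: "\<And>m. m > 0 \<Longrightarrow> x [^] m \<in> N \<Longrightarrow> n \<le> m"
  shows "card {x [^] i \<otimes> y | (i::nat) y. y \<in> N} = n * card N"
proof -
  note iff = pow_mod_N_iff[OF x n least]
  have inj: "inj_on (\<lambda>(i, y). x [^] i \<otimes> y) ({..<n} \<times> N)"
  proof -
    have *: "i = j \<and> y = z" if "i \<le> j" "j < n" "y \<in> N" "z \<in> N" "x [^] i \<otimes> y = x [^] j \<otimes> z" for i j :: nat and y z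
    proof -
      have y: "x [^] (j - i) \<in> N" "y = x [^] (j - i) \<otimes> z" using pow_diff_in_N[OF x] that by auto
      then have "j - i = 0" using iff that by (meson dvd_imp_le less_imp_diff_less not_le neq0_conv)
      then show ?thesis using that y N_subset by auto
    qed
    show ?thesis
    proof (rule inj_onI)
      fix a b assume ab: "a \<in> {..<n} \<times> N" "b \<in> {..<n} \<times> N"
        "(case a of (i, y) \<Rightarrow> x [^] i \<otimes> y) = (case b of (i, y) \<Rightarrow> x [^] i \<otimes> y)"
      obtain i y j z where "a = (i, y)" "b = (j, z)" by (cases a, cases b)
      then show "a = b" using ab *[of i j y z] *[of j i z y] by (cases "i \<le> j") auto
    qed
  qed
  have "{x [^] i \<otimes> y | (i::nat) y. y \<in> N} = (\<lambda>(i, y). x [^] i \<otimes> y) ` ({..<n} \<times> N)"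
  proof (intro equalityI subsetI)
    fix g assume "g \<in> {x [^] i \<otimes> y | (i::nat) y. y \<in> N}"
    then obtain i :: nat and y where g: "g = x [^] i \<otimes> y" "y \<in> N" by blast
    have y: "y \<in> carrier G" using g N_subset by auto
    have "x [^] (n * (i div n)) \<in> N" using iff by simp
    then have m: "x [^] (n * (i div n)) \<otimes> y \<in> N" using g subgroup_N by (simp add: subgroup.m_closed)
    have "x [^] i = x [^] (i mod n) \<otimes> x [^] (n * (i div n))"
      using x by (simp add: nat_pow_mult add.commute)
    then have "g = x [^] (i mod n) \<otimes> (x [^] (n * (i div n)) \<otimes> y)" using g x y by (simp add: m_assoc)
    then show "g \<in> (\<lambda>(i, y). x [^] i \<otimes> y) ` ({..<n} \<times> N)"
      using m n(1) by (intro image_eqI[of _ _ "(i mod n, x [^] (n * (i div n)) \<otimes> y)"]) auto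
  qed auto
  then show ?thesis using card_image[OF inj] by (simp add: card_cartesian_product)
qed

lemma powers_mod_N_subgroup:
  assumes x: "x \<in> carrier G"
  shows "subgroup {x [^] i \<otimes> y | (i::nat) y. y \<in> N} G" (is "subgroup ?H G")
proof (rule subgroupI)
  show sub: "?H \<subseteq> carrier G" using x N_subset by auto
  show "?H \<noteq> {}" using subgroup.one_closed[OF subgroup_N] by blast
  show "g \<otimes> h \<in> ?H" if gh: "g \<in> ?H" "h \<in> ?H" for g h
  proof -
    obtain i j :: nat and y z where g: "g = x [^] i \<otimes> y" "y \<in> N" "h = x [^] j \<otimes> z" "z \<in> N" using gh by blast
    have c: "y \<in> carrier G" "z \<in> carrier G" using g N_subset by auto
    have "inv (x [^] j) \<otimes> y \<otimes> inv (inv (x [^] j)) \<in> N" using conj_closed[of "inv (x [^] j)" y] x g by simp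
    then have "inv (x [^] j) \<otimes> y \<otimes> x [^] j \<otimes> z \<in> N" using g x subgroup_N by (simp add: subgroup.m_closed)
    moreover have "g \<otimes> h = x [^] (i + j) \<otimes> (inv (x [^] j) \<otimes> y \<otimes> x [^] j \<otimes> z)"
      using x c unfolding g nat_pow_mult[OF x, symmetric] by (simp add: m_assoc cancel_inv)
    ultimately show ?thesis by blast
  qed
  show "inv g \<in> ?H" if g: "g \<in> ?H" for g
  proof -
    obtain i :: nat and y where g: "g = x [^] i \<otimes> y" "y \<in> N" using g by blast
    have c: "y \<in> carrier G" using g N_subset by auto
    obtain k :: nat where inv: "inv (x [^] i) = x [^] k" using inv_pow_eq_pow[OF x] by blast
    have "x [^] i \<otimes> inv y \<otimes> inv (x [^] i) \<in> N" using conj_closed[of "x [^] i" "inv y"] x g subgroup_N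
      by (simp add: subgroup.m_inv_closed)
    moreover have "inv g = x [^] k \<otimes> (x [^] i \<otimes> inv y \<otimes> inv (x [^] i))"
      using x c unfolding g inv[symmetric] by (simp add: inv_mult_group m_assoc cancel_inv)
    ultimately show ?thesis by blast
  qed
qed

text \<open>
  Let \<open>G/N\<close> be cyclic, generated by \<open>t\<close>. For an invariant \<open>\<beta>\<close>, afforded by \<open>\<rho>\<close>, choose \<open>A\<close> with
  \<open>A \<rho>(c) = \<rho>(t c t\<inverse>) A\<close>. The group algebra element \<open>u = \<Sum>\<^sub>c tr(A \<rho>(c\<inverse>)) c\<close> of \<open>N\<close>
  satisfies \<open>\<rho>(u) = |N|/n A\<close>, so that \<open>u\<close> is a copy of \<open>A\<close>: it is fixed by conjugation with \<open>t\<close>,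
  and \<open>u c = t c t\<inverse> u\<close> for \<open>c \<in> N\<close>. In an irreducible representation \<open>R\<close> of \<open>G\<close> above \<open>\<beta>\<close>
  the matrix \<open>R(t)\<inverse> R(u)\<close> therefore commutes with \<open>R(G)\<close>. So \<open>R(t)\<close> is a combination of matrices
  from \<open>R(N)\<close>, and \<open>R\<close> remains irreducible on \<open>N\<close>.
\<close>

theorem cyclic_quotient_multiplicity_one:
  assumes t: "t \<in> carrier G" and gen: "\<And>g. g \<in> carrier G \<Longrightarrow> \<exists>(i::nat) y. y \<in> N \<and> g = t [^] i \<otimes> y"
    and \<beta>: "\<beta> \<in> Irr (G\<lparr>carrier := N\<rparr>)" and inv: "invariant_character G N \<beta>"
    and \<chi>: "\<chi> \<in> Irr_above G N \<beta>"
  shows "char_multiplicity (G\<lparr>carrier := N\<rparr>) \<chi> \<beta> = 1"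
proof -
  let ?N = "G\<lparr>carrier := N\<rparr>"
  interpret N: finite_group ?N by (rule finite_group_N)
  have \<chi>': "\<chi> \<in> Irr G" "char_multiplicity ?N \<chi> \<beta> > 0" using \<chi> unfolding Irr_above_eq[OF subgroup_N \<beta>] by auto
  have \<chi>c: "\<chi> \<in> characters G" using \<chi>' Irr_subset_characters by blast
  obtain r R where R: "irreducible_representation G r R" and \<chi>R: "\<chi> = rep_character G R"
    using \<chi>'(1) unfolding Irr_def by blast
  obtain n \<rho> where \<rho>: "irreducible_representation ?N n \<rho>" and \<beta>\<rho>: "\<beta> = rep_character ?N \<rho>"
    using \<beta> unfolding Irr_def by blast
  note Rr = irreducible_representationD(1)[OF R] and \<rho>r = irreducible_representationD(1)[OF \<rho>]
  note R' = representationD[OF Rr] and \<rho>' = representationD[OF \<rho>r]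
  have Nc: "c \<in> carrier G" if "c \<in> N" for c using that N_subset by auto
  have Ninv: "inv c \<in> N" if "c \<in> N" for c using that subgroup.m_inv_closed[OF subgroup_N] by simp
  have Nmult: "c \<otimes> d \<in> N" if "c \<in> N" "d \<in> N" for c d using that subgroup.m_closed[OF subgroup_N] by simp
  have RN: "representation ?N r R"
    by (rule representationI[OF N.is_group R'(1)]) (use R' Nc representation_one[OF is_group Rr] in auto)
  have R_restrict: "rep_character ?N R = restrict \<chi> N"
    unfolding \<chi>R rep_character_def using N_subset by (auto simp: restrict_def fun_eq_iff)
  have tc: "t \<otimes> c \<otimes> inv t \<in> N" if "c \<in> N" for c using conj_closed[OF t that] .
  define \<rho>t where "\<rho>t = \<rho> \<circ> (\<lambda>x. t \<otimes> x \<otimes> inv t)"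
  have \<rho>t: "irreducible_representation ?N n \<rho>t"
    unfolding \<rho>t_def by (rule conj_irreducible_representation[OF t \<rho>])
  note \<rho>tr = irreducible_representationD(1)[OF \<rho>t]
  note \<rho>t' = representationD[OF \<rho>tr]
  have "conj_char N t \<beta> = \<beta>"
    using invariant_orbit[OF \<beta> inv] t by (auto simp: char_orbit_def)
  then have \<rho>t\<beta>: "rep_character ?N \<rho>t = \<beta>"
    unfolding \<rho>t_def conj_rep_character[OF t, symmetric] \<beta>\<rho> .
  have "char_prod ?N (rep_character ?N \<rho>t) (rep_character ?N \<rho>) \<noteq> 0"
    unfolding \<rho>t\<beta> \<beta>\<rho>[symmetric] using N.Irr_orthonormal[OF \<beta> \<beta>] by simp
  then obtain A where A: "A \<in> carrier_mat n n" "A \<noteq> 0\<^sub>m n n" "\<And>c. c \<in> N \<Longrightarrow> \<rho>t c * A = A * \<rho> c"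
    using N.nonzero_intertwiner_exists[OF \<rho>tr \<rho>r] by auto
  have \<rho>c: "\<rho> c \<in> carrier_mat n n" "\<rho>t c \<in> carrier_mat n n" if "c \<in> N" for c
    using \<rho>'(2)[of c] \<rho>t'(2)[of c] that by auto
  \<comment> \<open>The coefficients of \<open>u\<close>; below, \<open>U = R(u)\<close>.\<close>
  define f where "f c = mat_trace (A * \<rho> (inv c))" for c
  have f_conj: "f (t \<otimes> c \<otimes> inv t) = f c" if c: "c \<in> N" for c
  proof -
    have "inv (t \<otimes> c \<otimes> inv t) = t \<otimes> inv c \<otimes> inv t"
      using t Nc[OF c] by (simp add: inv_mult_group m_assoc)
    then have "f (t \<otimes> c \<otimes> inv t) = mat_trace (A * \<rho>t (inv c))" by (simp add: f_def \<rho>t_def)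
    also have "\<dots> = mat_trace (\<rho>t (inv c) * A)"
      using A(1) \<rho>c[OF Ninv[OF c]] by (intro mat_trace_mult_comm) auto
    also have "\<dots> = f c" using A(3)[OF Ninv[OF c]] by (simp add: f_def)
    finally show ?thesis .
  qed
  have f_twisted: "f (c \<otimes> inv h) = f (inv (t \<otimes> h \<otimes> inv t) \<otimes> c)" if c: "c \<in> N" and h: "h \<in> N" for c h
  proof -
    note cc = \<rho>c[OF Ninv[OF c]] \<rho>c[OF h]
    have "f (inv (t \<otimes> h \<otimes> inv t) \<otimes> c) = mat_trace (A * \<rho> (inv c \<otimes> (t \<otimes> h \<otimes> inv t)))"
      using t Nc[OF c] Nc[OF h] by (simp add: f_def inv_mult_group)
    also have "\<rho> (inv c \<otimes> (t \<otimes> h \<otimes> inv t)) = \<rho> (inv c) * \<rho>t h"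
      using \<rho>'(3)[of "inv c" "t \<otimes> h \<otimes> inv t"] tc[OF h] Ninv[OF c] by (simp add: \<rho>t_def)
    also have "mat_trace (A * (\<rho> (inv c) * \<rho>t h)) = mat_trace ((A * \<rho> (inv c)) * \<rho>t h)"
      using A(1) cc by simp
    also have "\<dots> = mat_trace (\<rho>t h * (A * \<rho> (inv c)))"
      using A(1) cc by (intro mat_trace_mult_comm) auto
    also have "\<rho>t h * (A * \<rho> (inv c)) = (\<rho>t h * A) * \<rho> (inv c)"
      by (rule assoc_mult_mat[symmetric]) (use A(1) cc in auto)
    also have "\<dots> = A * (\<rho> h * \<rho> (inv c))"
      unfolding A(3)[OF h] by (rule assoc_mult_mat) (use A(1) cc in auto)
    also have "mat_trace \<dots> = f (c \<otimes> inv h)"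
      using \<rho>'(3)[of h "inv c"] Ninv[OF c] h Nc[OF c] Nc[OF h] by (simp add: f_def inv_mult_group)
    finally show ?thesis ..
  qed
  define U where "U = algebra_mat r N f R"
  have U: "U \<in> carrier_mat r r" unfolding U_def by (rule algebra_mat_carrier)
  note RU = algebra_mat_mult(1)[OF Rr N_subset, where f = f, folded U_def]
    and UR = algebra_mat_mult(2)[OF Rr N_subset, where f = f, folded U_def]
  have Ut: "R t * U = U * R t"
  proof (rule eq_matI)
    fix i j assume "i < dim_row (U * R t)" "j < dim_col (U * R t)"
    then have ij: "i < r" "j < r" using U R'(2)[OF t] by auto
    have "(U * R t) $$ (i, j) = (\<Sum>c\<in>N. f (t \<otimes> c \<otimes> inv t) * R (t \<otimes> c \<otimes> inv t \<otimes> t) $$ (i, j))"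
      unfolding UR[OF t ij] by (rule sum_conjugate_N[OF t, symmetric])
    also have "\<dots> = (R t * U) $$ (i, j)"
      unfolding RU[OF t ij] using f_conj t Nc by (intro sum.cong) (auto simp: m_assoc)
    finally show "(R t * U) $$ (i, j) = (U * R t) $$ (i, j)" ..
  qed (use U R'(2)[OF t] in auto)
  have Uh: "U * R h = R (t \<otimes> h \<otimes> inv t) * U" if h: "h \<in> N" for h
  proof (rule eq_matI)
    let ?k = "t \<otimes> h \<otimes> inv t"
    have k: "?k \<in> N" "?k \<in> carrier G" using tc[OF h] Nc by auto
    fix i j assume "i < dim_row (R ?k * U)" "j < dim_col (R ?k * U)"
    then have ij: "i < r" "j < r" using U R'(2)[OF k(2)] by auto
    have "(U * R h) $$ (i, j) = (\<Sum>c\<in>N. f (c \<otimes> inv h) * R c $$ (i, j))"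
      unfolding UR[OF Nc[OF h] ij]
      by (rule sum.reindex_bij_witness[of _ "\<lambda>c. c \<otimes> inv h" "\<lambda>c. c \<otimes> h"])
        (use h Nc Ninv Nmult in \<open>auto simp: m_assoc\<close>)
    also have "\<dots> = (\<Sum>c\<in>N. f (inv ?k \<otimes> c) * R c $$ (i, j))"
      using f_twisted[OF _ h] by (intro sum.cong) auto
    also have "\<dots> = (R ?k * U) $$ (i, j)"
      unfolding RU[OF k(2) ij]
      by (rule sum.reindex_bij_witness[of _ "\<lambda>c. ?k \<otimes> c" "\<lambda>c. inv ?k \<otimes> c"])
        (use k Nc Ninv Nmult in \<open>auto simp: cancel_inv simp del: inv_mult_group\<close>)
    finally show "(U * R h) $$ (i, j) = (R ?k * U) $$ (i, j)" .
  qed (use U R'(2)[OF Nc[OF h]] R'(2)[OF Nc[OF tc[OF h]]] in auto)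
  have U0: "U \<noteq> 0\<^sub>m r r"
  proof
    assume z: "U = 0\<^sub>m r r"
    have "char_prod ?N (restrict \<chi> N) \<beta> \<noteq> 0"
    proof -
      have "restrict \<chi> N \<in> characters ?N" by (rule restrict_character[OF subgroup_N \<chi>c])
      from N.of_nat_multiplicity[OF this \<beta>] show ?thesis
        using \<chi>'(2) unfolding multiplicity_restrict[OF subgroup_N, of \<chi>] by auto
    qed
    then have "char_prod ?N (rep_character ?N R) (rep_character ?N \<rho>) \<noteq> 0"
      unfolding R_restrict \<beta>\<rho>[symmetric] .
    then obtain X where X: "X \<in> carrier_mat r n" "X \<noteq> 0\<^sub>m r n" "\<And>c. c \<in> N \<Longrightarrow> R c * X = X * \<rho> c"
      using N.nonzero_intertwiner_exists[OF RN \<rho>r] by auto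
    \<comment> \<open>\<open>X\<close> intertwines \<open>\<rho>\<close> with \<open>R\<close>, hence \<open>R(u) X = X \<rho>(u)\<close>, and \<open>V = \<rho>(u)\<close> is computed by the orthogonality of matrix entries.\<close>
    define V where "V = (of_nat (card N) / of_nat n) \<cdot>\<^sub>m A"
    have V: "V \<in> carrier_mat n n" using A by (simp add: V_def)
    have Vent: "(\<Sum>c\<in>N. f c * \<rho> c $$ (i, j)) = V $$ (i, j)" if ij: "i < n" "j < n" for i j
    proof -
      have "(\<Sum>c\<in>N. f c * \<rho> c $$ (i, j)) =
        (\<Sum>c\<in>N. \<Sum>a<n. \<Sum>b<n. A $$ (a, b) * (\<rho> c $$ (i, j) * \<rho> (inv c) $$ (b, a)))"
      proof (rule sum.cong[OF refl])
        fix c assume c: "c \<in> N"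
        have "f c = (\<Sum>a<n. \<Sum>b<n. A $$ (a, b) * \<rho> (inv c) $$ (b, a))"
          unfolding f_def mat_trace_def using A(1) \<rho>c[OF Ninv[OF c]]
          by (simp add: scalar_prod_def atLeast0LessThan)
        then show "f c * \<rho> c $$ (i, j) = (\<Sum>a<n. \<Sum>b<n. A $$ (a, b) * (\<rho> c $$ (i, j) * \<rho> (inv c) $$ (b, a)))"
          by (simp add: sum_distrib_right mult.assoc) (simp add: mult.commute)
      qed
      also have "\<dots> = (\<Sum>a<n. \<Sum>b<n. A $$ (a, b) * (\<Sum>c\<in>N. \<rho> c $$ (i, j) * \<rho> (inv c) $$ (b, a)))"
        unfolding sum_distrib_left by (subst sum.swap, rule sum.cong[OF refl], rule sum.swap)
      also have "\<dots> = (\<Sum>a<n. \<Sum>b<n. if a = i \<and> b = j then A $$ (i, j) * (of_nat (card N) / of_nat n) else 0)"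
      proof (intro sum.cong refl)
        fix a b assume ab: "a \<in> {..<n}" "b \<in> {..<n}"
        have "(\<Sum>c\<in>N. \<rho> c $$ (i, j) * \<rho> (inv c) $$ (b, a)) = N.average n n \<rho> \<rho> j b $$ (i, a)"
          using ab ij subgroup_N by (simp add: N.average_def cong: sum.cong)
        then show "A $$ (a, b) * (\<Sum>c\<in>N. \<rho> c $$ (i, j) * \<rho> (inv c) $$ (b, a)) =
          (if a = i \<and> b = j then A $$ (i, j) * (of_nat (card N) / of_nat n) else 0)"
          using N.average_entries[OF \<rho>, of j b i a] ab ij by auto
      qed
      also have "\<dots> = (\<Sum>a<n. if a = i then A $$ (i, j) * (of_nat (card N) / of_nat n) else 0)"
        using ij by (intro sum.cong) (auto simp: if_distrib cong: if_cong)
      also have "\<dots> = V $$ (i, j)" using ij A(1) by (simp add: V_def)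
      finally show ?thesis .
    qed
    have "X * V = U * X"
    proof (rule eq_matI)
      fix i j assume "i < dim_row (U * X)" "j < dim_col (U * X)"
      then have ij: "i < r" "j < n" using X U by auto
      have "(U * X) $$ (i, j) = (\<Sum>a<r. (\<Sum>c\<in>N. f c * R c $$ (i, a)) * X $$ (a, j))"
        using ij X by (simp add: U_def algebra_mat_def scalar_prod_def atLeast0LessThan)
      also have "\<dots> = (\<Sum>c\<in>N. f c * (\<Sum>a<r. R c $$ (i, a) * X $$ (a, j)))"
        by (simp add: sum_distrib_left sum_distrib_right mult.assoc) (rule sum.swap)
      also have "\<dots> = (\<Sum>c\<in>N. f c * (\<Sum>a<n. X $$ (i, a) * \<rho> c $$ (a, j)))"
      proof (rule sum.cong[OF refl])
        fix c assume c: "c \<in> N"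
        have "(\<Sum>a<r. R c $$ (i, a) * X $$ (a, j)) = (R c * X) $$ (i, j)"
          using ij X(1) R'(2)[OF Nc[OF c]] by (simp add: scalar_prod_def atLeast0LessThan)
        also have "\<dots> = (\<Sum>a<n. X $$ (i, a) * \<rho> c $$ (a, j))"
          unfolding X(3)[OF c] using ij X(1) \<rho>c[OF c] by (simp add: scalar_prod_def atLeast0LessThan)
        finally show "f c * (\<Sum>a<r. R c $$ (i, a) * X $$ (a, j)) = f c * (\<Sum>a<n. X $$ (i, a) * \<rho> c $$ (a, j))" by simp
      qed
      also have "\<dots> = (\<Sum>a<n. X $$ (i, a) * (\<Sum>c\<in>N. f c * \<rho> c $$ (a, j)))"
        by (simp add: sum_distrib_left mult.left_commute) (rule sum.swap)
      also have "\<dots> = (\<Sum>a<n. X $$ (i, a) * V $$ (a, j))"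
        using ij Vent by (intro sum.cong) auto
      also have "\<dots> = (X * V) $$ (i, j)" using ij X(1) V by (simp add: scalar_prod_def atLeast0LessThan)
      finally show "(X * V) $$ (i, j) = (U * X) $$ (i, j)" ..
    qed (use X U V in auto)
    then have XV: "X * V = 0\<^sub>m r n" using z X by simp
    have "V \<noteq> 0\<^sub>m n n"
    proof
      assume V0: "V = 0\<^sub>m n n"
      have "A = 0\<^sub>m n n"
      proof (rule eq_matI)
        fix i j assume ij: "i < dim_row (0\<^sub>m n n :: complex mat)" "j < dim_col (0\<^sub>m n n :: complex mat)"
        have "V $$ (i, j) = 0" using V0 ij by simp
        then show "A $$ (i, j) = 0\<^sub>m n n $$ (i, j)"
          using ij A(1) card_subgroup_pos[OF subgroup_N] by (auto simp: V_def)
      qed (use A in auto)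
      with A(2) show False by simp
    qed
    then obtain v where v: "v \<in> carrier_vec n" "V *\<^sub>v v \<noteq> 0\<^sub>v n" using nonzero_mat_vec[OF V] by blast
    have "X *\<^sub>v (V *\<^sub>v v) = (X * V) *\<^sub>v v" using assoc_mult_mat_vec[OF X(1) V v(1)] by simp
    also have "\<dots> = 0\<^sub>v r" unfolding XV using v(1) by auto
    finally have "X *\<^sub>v (V *\<^sub>v v) = 0\<^sub>v r" .
    moreover have "\<exists>B\<in>carrier_mat r r. X * \<rho> c = B * X" if "c \<in> carrier ?N" for c
      using that X(3)[of c] R'(2)[OF Nc, of c] by (intro bexI[of _ "R c"]) simp_all
    ultimately have "V *\<^sub>v v = 0\<^sub>v n"
      using irreducible_source_injective[OF \<rho> X(1,2)] V v(1) by auto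
    with v(2) show False by simp
  qed
  \<comment> \<open>\<open>U\<close> satisfies the same relations with \<open>R(N)\<close> and \<open>R(t)\<close> as \<open>R(t)\<close> does, so that Schur's lemma applies to the quotient \<open>S\<close>.\<close>
  define S where "S = R (inv t) * U"
  have ti: "inv t \<in> carrier G" using t by simp
  have S: "S \<in> carrier_mat r r" using R'(2)[OF ti] U by (auto simp: S_def)
  have tS: "R t * S = U"
  proof -
    have "R t * S = (R t * R (inv t)) * U"
      unfolding S_def by (rule assoc_mult_mat[symmetric]) (use R'(2)[OF t] R'(2)[OF ti] U in auto)
    then show ?thesis using representation_inv(1)[OF is_group Rr t] U by simp
  qed
  have St: "S * R t = R t * S"
  proof -
    have "S * R t = R (inv t) * (U * R t)"
      unfolding S_def by (rule assoc_mult_mat) (use R'(2)[OF t] R'(2)[OF ti] U in auto)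
    also have "\<dots> = (R (inv t) * R t) * U"
      unfolding Ut[symmetric] by (rule assoc_mult_mat[symmetric]) (use R'(2)[OF t] R'(2)[OF ti] U in auto)
    finally show ?thesis using representation_inv(2)[OF is_group Rr t] U tS by simp
  qed
  have Sh: "S * R h = R h * S" if h: "h \<in> N" for h
  proof -
    let ?k = "t \<otimes> h \<otimes> inv t"
    have k: "?k \<in> carrier G" using tc[OF h] Nc by auto
    note cc = R'(2)[OF Nc[OF h]] R'(2)[OF ti] R'(2)[OF k] U
    have "S * R h = R (inv t) * (U * R h)"
      unfolding S_def by (rule assoc_mult_mat) (use cc in auto)
    also have "\<dots> = (R (inv t) * R ?k) * U"
      unfolding Uh[OF h] by (rule assoc_mult_mat[symmetric]) (use cc in auto)
    also have "R (inv t) * R ?k = R (inv t \<otimes> ?k)" by (rule R'(3)[OF ti k, symmetric])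
    also have "inv t \<otimes> ?k = h \<otimes> inv t" using t Nc[OF h] by (simp add: m_assoc cancel_inv)
    also have "R (h \<otimes> inv t) = R h * R (inv t)" by (rule R'(3)[OF Nc[OF h] ti])
    also have "R h * R (inv t) * U = R h * S"
      unfolding S_def by (rule assoc_mult_mat) (use cc in auto)
    finally show ?thesis .
  qed
  have comm_mult: "S * R (g \<otimes> h) = R (g \<otimes> h) * S"
    if g: "g \<in> carrier G" "S * R g = R g * S" and h: "h \<in> carrier G" "S * R h = R h * S" for g h
  proof -
    note cc = R'(2)[OF g(1)] R'(2)[OF h(1)] S
    have "S * R (g \<otimes> h) = S * R g * R h"
      unfolding R'(3)[OF g(1) h(1)] by (rule assoc_mult_mat[symmetric]) (use cc in auto)
    also have "\<dots> = R g * (S * R h)"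
      unfolding g(2) by (rule assoc_mult_mat) (use cc in auto)
    also have "\<dots> = R g * R h * S"
      unfolding h(2) by (rule assoc_mult_mat[symmetric]) (use cc in auto)
    finally show ?thesis by (simp only: R'(3)[OF g(1) h(1)])
  qed
  have "S * R (t [^] (i::nat)) = R (t [^] i) * S" for i
  proof (induction i)
    case 0
    then show ?case using representation_one[OF is_group Rr] S by simp
  next
    case (Suc i)
    then show ?case using comm_mult[of "t [^] i" t] t St by simp
  qed
  then have "R g * S = S * R g" if "g \<in> carrier G" for g
    using gen[OF that] comm_mult t Nc Sh by (metis nat_pow_closed)
  then obtain s where s: "S = s \<cdot>\<^sub>m 1\<^sub>m r" using schur_scalar[OF R S] by blast
  have Us: "U = s \<cdot>\<^sub>m R t"
    unfolding tS[symmetric] s using mult_smult_distrib[OF R'(2)[OF t] one_carrier_mat] R'(2)[OF t] by simp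
  have s0: "s \<noteq> 0" using U0 R'(2)[OF t] unfolding Us by auto
  have "irreducible_representation ?N r R"
    unfolding irreducible_representation_def
  proof (intro conjI allI impI RN)
    fix W assume W: "VectorSpace.subspace class_ring W (module_vec TYPE(complex) r) \<and>
      (\<forall>g\<in>carrier ?N. \<forall>w\<in>W. R g *\<^sub>v w \<in> W)"
    then have W': "W \<subseteq> carrier_vec r" "0\<^sub>v r \<in> W" "\<And>v w. v \<in> W \<Longrightarrow> w \<in> W \<Longrightarrow> v + w \<in> W"
      "\<And>c v. v \<in> W \<Longrightarrow> c \<cdot>\<^sub>v v \<in> W" "\<And>g w. g \<in> N \<Longrightarrow> w \<in> W \<Longrightarrow> R g *\<^sub>v w \<in> W"
      by (auto simp: subspace_vec_iff)
    \<comment> \<open>\<open>s R(t) = U\<close> is a combination of the matrices \<open>R(c)\<close> with \<open>c \<in> N\<close>, which preserve \<open>W\<close>.\<close>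
    have tW: "R t *\<^sub>v w \<in> W" if w: "w \<in> W" for w
    proof -
      have wc: "w \<in> carrier_vec r" using w W' by auto
      have "vec r (\<lambda>i. \<Sum>c\<in>B. f c * (R c *\<^sub>v w) $ i) \<in> W" if "finite B" "B \<subseteq> N" for B
        using that
      proof (induction B rule: finite_induct)
        case empty
        have "vec r (\<lambda>i. \<Sum>c\<in>{}. f c * (R c *\<^sub>v w) $ i) = 0\<^sub>v r" by auto
        then show ?case using W' by simp
      next
        case (insert c B)
        have "vec r (\<lambda>i. \<Sum>c\<in>insert c B. f c * (R c *\<^sub>v w) $ i) =
          f c \<cdot>\<^sub>v (R c *\<^sub>v w) + vec r (\<lambda>i. \<Sum>c\<in>B. f c * (R c *\<^sub>v w) $ i)"
          using insert R'(2)[of c] Nc by (intro eq_vecI) auto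
        then show ?case using insert W' w by simp
      qed
      then have "vec r (\<lambda>i. \<Sum>c\<in>N. f c * (R c *\<^sub>v w) $ i) \<in> W" using N.fin by simp
      also have "vec r (\<lambda>i. \<Sum>c\<in>N. f c * (R c *\<^sub>v w) $ i) = s \<cdot>\<^sub>v (R t *\<^sub>v w)"
      proof (rule eq_vecI)
        fix i assume "i < dim_vec (s \<cdot>\<^sub>v (R t *\<^sub>v w))"
        then have i: "i < r" using R'(2)[OF t] by simp
        have "(\<Sum>c\<in>N. f c * (R c *\<^sub>v w) $ i) = (\<Sum>c\<in>N. \<Sum>a<r. f c * R c $$ (i, a) * w $ a)"
        proof (rule sum.cong[OF refl])
          fix c assume "c \<in> N"
          then show "f c * (R c *\<^sub>v w) $ i = (\<Sum>a<r. f c * R c $$ (i, a) * w $ a)"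
            using i R'(2)[of c] Nc wc by (simp add: scalar_prod_def atLeast0LessThan sum_distrib_left mult.assoc)
        qed
        also have "\<dots> = (\<Sum>a<r. (\<Sum>c\<in>N. f c * R c $$ (i, a)) * w $ a)"
          by (subst sum.swap) (simp add: sum_distrib_right)
        also have "\<dots> = (\<Sum>a<r. U $$ (i, a) * w $ a)"
          using i by (intro sum.cong) (auto simp: U_def algebra_mat_def)
        also have "\<dots> = s * (R t *\<^sub>v w) $ i"
          unfolding Us using i R'(2)[OF t] wc by (simp add: scalar_prod_def atLeast0LessThan sum_distrib_left mult.assoc)
        finally show "vec r (\<lambda>i. \<Sum>c\<in>N. f c * (R c *\<^sub>v w) $ i) $ i = (s \<cdot>\<^sub>v (R t *\<^sub>v w)) $ i"
          using i R'(2)[OF t] by simp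
      qed (use R'(2)[OF t] in auto)
      finally have "(1 / s) \<cdot>\<^sub>v (s \<cdot>\<^sub>v (R t *\<^sub>v w)) \<in> W" by (rule W'(4))
      then show ?thesis using s0 by (simp add: smult_smult_assoc)
    qed
    have pW: "R (t [^] (i::nat)) *\<^sub>v w \<in> W" if "w \<in> W" for i w
      using that
    proof (induction i arbitrary: w)
      case 0
      then show ?case using representation_one[OF is_group Rr] W'(1) by auto
    next
      case (Suc i)
      have wc: "w \<in> carrier_vec r" using Suc.prems W' by auto
      have "R (t [^] Suc i) *\<^sub>v w = R (t [^] i) *\<^sub>v (R t *\<^sub>v w)"
        using R'(3)[of "t [^] i" t] assoc_mult_mat_vec[OF R'(2)[of "t [^] i"] R'(2)[OF t] wc] t by simp
      then show ?case using Suc.IH[OF tW[OF Suc.prems]] by simp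
    qed
    show "W = {0\<^sub>v r} \<or> W = carrier_vec r"
    proof (rule irreducible_representationD(2)[OF R W'(1-4)])
      fix g w assume g: "g \<in> carrier G" and w: "w \<in> W"
      obtain i y where y: "y \<in> N" "g = t [^] (i::nat) \<otimes> y" using gen[OF g] by blast
      have wc: "w \<in> carrier_vec r" using w W' by auto
      have "R g *\<^sub>v w = R (t [^] i) *\<^sub>v (R y *\<^sub>v w)"
        using R'(3)[of "t [^] i" y] assoc_mult_mat_vec[OF R'(2)[of "t [^] i"] R'(2)[OF Nc[OF y(1)]] wc] t Nc[OF y(1)] y(2)
        by simp
      then show "R g *\<^sub>v w \<in> W" using pW W'(5)[OF y(1) w] by simp
    qed
  qed
  then have "restrict \<chi> N \<in> Irr ?N" unfolding R_restrict[symmetric] Irr_def by blast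
  from N.multiplicity_Irr[OF this \<beta>] show ?thesis
    using \<chi>'(2) unfolding multiplicity_restrict[OF subgroup_N, of \<chi>] by (auto split: if_splits)
qed

end

section \<open>Normal subgroups of prime index\<close>

lemma (in finite_group) card_subgroup_dvd:
  assumes "subgroup H G" shows "card H dvd card (carrier G)"
  using dvd_triv_right[of "card H" "card (rcosets H)"] unfolding lagrange[OF assms] Coset.order_def .

lemma root_of_unity_coprime:
  fixes z :: complex
  assumes "z ^ p = 1" and "z ^ k = 1" and "coprime k p" and "0 < k"
  shows "z = 1"
proof -
  obtain x y where xy: "k * x = p * y + 1"
    using bezout_nat[of k p] assms(3,4) by (auto simp: coprime_iff_gcd_eq_1)
  have "z ^ (k * x) = 1" using assms(2) by (simp add: power_mult)
  moreover have "z ^ (k * x) = z" unfolding xy using assms(1) by (simp add: power_mult)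
  ultimately show ?thesis by simp
qed

lemma coprime_less_prime: "prime p \<Longrightarrow> 0 < k \<Longrightarrow> k < p \<Longrightarrow> coprime k (p::nat)"
  by (meson coprime_commute dvd_imp_le not_le prime_imp_coprime)

lemma cis_root_eq_1_iff:
  assumes "n > 0"
  shows "cis (2 * pi / real n) ^ i = 1 \<longleftrightarrow> n dvd i"
proof
  assume "cis (2 * pi / real n) ^ i = 1"
  then have "cos (real i * (2 * pi / real n)) = 1" by (simp add: DeMoivre complex_eq_iff)
  then obtain k :: int where "real i * (2 * pi / real n) = real_of_int k * 2 * pi"
    unfolding cos_one_2pi_int by blast
  then have "real i = real_of_int k * real n" using assms by (simp add: field_simps)
  then have "int i = k * int n" by (metis of_int_eq_iff of_int_mult of_int_of_nat_eq)
  then show "n dvd i" by (metis dvd_triv_right int_dvd_int_iff)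
next
  assume "n dvd i"
  then obtain k where "i = n * k" by blast
  then have "cis (2 * pi / real n) ^ i = cis (2 * pi * real k)"
    using assms by (simp add: DeMoivre field_simps)
  then show "cis (2 * pi / real n) ^ i = 1" by (simp add: cis_multiple_2pi)
qed

context finite_group_normal
begin

lemma prime_index_generator:
  assumes p: "prime p" "card (carrier G) = p * card N" and x: "x \<in> carrier G" "x \<notin> N"
  shows "x [^] (i::nat) \<in> N \<longleftrightarrow> p dvd i"
    and "g \<in> carrier G \<Longrightarrow> \<exists>(i::nat) y. y \<in> N \<and> g = x [^] i \<otimes> y"
proof -
  obtain n :: nat where n: "n > 0" "x [^] n \<in> N" "\<And>m. m > 0 \<Longrightarrow> x [^] m \<in> N \<Longrightarrow> n \<le> m"
    using order_mod_N_exists[OF x(1)] by blast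
  let ?H = "{x [^] i \<otimes> y | (i::nat) y. y \<in> N}"
  have card: "card ?H = n * card N" by (rule card_powers_mod_N[OF x(1) n])
  have sub: "subgroup ?H G" by (rule powers_mod_N_subgroup[OF x(1)])
  have "n * card N dvd p * card N"
    using card_subgroup_dvd[OF sub] unfolding card p(2) .
  then have "n dvd p" using card_subgroup_pos[OF subgroup_N] by simp
  moreover have "n \<noteq> 1" using n(2) x by auto
  ultimately have np: "n = p" using p(1) by (metis prime_nat_iff)
  have "?H = carrier G"
    by (rule card_subset_eq[OF fin subgroup.subset[OF sub]]) (simp only: card p(2) np)
  then show "g \<in> carrier G \<Longrightarrow> \<exists>(i::nat) y. y \<in> N \<and> g = x [^] i \<otimes> y" by blast
  show "x [^] (i::nat) \<in> N \<longleftrightarrow> p dvd i" using pow_mod_N_iff[OF x(1) n] np by simp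
qed

text \<open>
  For a generator \<open>x\<close> of \<open>G/N\<close> and a primitive \<open>p\<close>-th root of unity \<open>\<omega>\<close> the character is
  \<open>\<mu>(x\<^sup>i y) = \<omega>\<^sup>i\<close>; it separates \<open>N\<close> from the rest of \<open>G\<close>.
\<close>

lemma prime_index_linear_char:
  assumes p: "prime p" "card (carrier G) = p * card N"
  shows "\<exists>x \<mu>. x \<in> carrier G \<and> (\<forall>g\<in>carrier G. \<exists>(i::nat) y. y \<in> N \<and> g = x [^] i \<otimes> y) \<and>
    linear_char G \<mu> \<and> (\<forall>g\<in>carrier G. \<mu> g = 1 \<longleftrightarrow> g \<in> N) \<and> (\<forall>g\<in>carrier G. \<mu> g ^ p = 1)"
proof -
  have "N \<noteq> carrier G"
  proof
    assume "N = carrier G"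
    then have "p = 1" using p(2) card_pos by simp
    then show False using p(1) by simp
  qed
  then obtain x where x: "x \<in> carrier G" "x \<notin> N" using N_subset by blast
  note iff = prime_index_generator(1)[OF p x] and gen = prime_index_generator(2)[OF p x]
  have p0: "p > 0" using p(1) by (simp add: prime_gt_0_nat)
  define \<omega> where "\<omega> = cis (2 * pi / real p)"
  have \<omega>: "\<omega> ^ i = 1 \<longleftrightarrow> p dvd i" for i unfolding \<omega>_def by (rule cis_root_eq_1_iff[OF p0])
  have \<omega>0: "\<omega> \<noteq> 0" by (simp add: \<omega>_def)
  define \<mu> where "\<mu> g = \<omega> ^ (SOME i. \<exists>y\<in>N. g = x [^] (i::nat) \<otimes> y)" for g
  \<comment> \<open>\<open>\<mu>\<close> does not depend on the chosen exponent: \<open>x\<^sup>j\<^sup>-\<^sup>i \<in> N\<close> only if \<open>p\<close> divides \<open>j - i\<close>.\<close>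
  have eq: "\<omega> ^ i = \<omega> ^ j" if le: "i \<le> j" and yz: "y \<in> N" "z \<in> N" "x [^] i \<otimes> y = x [^] j \<otimes> z"
    for i j :: nat and y z
  proof -
    have "x [^] (j - i) \<in> N" by (rule pow_diff_in_N(1)[OF x(1) le yz])
    then have "\<omega> ^ (j - i) = 1" using iff \<omega> by blast
    moreover have "\<omega> ^ j = \<omega> ^ i * \<omega> ^ (j - i)" using le by (simp flip: power_add)
    ultimately show ?thesis by simp
  qed
  have val: "\<mu> (x [^] i \<otimes> y) = \<omega> ^ i" if y: "y \<in> N" for i :: nat and y
  proof -
    define j where "j = (SOME j. \<exists>z\<in>N. x [^] i \<otimes> y = x [^] (j::nat) \<otimes> z)"
    have "\<exists>z\<in>N. x [^] i \<otimes> y = x [^] j \<otimes> z" unfolding j_def by (rule someI[of _ i]) (use y in blast)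
    then obtain z where z: "z \<in> N" "x [^] i \<otimes> y = x [^] j \<otimes> z" by blast
    have "\<omega> ^ j = \<omega> ^ i"
    proof (cases "i \<le> j")
      case True
      show ?thesis by (rule eq[OF True y z, symmetric])
    next
      case False
      then have "j \<le> i" by simp
      from eq[OF this z(1) y z(2)[symmetric]] show ?thesis .
    qed
    then show ?thesis by (simp add: \<mu>_def j_def)
  qed
  have "linear_char G \<mu>"
    unfolding linear_char_def
  proof (intro conjI ballI)
    have "\<mu> (x [^] (0::nat) \<otimes> \<one>) = \<omega> ^ 0" by (rule val[OF subgroup.one_closed[OF subgroup_N]])
    then show "\<mu> \<one> = 1" by simp
    fix g h assume gh: "g \<in> carrier G" "h \<in> carrier G"
    obtain i :: nat and y where g: "y \<in> N" "g = x [^] i \<otimes> y" using gen[OF gh(1)] by blast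
    obtain j :: nat and z where h: "z \<in> N" "h = x [^] j \<otimes> z" using gen[OF gh(2)] by blast
    have c: "y \<in> carrier G" "z \<in> carrier G" using g h N_subset by auto
    have n: "inv (x [^] j) \<otimes> y \<otimes> x [^] j \<otimes> z \<in> N"
      using conj_closed[of "inv (x [^] j)" y] x g(1) h(1) subgroup_N by (simp add: subgroup.m_closed)
    have "g \<otimes> h = x [^] (i + j) \<otimes> (inv (x [^] j) \<otimes> y \<otimes> x [^] j \<otimes> z)"
      using x c unfolding g h nat_pow_mult[OF x(1), symmetric] by (simp add: m_assoc cancel_inv)
    then have "\<mu> (g \<otimes> h) = \<omega> ^ (i + j)" using val[OF n] by simp
    then show "\<mu> (g \<otimes> h) = \<mu> g * \<mu> h" using val g h by (simp add: power_add)
  qed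
  moreover have "\<mu> g = 1 \<longleftrightarrow> g \<in> N" and "\<mu> g ^ p = 1" if g: "g \<in> carrier G" for g
  proof -
    obtain i :: nat and y where y: "y \<in> N" "g = x [^] i \<otimes> y" using gen[OF g] by blast
    have c: "y \<in> carrier G" using y N_subset by auto
    have "g \<in> N \<longleftrightarrow> x [^] i \<in> N"
    proof
      assume "x [^] i \<in> N"
      then show "g \<in> N" using y subgroup_N by (simp add: subgroup.m_closed)
    next
      assume gN: "g \<in> N"
      have e: "x [^] i = g \<otimes> inv y" using y c x by (simp add: m_assoc)
      show "x [^] i \<in> N"
        unfolding e by (rule subgroup.m_closed[OF subgroup_N gN subgroup.m_inv_closed[OF subgroup_N y(1)]])
    qed
    then show "\<mu> g = 1 \<longleftrightarrow> g \<in> N" using val[OF y(1), of i] y(2) \<omega> iff by simp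
    have "\<mu> g ^ p = (\<omega> ^ p) ^ i" using val[OF y(1), of i] y(2) by (simp add: power_mult[symmetric] mult.commute)
    then show "\<mu> g ^ p = 1" using \<omega>[of p] by simp
  qed
  ultimately show ?thesis using x gen by blast
qed

lemma multiplicity_twist:
  assumes "\<And>x. x \<in> N \<Longrightarrow> \<mu> x = 1"
  shows "char_multiplicity (G\<lparr>carrier := N\<rparr>) (twist G \<mu> \<eta>) \<theta> = char_multiplicity (G\<lparr>carrier := N\<rparr>) \<eta> \<theta>"
proof -
  have "char_prod (G\<lparr>carrier := N\<rparr>) (twist G \<mu> \<eta>) \<theta> = char_prod (G\<lparr>carrier := N\<rparr>) \<eta> \<theta>"
    using assms N_subset by (intro finite_group.char_prod_cong[OF finite_group_N]) (auto simp: twist_def)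
  then show ?thesis by (simp add: char_multiplicity_def)
qed

text \<open>
  If \<open>\<eta>\<close> equalled one of its twists, it would vanish outside \<open>N\<close>; then the norm of \<open>\<eta>\<close> would give
  \<open>p = e\<^sup>2\<close> for \<open>e = [\<eta>\<^sub>N, \<theta>]\<close>, which is impossible for a prime. So there are \<open>p\<close> different twists,
  and \<open>\<Sum>e\<^sup>2 = p\<close> leaves room for nothing else.
\<close>

theorem prime_index_extensions:
  assumes p: "prime p" "card (carrier G) = p * card N"
    and \<mu>: "linear_char G \<mu>" "\<And>g. g \<in> carrier G \<Longrightarrow> \<mu> g = 1 \<longleftrightarrow> g \<in> N" "\<And>g. g \<in> carrier G \<Longrightarrow> \<mu> g ^ p = 1"
    and \<theta>: "\<theta> \<in> Irr (G\<lparr>carrier := N\<rparr>)" "invariant_character G N \<theta>" and \<eta>: "\<eta> \<in> Irr_above G N \<theta>"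
  shows "char_multiplicity (G\<lparr>carrier := N\<rparr>) \<eta> \<theta> = 1"
    and "inj_on (\<lambda>i. twist G (\<lambda>x. \<mu> x ^ i) \<eta>) {..<p}"
    and "Irr_above G N \<theta> = (\<lambda>i. twist G (\<lambda>x. \<mu> x ^ i) \<eta>) ` {..<p}"
proof -
  let ?N = "G\<lparr>carrier := N\<rparr>" and ?t = "\<lambda>i. twist G (\<lambda>x. \<mu> x ^ i) \<eta>"
  interpret N: finite_group ?N by (rule finite_group_N)
  have \<eta>I: "\<eta> \<in> Irr G" and pos: "char_multiplicity ?N \<eta> \<theta> > 0"
    using \<eta> unfolding Irr_above_eq[OF subgroup_N \<theta>(1)] by auto
  have \<eta>c: "\<eta> \<in> characters G" by (rule Irr_character[OF \<eta>I])
  define e where "e = char_multiplicity ?N \<eta> \<theta>"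
  have p0: "p > 0" using p(1) by (simp add: prime_gt_0_nat)
  have \<mu>N: "\<mu> x ^ i = 1" if "x \<in> N" for x i using that \<mu>(2)[of x] N_subset by auto
  \<comment> \<open>If \<open>\<eta>\<close> vanished outside \<open>N\<close>, its norm would be \<open>e\<^sup>2 |N| / |G| = e\<^sup>2 / p\<close>.\<close>
  have no_vanish: "\<exists>g\<in>carrier G - N. \<eta> g \<noteq> 0"
  proof (rule ccontr)
    assume "\<not> ?thesis"
    then have v: "\<eta> g = 0" if "g \<in> carrier G - N" for g using that by blast
    have rest: "\<eta> x = of_nat e * \<theta> x" if "x \<in> N" for x
      unfolding e_def by (rule invariant_restriction[OF \<theta> \<eta> that])
    have "of_nat (card (carrier G)) = (\<Sum>x\<in>carrier G. \<eta> x * \<eta> (inv x))"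
      using Irr_orthonormal[OF \<eta>I \<eta>I] card_pos by (simp add: char_prod_def field_simps)
    also have "\<dots> = (\<Sum>x\<in>N. \<eta> x * \<eta> (inv x))"
      by (rule sum.mono_neutral_right[OF fin N_subset]) (simp add: v)
    also have "\<dots> = of_nat e ^ 2 * (\<Sum>x\<in>N. \<theta> x * \<theta> (inv x))"
      unfolding sum_distrib_left
      by (rule sum.cong) (use subgroup_N in \<open>auto simp: rest subgroup.m_inv_closed power2_eq_square\<close>)
    also have "(\<Sum>x\<in>N. \<theta> x * \<theta> (inv x)) = of_nat (card N)"
      using N.Irr_orthonormal[OF \<theta>(1) \<theta>(1)] card_subgroup_pos[OF subgroup_N]
      by (simp add: char_prod_subgroup[OF subgroup_N] field_simps)
    finally have "complex_of_nat (p * card N) = of_nat (e ^ 2 * card N)" by (simp add: p(2))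
    then have "p * card N = e ^ 2 * card N" by (simp only: of_nat_eq_iff)
    then have "p = e ^ 2" using card_subgroup_pos[OF subgroup_N] by simp
    then show False using p(1) by (simp add: prime_power_iff)
  qed
  have inj: "?t i \<noteq> ?t j" if ij: "i < j" "j < p" for i j
  proof
    assume eq: "?t i = ?t j"
    obtain g where g: "g \<in> carrier G" "g \<notin> N" "\<eta> g \<noteq> 0" using no_vanish by blast
    have "\<mu> g ^ i = \<mu> g ^ j" using fun_cong[OF eq, of g] g by (simp add: twist_def)
    moreover have "\<mu> g \<noteq> 0" using \<mu>(3)[OF g(1)] p0 by (metis power_0_left zero_neq_one neq0_conv)
    moreover have "\<mu> g ^ j = \<mu> g ^ i * \<mu> g ^ (j - i)" using ij by (simp add: power_add[symmetric])
    ultimately have "\<mu> g ^ (j - i) = 1" by simp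
    then have "\<mu> g = 1" using root_of_unity_coprime[OF \<mu>(3)[OF g(1)], of "j - i"] coprime_less_prime[OF p(1), of "j - i"] ij
      by simp
    then show False using \<mu>(2)[OF g(1)] g(2) by simp
  qed
  then show inj': "inj_on ?t {..<p}" by (intro linorder_inj_onI') auto
  have mult: "char_multiplicity ?N (?t i) \<theta> = e" for i
    unfolding e_def by (rule multiplicity_twist) (simp add: \<mu>N)
  have above: "?t i \<in> Irr_above G N \<theta>" for i
    unfolding Irr_above_eq[OF subgroup_N \<theta>(1)]
    using twist_Irr[OF linear_char_power[OF \<mu>(1)] \<eta>I] mult pos by (simp add: e_def)
  have fin_above: "finite (Irr_above G N \<theta>)" using finite_Irr by (simp add: Irr_above_def)
  have sq: "(\<Sum>\<chi>\<in>Irr_above G N \<theta>. (char_multiplicity ?N \<chi> \<theta>)\<^sup>2) = p"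
    using sum_squares_above[OF \<theta>] p(2) card_subgroup_pos[OF subgroup_N] by simp
  have part: "(\<Sum>\<chi>\<in>?t ` {..<p}. (char_multiplicity ?N \<chi> \<theta>)\<^sup>2) = p * e\<^sup>2"
    by (subst sum.reindex[OF inj']) (simp add: mult)
  have "(\<Sum>\<chi>\<in>?t ` {..<p}. (char_multiplicity ?N \<chi> \<theta>)\<^sup>2) \<le> (\<Sum>\<chi>\<in>Irr_above G N \<theta>. (char_multiplicity ?N \<chi> \<theta>)\<^sup>2)"
    by (rule sum_mono2[OF fin_above]) (use above in auto)
  then have le: "p * e\<^sup>2 \<le> p" unfolding part sq .
  then have "e\<^sup>2 \<le> 1" using p0 by simp
  moreover have "e \<le> e\<^sup>2" by (simp add: power2_eq_square)
  ultimately have "e = 1" using pos by (simp add: e_def)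
  then show "char_multiplicity ?N \<eta> \<theta> = 1" by (simp add: e_def)
  have rest0: "(\<Sum>\<chi>\<in>Irr_above G N \<theta> - ?t ` {..<p}. (char_multiplicity ?N \<chi> \<theta>)\<^sup>2) = 0"
    using sum.subset_diff[OF _ fin_above, of "?t ` {..<p}" "\<lambda>\<chi>. (char_multiplicity ?N \<chi> \<theta>)\<^sup>2"] above
    unfolding sq part \<open>e = 1\<close> by auto
  have "\<chi> \<in> ?t ` {..<p}" if \<chi>: "\<chi> \<in> Irr_above G N \<theta>" for \<chi>
  proof (rule ccontr)
    assume "\<chi> \<notin> ?t ` {..<p}"
    then have "char_multiplicity ?N \<chi> \<theta> = 0" using rest0 fin_above \<chi> by simp
    then show False using \<chi> unfolding Irr_above_eq[OF subgroup_N \<theta>(1)] by simp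
  qed
  then show "Irr_above G N \<theta> = ?t ` {..<p}" using above by blast
qed

end

section \<open>Normal series with prime indices\<close>

text \<open>
  A supersolvable quotient \<open>G/N\<close> is used only through a chain of normal subgroups of \<open>G\<close> that leads
  from \<open>N\<close> to \<open>G\<close> in steps of prime index.
\<close>

inductive prime_series :: "('a, 'b) monoid_scheme \<Rightarrow> 'a set \<Rightarrow> bool" for G where
  top: "prime_series G (carrier G)"
| step: "\<lbrakk>prime_series G M; M \<lhd> G; N \<lhd> G; N \<subseteq> M; prime p; card M = p * card N\<rbrakk> \<Longrightarrow> prime_series G N"

lemma nat_pow_subgroup: "x [^]\<^bsub>G\<lparr>carrier := H\<rparr>\<^esub> (n::nat) = x [^]\<^bsub>G\<^esub> n"
  by (simp add: nat_pow_def)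

context finite_group
begin

text \<open>
  Intersecting a step \<open>N \<le> M\<close> of the series with \<open>T\<close> either makes it trivial, or \<open>M \<inter> T\<close> contains some
  \<open>x \<notin> N\<close>. In the second case the powers of \<open>x\<close> represent the cosets of \<open>N\<close> in \<open>M\<close> and also those of
  \<open>N \<inter> T\<close> in \<open>M \<inter> T\<close>.
\<close>

lemma prime_series_subgroup:
  assumes "prime_series G N" and T: "subgroup T G"
  shows "prime_series (G\<lparr>carrier := T\<rparr>) (N \<inter> T)"
  using assms(1)
proof induction
  case top
  have "carrier G \<inter> T = carrier (G\<lparr>carrier := T\<rparr>)" using subgroup.subset[OF T] by auto
  then show ?case using prime_series.top[of "G\<lparr>carrier := T\<rparr>"] by simp
next
  case (step M N p)
  have nM: "M \<inter> T \<lhd> G\<lparr>carrier := T\<rparr>" and nN: "N \<inter> T \<lhd> G\<lparr>carrier := T\<rparr>"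
    using normal_Int_subgroup[OF T] step.hyps by auto
  have Ms: "subgroup M G" using step.hyps by (simp add: normal_imp_subgroup)
  show ?case
  proof (cases "M \<inter> T \<subseteq> N")
    case True
    then have "M \<inter> T = N \<inter> T" using step.hyps by blast
    then show ?thesis using step.IH by simp
  next
    case False
    then obtain x where x: "x \<in> M" "x \<in> T" "x \<notin> N" by blast
    interpret M: finite_group_normal "G\<lparr>carrier := M\<rparr>" N
      using subgroup_finite_group[OF Ms] normal_restrict_supergroup[OF Ms step.hyps(3,4)]
      by (simp add: finite_group_normal_def finite_group_normal_axioms_def)
    have index: "card (carrier (G\<lparr>carrier := M\<rparr>)) = p * card N" using step.hyps by simp
    have xM: "x \<in> carrier (G\<lparr>carrier := M\<rparr>)" using x by simp
    note iff = M.prime_index_generator(1)[OF step.hyps(5) index xM x(3), unfolded nat_pow_subgroup]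
    note gen = M.prime_index_generator(2)[OF step.hyps(5) index xM x(3), unfolded nat_pow_subgroup, simplified]
    interpret T: finite_group_normal "G\<lparr>carrier := T\<rparr>" "N \<inter> T"
      using subgroup_finite_group[OF T] nN by (simp add: finite_group_normal_def finite_group_normal_axioms_def)
    have xG: "x \<in> carrier G" using x subgroup.subset[OF T] by auto
    have powT: "x [^] (i::nat) \<in> T" for i
      using x T by (induction i) (simp_all add: subgroup.one_closed subgroup.m_closed)
    have powM: "x [^] (i::nat) \<in> M" for i
      using x Ms by (induction i) (simp_all add: subgroup.one_closed subgroup.m_closed)
    have p0: "p > 0" using step.hyps by (simp add: prime_gt_0_nat)
    have "card {x [^] i \<otimes> y | (i::nat) y. y \<in> N \<inter> T} = p * card (N \<inter> T)"
      using T.card_powers_mod_N[of x p, unfolded nat_pow_subgroup] x p0 iff powT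
      by (auto intro: dvd_imp_le)
    moreover have "{x [^] i \<otimes> y | (i::nat) y. y \<in> N \<inter> T} = M \<inter> T"
    proof (intro equalityI subsetI)
      fix g assume "g \<in> {x [^] i \<otimes> y | (i::nat) y. y \<in> N \<inter> T}"
      then obtain i :: nat and y where "g = x [^] i \<otimes> y" "y \<in> N" "y \<in> T" by blast
      then show "g \<in> M \<inter> T"
        using powT[of i] powM[of i] step.hyps(4) subgroup.m_closed[OF T] subgroup.m_closed[OF Ms] by blast
    next
      fix g assume g: "g \<in> M \<inter> T"
      then obtain i :: nat and y where y: "y \<in> N" "g = x [^] i \<otimes> y" using gen[of g] by blast
      have "y \<in> carrier G" using y(1) step.hyps(4) subgroup.subset[OF Ms] by auto
      then have "y = inv (x [^] i) \<otimes> g" using y(2) xG by (simp add: cancel_inv)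
      then have "y \<in> T" using g powT[of i] T by (simp add: subgroup.m_closed subgroup.m_inv_closed)
      then show "g \<in> {x [^] i \<otimes> y | (i::nat) y. y \<in> N \<inter> T}" using y by blast
    qed
    ultimately have "card (M \<inter> T) = p * card (N \<inter> T)" by simp
    then show ?thesis
      using step.hyps(4) by (intro prime_series.step[OF step.IH nM nN _ step.hyps(5)]) auto
  qed
qed

lemma normal_pow_coset:
  assumes K: "K \<lhd> G" and u: "u \<in> carrier G" and k: "k \<in> K"
  shows "\<exists>y\<in>K. (u \<otimes> k) [^] (m::nat) = u [^] m \<otimes> y"
proof -
  interpret K: finite_group_normal G K
    by (rule finite_group_normalI[OF K])
  have kG: "k \<in> carrier G" using k K.N_subset by auto
  show ?thesis
  proof (induction m)
    case 0
    then show ?case using subgroup.one_closed[OF K.subgroup_N] by (intro bexI[of _ \<one>]) auto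
  next
    case (Suc m)
    then obtain y where y: "y \<in> K" "(u \<otimes> k) [^] m = u [^] m \<otimes> y" by blast
    have yG: "y \<in> carrier G" using y K.N_subset by auto
    have "inv u \<otimes> y \<otimes> u \<in> K" using K.conj_closed[of "inv u" y] u y by simp
    then have "inv u \<otimes> y \<otimes> u \<otimes> k \<in> K" using k K.subgroup_N by (simp add: subgroup.m_closed)
    moreover have "(u \<otimes> k) [^] Suc m = u [^] Suc m \<otimes> (inv u \<otimes> y \<otimes> u \<otimes> k)"
      using u kG yG y(2) by (simp add: m_assoc cancel_inv)
    ultimately show ?case by blast
  qed
qed

text \<open>A normal cyclic factor is refined through the subgroups of its cyclic group, all of which are normal in \<open>G\<close>.\<close>

lemma prime_series_cyclic_factor:
  assumes "K \<lhd> G" and "H \<lhd> G" and "K \<subseteq> H" and "prime_series G H" and "x \<in> H"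
    and "\<And>h. h \<in> H \<Longrightarrow> \<exists>(i::nat) y. y \<in> K \<and> h = x [^] i \<otimes> y"
  shows "prime_series G K"
  using assms
proof (induction "card H" arbitrary: H x rule: less_induct)
  case less
  interpret K: finite_group_normal G K
    by (rule finite_group_normalI[OF less.prems(1)])
  have Hs: "subgroup H G" using less.prems(2) by (rule normal_imp_subgroup)
  have HG: "H \<subseteq> carrier G" by (rule subgroup.subset[OF Hs])
  have x: "x \<in> carrier G" using less.prems(5) HG by auto
  show ?case
  proof (cases "x \<in> K")
    case True
    have pow: "x [^] (i::nat) \<in> K" for i
      using True K.subgroup_N by (induction i) (simp_all add: subgroup.one_closed subgroup.m_closed)
    have "H \<subseteq> K"
    proof
      fix h assume "h \<in> H"
      then obtain i :: nat and y where "y \<in> K" "h = x [^] i \<otimes> y" using less.prems(6) by blast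
      then show "h \<in> K" using subgroup.m_closed[OF K.subgroup_N pow] by simp
    qed
    then show ?thesis using less.prems(3,4) by simp
  next
    case False
    obtain n :: nat where n: "n > 0" "x [^] n \<in> K" "\<And>m. m > 0 \<Longrightarrow> x [^] m \<in> K \<Longrightarrow> n \<le> m"
      using K.order_mod_N_exists[OF x] by blast
    note iff = K.pow_mod_N_iff[OF x n]
    have "n \<noteq> 1" using n(2) False x by auto
    then obtain r where r: "prime r" "r dvd n" using prime_factor_nat by blast
    then obtain m where m: "n = r * m" by blast
    have m0: "m > 0" using n(1) m by simp
    have r0: "r > 0" using n(1) m by simp
    \<comment> \<open>The next lower term is generated by \<open>K\<close> and \<open>x\<^sup>r\<close> and has index \<open>r\<close> in \<open>H\<close>.\<close>
    define z where "z = x [^] r"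
    have z: "z \<in> carrier G" using x by (simp add: z_def)
    have zpow: "z [^] (i::nat) = x [^] (r * i)" for i using x by (simp add: z_def nat_pow_pow)
    define H' where "H' = {z [^] i \<otimes> y | (i::nat) y. y \<in> K}"
    have "H \<subseteq> {x [^] i \<otimes> y | (i::nat) y. y \<in> K}" using less.prems(6) by blast
    moreover have "{x [^] i \<otimes> y | (i::nat) y. y \<in> K} \<subseteq> H"
    proof -
      have "x [^] (i::nat) \<in> H" for i
        using less.prems(5) Hs by (induction i) (simp_all add: subgroup.one_closed subgroup.m_closed)
      then show ?thesis using subgroup.m_closed[OF Hs] less.prems(3) by blast
    qed
    ultimately have "H = {x [^] i \<otimes> y | (i::nat) y. y \<in> K}" by blast
    then have cardH: "card H = n * card K" using K.card_powers_mod_N[OF x n] by simp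
    have zK: "z [^] (i::nat) \<in> K \<longleftrightarrow> m dvd i" for i
      using iff[of "r * i"] r0 unfolding zpow m by simp
    have cardH': "card H' = m * card K"
      unfolding H'_def by (rule K.card_powers_mod_N[OF z m0]) (auto simp: zK dest: dvd_imp_le)
    have H's: "subgroup H' G" unfolding H'_def by (rule K.powers_mod_N_subgroup[OF z])
    have xpow: "x [^] (i::nat) \<in> H" for i
      using less.prems(5) Hs by (induction i) (simp_all add: subgroup.one_closed subgroup.m_closed)
    have sub: "H' \<subseteq> H" unfolding H'_def zpow using xpow subgroup.m_closed[OF Hs] less.prems(3) by blast
    have H'n: "H' \<lhd> G"
      unfolding normal_inv_iff
    proof (intro conjI ballI H's)
      fix g h assume g: "g \<in> carrier G" and "h \<in> H'"
      then obtain i :: nat and y where y: "y \<in> K" "h = z [^] i \<otimes> y" unfolding H'_def by blast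
      have yG: "y \<in> carrier G" using y K.N_subset by auto
      have "g \<otimes> x \<otimes> inv g \<in> H" using normal.inv_op_closed2[OF less.prems(2) g less.prems(5)] .
      then obtain a :: nat and k where k: "k \<in> K" "g \<otimes> x \<otimes> inv g = x [^] a \<otimes> k" using less.prems(6) by blast
      obtain k' where k': "k' \<in> K" "(x [^] a \<otimes> k) [^] (r * i) = (x [^] a) [^] (r * i) \<otimes> k'"
        using normal_pow_coset[OF less.prems(1) _ k(1), of "x [^] a" "r * i"] x by auto
      have k'G: "k' \<in> carrier G" using k' K.N_subset by auto
      have gy: "g \<otimes> y \<otimes> inv g \<in> K" by (rule K.conj_closed[OF g y(1)])
      have "g \<otimes> h \<otimes> inv g = (g \<otimes> x [^] (r * i) \<otimes> inv g) \<otimes> (g \<otimes> y \<otimes> inv g)"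
        using g x yG by (simp add: y(2) zpow m_assoc cancel_inv)
      also have "\<dots> = z [^] (a * i) \<otimes> (k' \<otimes> (g \<otimes> y \<otimes> inv g))"
        unfolding conj_nat_pow[OF g x] k(2) k'(2) zpow using x k'G gy K.N_subset
        by (simp add: nat_pow_pow m_assoc mult.left_commute subset_iff)
      finally show "g \<otimes> h \<otimes> inv g \<in> H'"
        unfolding H'_def using subgroup.m_closed[OF K.subgroup_N k'(1) gy] by blast
    qed
    have "card H = r * card H'" by (simp add: cardH cardH' m)
    then have ser: "prime_series G H'"
      by (intro prime_series.step[OF less.prems(4,2) H'n sub r(1)])
    have KH': "K \<subseteq> H'"
    proof
      fix y assume y: "y \<in> K"
      then have "y = z [^] (0::nat) \<otimes> y" using K.N_subset by auto
      then show "y \<in> H'" unfolding H'_def using y by blast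
    qed
    have zH': "z \<in> H'"
    proof -
      have "z = z [^] (1::nat) \<otimes> \<one>" using z by simp
      then show ?thesis unfolding H'_def using subgroup.one_closed[OF K.subgroup_N] by blast
    qed
    have "card H' < card H"
      using cardH cardH' m m0 prime_gt_1_nat[OF r(1)] card_subgroup_pos[OF K.subgroup_N] by simp
    then show ?thesis
      by (rule less.hyps[OF _ less.prems(1) H'n KH' ser zH']) (auto simp: H'_def)
  qed
qed

lemma preimage_normal:
  assumes N: "N \<lhd> G" and H: "H \<lhd> G Mod N"
  shows "{g \<in> carrier G. N #> g \<in> H} \<lhd> G"
proof -
  interpret Q: group "G Mod N" by (rule normal.factorgroup_is_group[OF N])
  have hom: "(\<lambda>g. N #> g) \<in> hom G (G Mod N)" by (rule normal.r_coset_hom_Mod[OF N])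
  interpret q: group_hom G "G Mod N" "\<lambda>g. N #> g"
    using hom by unfold_locales
  have Hs: "subgroup H (G Mod N)" using H by (rule normal_imp_subgroup)
  show ?thesis
    unfolding normal_inv_iff
  proof (intro conjI ballI)
    show "subgroup {g \<in> carrier G. N #> g \<in> H} G"
    proof (rule subgroupI)
      have "\<one> \<in> {g \<in> carrier G. N #> g \<in> H}" using q.hom_one subgroup.one_closed[OF Hs] by simp
      then show "{g \<in> carrier G. N #> g \<in> H} \<noteq> {}" by blast
      show "inv a \<in> {g \<in> carrier G. N #> g \<in> H}" if "a \<in> {g \<in> carrier G. N #> g \<in> H}" for a
        using that q.hom_inv[of a] subgroup.m_inv_closed[OF Hs, of "N #> a"] by simp
      show "a \<otimes> b \<in> {g \<in> carrier G. N #> g \<in> H}"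
        if "a \<in> {g \<in> carrier G. N #> g \<in> H}" "b \<in> {g \<in> carrier G. N #> g \<in> H}" for a b
        using that q.hom_mult[of a b] subgroup.m_closed[OF Hs, of "N #> a" "N #> b"] by simp
    qed auto
    fix g h assume g: "g \<in> carrier G" and h: "h \<in> {g \<in> carrier G. N #> g \<in> H}"
    have "N #> (g \<otimes> h \<otimes> inv g) = (N #> g) \<otimes>\<^bsub>G Mod N\<^esub> (N #> h) \<otimes>\<^bsub>G Mod N\<^esub> inv\<^bsub>G Mod N\<^esub> (N #> g)"
      using g h q.hom_mult[of "g \<otimes> h" "inv g"] q.hom_mult[of g h] q.hom_inv[of g] by simp
    also have "\<dots> \<in> H" using normal.inv_op_closed2[OF H q.hom_closed[OF g], of "N #> h"] h by simp
    finally show "g \<otimes> h \<otimes> inv g \<in> {g \<in> carrier G. N #> g \<in> H}" using g h by simp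
  qed
qed

lemma supersolvable_seq_normal:
  assumes "group Q" and "supersolvable_seq Q H"
  shows "H \<lhd> Q"
  using assms(2) by cases (auto intro: group.one_is_normal[OF assms(1)])

text \<open>
  The terms of the series of \<open>G/N\<close> are pulled back to \<open>G\<close>, and each cyclic factor is refined.
\<close>

lemma supersolvable_prime_series:
  assumes N: "N \<lhd> G" and ss: "supersolvable (G Mod N)"
  shows "prime_series G N"
proof -
  let ?Q = "G Mod N"
  let ?pre = "\<lambda>H. {g \<in> carrier G. N #> g \<in> H}"
  interpret Q: group ?Q by (rule normal.factorgroup_is_group[OF N])
  have homq: "(\<lambda>g. N #> g) \<in> hom G ?Q" by (rule normal.r_coset_hom_Mod[OF N])
  have Ns: "subgroup N G" using N by (rule normal_imp_subgroup)
  have "prime_series G (?pre H) \<longrightarrow> prime_series G N" if "supersolvable_seq ?Q H" for H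
    using that
  proof induction
    case unity
    have "?pre {\<one>\<^bsub>?Q\<^esub>} = N"
      using coset_join1[OF _ _ Ns] coset_join2[OF _ Ns] subgroup.subset[OF Ns]
      by (auto simp: FactGroup_def)
    then show ?case by simp
  next
    case (extension K H)
    have K: "K \<lhd> ?Q" by (rule supersolvable_seq_normal[OF Q.is_group extension.hyps(1)])
    have Ks: "subgroup K ?Q" and Hs: "subgroup H ?Q"
      using K extension.hyps by (simp_all add: normal_imp_subgroup)
    have Kn: "?pre K \<lhd> G" and Hn: "?pre H \<lhd> G" using preimage_normal[OF N] K extension.hyps by auto
    have pHs: "subgroup (?pre H) G" using Hn by (rule normal_imp_subgroup)
    let ?QH = "?Q\<lparr>carrier := H\<rparr>" and ?GH = "G\<lparr>carrier := ?pre H\<rparr>"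
    interpret QH: group ?QH by (rule subgroup.subgroup_is_group[OF Hs Q.is_group])
    have KH: "K \<lhd> ?QH" by (rule Q.normal_restrict_supergroup[OF Hs K extension.hyps(2)])
    interpret F: group "?QH Mod K" by (rule normal.factorgroup_is_group[OF KH])
    interpret GH: finite_group ?GH by (rule subgroup_finite_group[OF pHs])
    have h1: "(\<lambda>g. N #> g) \<in> hom ?GH ?QH"
      using homq unfolding hom_def by auto
    have h2: "(\<lambda>a. K #>\<^bsub>?QH\<^esub> a) \<in> hom ?QH (?QH Mod K)" by (rule normal.r_coset_hom_Mod[OF KH])
    define \<phi> where "\<phi> = (\<lambda>a. K #>\<^bsub>?QH\<^esub> a) \<circ> (\<lambda>g. N #> g)"
    have h: "\<phi> \<in> hom ?GH (?QH Mod K)" unfolding \<phi>_def by (rule Group.hom_compose[OF h1 h2])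
    interpret \<phi>: group_hom ?GH "?QH Mod K" \<phi> using h by unfold_locales
    have ker: "g \<in> ?pre K" if "g \<in> ?pre H" "\<phi> g = \<one>\<^bsub>?QH Mod K\<^esub>" for g
    proof -
      have KsH: "subgroup K ?QH" using KH by (rule normal_imp_subgroup)
      have "K #>\<^bsub>?QH\<^esub> (N #> g) = K" using that by (simp add: \<phi>_def FactGroup_def)
      then have "N #> g \<in> K" using QH.coset_join1[OF _ _ KsH, of "N #> g"] that subgroup.subset[OF KsH] by simp
      then show ?thesis using that by simp
    qed
    obtain X where X: "X \<in> carrier (?QH Mod K)" "carrier (?QH Mod K) = range (\<lambda>n::int. X [^]\<^bsub>?QH Mod K\<^esub> n)"
      using extension.hyps(4) unfolding F.cyclic_group by blast
    have surj: "\<exists>x\<in>?pre H. \<phi> x = Y" if "Y \<in> carrier (?QH Mod K)" for Y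
    proof -
      have "Y \<in> (\<lambda>a. K #>\<^bsub>?QH\<^esub> a) ` carrier ?QH" using that unfolding carrier_FactGroup .
      then obtain a where a': "Y = K #>\<^bsub>?QH\<^esub> a" "a \<in> carrier ?QH" by (rule imageE)
      then have a: "a \<in> H" "Y = K #>\<^bsub>?QH\<^esub> a" by simp_all
      have "a \<in> carrier ?Q" using a(1) subgroup.subset[OF Hs] by auto
      then obtain g where "g \<in> carrier G" "a = N #> g" by (auto simp: FactGroup_def RCOSETS_def)
      then show ?thesis using a by (intro bexI[of _ g]) (auto simp: \<phi>_def)
    qed
    obtain x where x: "x \<in> ?pre H" "\<phi> x = X" using surj[OF X(1)] by blast
    have xG: "x \<in> carrier ?GH" "x \<in> carrier G" using x by auto
    have gen: "\<exists>(i::nat) y. y \<in> ?pre K \<and> g = x [^] i \<otimes> y" if g: "g \<in> ?pre H" for g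
    proof -
      have gG: "g \<in> carrier ?GH" using g by simp
      have "\<phi> g \<in> carrier (?QH Mod K)" by (rule \<phi>.hom_closed[OF gG])
      then obtain n :: int where n: "\<phi> g = X [^]\<^bsub>?QH Mod K\<^esub> n" using X(2) by auto
      have "\<exists>i::nat. x [^]\<^bsub>?GH\<^esub> n = x [^]\<^bsub>?GH\<^esub> i"
      proof (cases "n < 0")
        case True
        obtain k :: nat where "inv\<^bsub>?GH\<^esub> (x [^]\<^bsub>?GH\<^esub> nat (- n)) = x [^]\<^bsub>?GH\<^esub> k"
          using GH.inv_pow_eq_pow[OF xG(1)] by blast
        then have "x [^]\<^bsub>?GH\<^esub> n = x [^]\<^bsub>?GH\<^esub> k"
          using True by (simp only: int_pow_def2 if_True)
        then show ?thesis by blast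
      next
        case False
        then have "x [^]\<^bsub>?GH\<^esub> n = x [^]\<^bsub>?GH\<^esub> nat n" by (simp only: int_pow_def2 if_False)
        then show ?thesis by blast
      qed
      then obtain i :: nat where i: "x [^]\<^bsub>?GH\<^esub> n = x [^]\<^bsub>?GH\<^esub> i" by blast
      let ?z = "x [^]\<^bsub>?GH\<^esub> i"
      have z: "?z \<in> carrier ?GH" by (rule GH.nat_pow_closed[OF xG(1)])
      have "\<phi> ?z = \<phi> g" using \<phi>.hom_int_pow[OF xG(1), of n] unfolding i x(2) n .
      note z\<phi> = this
      define y where "y = inv\<^bsub>?GH\<^esub> ?z \<otimes>\<^bsub>?GH\<^esub> g"
      have zi: "inv\<^bsub>?GH\<^esub> ?z \<in> carrier ?GH" by (rule GH.inv_closed[OF z])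
      have "\<phi> y = \<phi> (inv\<^bsub>?GH\<^esub> ?z) \<otimes>\<^bsub>?QH Mod K\<^esub> \<phi> g" unfolding y_def by (rule \<phi>.hom_mult[OF zi gG])
      also have "\<phi> (inv\<^bsub>?GH\<^esub> ?z) = inv\<^bsub>?QH Mod K\<^esub> (\<phi> g)" using \<phi>.hom_inv[OF z] unfolding z\<phi> .
      also have "inv\<^bsub>?QH Mod K\<^esub> (\<phi> g) \<otimes>\<^bsub>?QH Mod K\<^esub> \<phi> g = \<one>\<^bsub>?QH Mod K\<^esub>"
        by (rule F.l_inv[OF \<phi>.hom_closed[OF gG]])
      finally have y1: "\<phi> y = \<one>\<^bsub>?QH Mod K\<^esub>" .
      have carr: "carrier ?GH = ?pre H" by simp
      have "y \<in> ?pre H" using GH.m_closed[OF zi gG] unfolding y_def carr .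
      then have yK: "y \<in> ?pre K" using y1 by (rule ker)
      have "g = ?z \<otimes>\<^bsub>?GH\<^esub> y" unfolding y_def by (rule GH.cancel_inv(1)[OF z gG, symmetric])
      then have "g = x [^] i \<otimes> y" by (simp add: nat_pow_subgroup)
      with yK show ?thesis by blast
    qed
    show ?case
    proof
      assume "prime_series G (?pre H)"
      then have "prime_series G (?pre K)"
        by (rule prime_series_cyclic_factor[OF Kn Hn _ _ x(1) gen, rotated]) (use extension.hyps(2) in auto)
      then show "prime_series G N" using extension.IH by simp
    qed
  qed
  from this[of "carrier ?Q"] have "prime_series G (?pre (carrier ?Q)) \<longrightarrow> prime_series G N"
    using ss unfolding supersolvable_def by simp
  moreover have "?pre (carrier ?Q) = carrier G" by (auto simp: FactGroup_def RCOSETS_def)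
  ultimately show ?thesis using prime_series.top[of G] by simp
qed

end

section \<open>One step of prime index\<close>

lemma root_power_cong:
  fixes z :: complex
  assumes "z ^ p = 1" and "[k = l] (mod p)"
  shows "z ^ k = z ^ l"
proof -
  have "z ^ k = z ^ (k mod p)" for k
  proof -
    have "z ^ k = z ^ (p * (k div p) + k mod p)" by simp
    also have "\<dots> = z ^ (k mod p)" using assms(1) unfolding power_add power_mult by simp
    finally show ?thesis .
  qed
  from this[of k] this[of l] show ?thesis using assms(2) by (simp add: cong_def)
qed

lemma root_power_eq_imp_cong:
  fixes z :: complex
  assumes "prime p" and "z ^ p = 1" and "z \<noteq> 1" and "z ^ k = z ^ l"
  shows "[k = l] (mod p)"
proof -
  have z0: "z \<noteq> 0" using assms(1,2) by (auto simp: power_0_left)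
  have *: "[k = l] (mod p)" if kl: "k \<le> l" "z ^ k = z ^ l" for k l
  proof -
    have "z ^ l = z ^ k * z ^ (l - k)" using kl(1) by (simp flip: power_add)
    then have 1: "z ^ (l - k) = 1" using kl(2) z0 by simp
    have "p dvd l - k"
    proof (rule ccontr)
      assume n: "\<not> p dvd l - k"
      then have "coprime (l - k) p" using assms(1) by (meson coprime_commute prime_imp_coprime)
      moreover have "l - k > 0" using n by (cases "l - k") auto
      ultimately show False using root_of_unity_coprime[OF assms(2) 1] assms(3) by blast
    qed
    then show ?thesis using kl(1) by (metis cong_altdef_nat cong_sym)
  qed
  show ?thesis
  proof (cases "k \<le> l")
    case True
    then show ?thesis using assms(4) by (rule *)
  next
    case False
    then show ?thesis using cong_sym[OF *[OF _ assms(4)[symmetric]]] by simp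
  qed
qed

text \<open>
  The situation after one step of a normal series: \<open>M/N\<close> has prime order \<open>p\<close>, the character \<open>\<theta>\<close> of
  \<open>N\<close> is invariant in \<open>G\<close>, \<open>\<eta>\<close> is an extension to \<open>M\<close>, and \<open>\<mu>\<close> generates the linear characters
  of \<open>M/N\<close>.
\<close>

locale prime_step = finite_group +
  fixes N M :: "'a set" and p :: nat and \<theta> \<eta> \<mu> :: "'a \<Rightarrow> complex" and x :: 'a
  assumes N_normal: "N \<lhd> G" and M_normal: "M \<lhd> G" and NM: "N \<subseteq> M"
    and p: "prime p" and index: "card M = p * card N"
    and \<theta>: "\<theta> \<in> Irr (G\<lparr>carrier := N\<rparr>)" and \<theta>_inv: "invariant_character G N \<theta>"
    and \<eta>: "\<eta> \<in> Irr_above (G\<lparr>carrier := M\<rparr>) N \<theta>"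
    and x: "x \<in> M" and gen: "\<And>g. g \<in> M \<Longrightarrow> \<exists>(i::nat) y. y \<in> N \<and> g = x [^] i \<otimes> y"
    and \<mu>: "linear_char (G\<lparr>carrier := M\<rparr>) \<mu>" and \<mu>_ker: "\<And>g. g \<in> M \<Longrightarrow> \<mu> g = 1 \<longleftrightarrow> g \<in> N"
    and \<mu>_pow: "\<And>g. g \<in> M \<Longrightarrow> \<mu> g ^ p = 1"

sublocale prime_step \<subseteq> M: finite_group_normal G M
  by (rule finite_group_normalI[OF M_normal])

sublocale prime_step \<subseteq> N: finite_group_normal G N
  by (rule finite_group_normalI[OF N_normal])

context prime_step
begin

abbreviation (input) "GM \<equiv> G\<lparr>carrier := M\<rparr>"
abbreviation (input) "GN \<equiv> G\<lparr>carrier := N\<rparr>"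

definition tw :: "nat \<Rightarrow> 'a \<Rightarrow> complex" where
  "tw i = twist GM (\<lambda>x. \<mu> x ^ i) \<eta>"

lemma N_in_M: "finite_group_normal GM N"
  by (rule N.normal_in_intermediate[OF M.subgroup_N NM])

lemma M_elem: "m \<in> M \<Longrightarrow> m \<in> carrier G"
  using M.N_subset by auto

lemma p_gt_1: "p > 1"
  using p by (rule prime_gt_1_nat)

lemma \<mu>_one: "\<mu> \<one> = 1"
  using \<mu> by (simp add: linear_char_def)

lemma \<mu>_mult: "a \<in> M \<Longrightarrow> b \<in> M \<Longrightarrow> \<mu> (a \<otimes> b) = \<mu> a * \<mu> b"
  using \<mu> by (simp add: linear_char_def)

lemma M_mult: "a \<in> M \<Longrightarrow> b \<in> M \<Longrightarrow> a \<otimes> b \<in> M"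
  using subgroup.m_closed[OF M.subgroup_N] .

lemma M_inv: "a \<in> M \<Longrightarrow> inv a \<in> M"
  using subgroup.m_inv_closed[OF M.subgroup_N] .

lemma \<mu>_pow_elem: "a \<in> M \<Longrightarrow> a [^] (i::nat) \<in> M" "a \<in> M \<Longrightarrow> \<mu> (a [^] (i::nat)) = \<mu> a ^ i"
proof -
  assume a: "a \<in> M"
  have "a [^] i \<in> M \<and> \<mu> (a [^] i) = \<mu> a ^ i"
    using a subgroup.one_closed[OF M.subgroup_N]
    by (induction i) (simp_all add: \<mu>_one \<mu>_mult M_mult)
  then show "a [^] i \<in> M" "\<mu> (a [^] i) = \<mu> a ^ i" by auto
qed

lemma M_neq_N: "\<exists>m\<in>M. m \<notin> N"
proof (rule ccontr)
  assume "\<not> ?thesis"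
  then have "M = N" using NM by blast
  then show False using index p_gt_1 card_subgroup_pos[OF N.subgroup_N] by simp
qed

lemma \<mu>_x_neq_1: "\<mu> x \<noteq> 1"
proof
  assume "\<mu> x = 1"
  then have "g \<in> N" if g: "g \<in> M" for g
  proof -
    obtain i :: nat and y where y: "y \<in> N" "g = x [^] i \<otimes> y" using gen[OF g] by blast
    have "\<mu> g = \<mu> x ^ i * \<mu> y"
      using y NM x by (simp add: \<mu>_mult \<mu>_pow_elem subsetD)
    also have "\<dots> = 1" using \<open>\<mu> x = 1\<close> \<mu>_ker[of y] y(1) NM by auto
    finally show ?thesis using \<mu>_ker[OF g] by simp
  qed
  then show False using M_neq_N by blast
qed

lemma \<theta>_inv_M: "invariant_character GM N \<theta>"
  using \<theta>_inv M.N_subset m_inv_consistent[OF M.subgroup_N] by (auto simp: invariant_character_def)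

lemma extensions:
  shows extension_multiplicity: "char_multiplicity GN \<eta> \<theta> = 1"
    and tw_inj: "inj_on tw {..<p}"
    and extensions_eq: "Irr_above GM N \<theta> = tw ` {..<p}"
proof -
  interpret MN: finite_group_normal GM N by (rule N_in_M)
  have \<theta>': "\<theta> \<in> Irr (GM\<lparr>carrier := N\<rparr>)" using \<theta> by simp
  have ind: "card (carrier GM) = p * card N" using index by simp
  have t: "tw = (\<lambda>i. twist GM (\<lambda>x. \<mu> x ^ i) \<eta>)" by (simp add: tw_def fun_eq_iff)
  have "\<mu> g = 1 \<longleftrightarrow> g \<in> N" "\<mu> g ^ p = 1" if "g \<in> carrier GM" for g
    using \<mu>_ker[of g] \<mu>_pow[of g] that by simp_all
  note MN.prime_index_extensions[OF p ind \<mu> this \<theta>' \<theta>_inv_M \<eta>]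
  then show "char_multiplicity GN \<eta> \<theta> = 1" "inj_on tw {..<p}" "Irr_above GM N \<theta> = tw ` {..<p}"
    unfolding t by simp_all
qed

lemma tw_mod: "tw i = tw (i mod p)"
proof -
  have "\<mu> m ^ i = \<mu> m ^ (i mod p)" if "m \<in> M" for m
    by (rule root_power_cong[OF \<mu>_pow[OF that]]) (simp add: cong_def)
  then show ?thesis by (auto simp: tw_def twist_def restrict_def)
qed

lemma tw_eq_iff: "tw i = tw j \<longleftrightarrow> [i = j] (mod p)"
proof -
  have "tw i = tw j \<longleftrightarrow> tw (i mod p) = tw (j mod p)" using tw_mod by metis
  also have "\<dots> \<longleftrightarrow> i mod p = j mod p" using inj_on_eq_iff[OF tw_inj] p_gt_1 by simp
  finally show ?thesis by (simp add: cong_def)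
qed

lemma tw_above: "tw i \<in> Irr_above GM N \<theta>"
  unfolding extensions_eq using p_gt_1 by (subst tw_mod) auto

lemma \<eta>_Irr: "\<eta> \<in> Irr GM"
  using \<eta> by (simp add: Irr_above_def)

lemma \<eta>_extensional: "\<eta> \<in> extensional M"
  using characters_extensional[of \<eta> GM] \<eta>_Irr Irr_subset_characters[of GM] by auto

lemma tw_0: "tw 0 = \<eta>"
  using \<eta>_extensional by (auto simp: tw_def twist_def restrict_def extensional_def fun_eq_iff)

lemma tw_Irr: "tw i \<in> Irr GM"
  using tw_above[of i] by (simp add: Irr_above_def)

lemma tw_apply: "m \<in> M \<Longrightarrow> tw i m = \<mu> m ^ i * \<eta> m"
  by (simp add: tw_def twist_def)

lemma tw_degree: "degree_nat G (tw i) = degree_nat G \<eta>"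
  using tw_apply[OF subgroup.one_closed[OF M.subgroup_N], of i] by (simp add: degree_nat_def \<mu>_one)

lemma tw_multiplicity: "char_multiplicity GN (tw i) \<theta> > 0"
proof -
  interpret MN: finite_group_normal GM N by (rule N_in_M)
  show ?thesis using tw_above[of i] MN.Irr_above_eq[OF MN.subgroup_N, of \<theta>] \<theta> by simp
qed

text \<open>\<open>G\<close> acts on \<open>M/N\<close> by exponents: \<open>\<mu>\<^sup>g = \<mu>\<^sup>k\<close>.\<close>

definition acts_by :: "'a \<Rightarrow> nat \<Rightarrow> bool" where
  "acts_by g k \<longleftrightarrow> (\<forall>m\<in>M. \<mu> (g \<otimes> m \<otimes> inv g) = \<mu> m ^ k)"

lemma acts_by_exists:
  assumes g: "g \<in> carrier G"
  shows "\<exists>k. acts_by g k"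
proof -
  obtain k :: nat and y where y: "y \<in> N" "g \<otimes> x \<otimes> inv g = x [^] k \<otimes> y"
    using gen[OF M.conj_closed[OF g x]] by blast
  have yM: "y \<in> M" using y NM by auto
  have gx: "\<mu> (g \<otimes> x \<otimes> inv g) = \<mu> x ^ k"
    using y \<mu>_ker[OF yM] yM x by (simp add: \<mu>_mult \<mu>_pow_elem)
  have "\<mu> (g \<otimes> m \<otimes> inv g) = \<mu> m ^ k" if m: "m \<in> M" for m
  proof -
    obtain i :: nat and z where z: "z \<in> N" "m = x [^] i \<otimes> z" using gen[OF m] by blast
    have zM: "z \<in> M" using z NM by auto
    have "g \<otimes> m \<otimes> inv g = (g \<otimes> x \<otimes> inv g) [^] i \<otimes> (g \<otimes> z \<otimes> inv g)"
      unfolding conj_nat_pow[OF g M_elem[OF x], symmetric] z(2) using g M_elem[OF x] M_elem[OF zM] by (simp add: m_assoc cancel_inv)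
    moreover have "\<mu> (g \<otimes> z \<otimes> inv g) = 1"
      using \<mu>_ker[OF M.conj_closed[OF g zM]] N.conj_closed[OF g z(1)] by simp
    ultimately have "\<mu> (g \<otimes> m \<otimes> inv g) = (\<mu> x ^ k) ^ i"
      using M.conj_closed[OF g x] M.conj_closed[OF g zM] by (simp add: \<mu>_mult \<mu>_pow_elem gx)
    also have "\<dots> = (\<mu> x ^ i) ^ k" by (simp add: power_mult[symmetric] mult.commute)
    also have "\<mu> x ^ i = \<mu> m"
      using z \<mu>_ker[OF zM] zM x by (simp add: \<mu>_mult \<mu>_pow_elem)
    finally show ?thesis .
  qed
  then show ?thesis unfolding acts_by_def by blast
qed

lemma acts_by_mult:
  assumes "g \<in> carrier G" "h \<in> carrier G" "acts_by g k" "acts_by h l"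
  shows "acts_by (g \<otimes> h) (k * l)"
  unfolding acts_by_def
proof
  fix m assume m: "m \<in> M"
  have "g \<otimes> h \<otimes> m \<otimes> inv (g \<otimes> h) = g \<otimes> (h \<otimes> m \<otimes> inv h) \<otimes> inv g"
    using assms M_elem[OF m] by (simp add: m_assoc inv_mult_group)
  then show "\<mu> (g \<otimes> h \<otimes> m \<otimes> inv (g \<otimes> h)) = \<mu> m ^ (k * l)"
    using assms M.conj_closed[OF assms(2) m] m by (simp add: acts_by_def power_mult[symmetric] mult.commute)
qed

lemma acts_by_cong:
  assumes "acts_by g k" and "[k = l] (mod p)"
  shows "acts_by g l"
  unfolding acts_by_def
proof
  fix m assume m: "m \<in> M"
  then show "\<mu> (g \<otimes> m \<otimes> inv g) = \<mu> m ^ l"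
    using assms(1) root_power_cong[OF \<mu>_pow[OF m] assms(2)] by (simp add: acts_by_def)
qed

lemma acts_by_unique: "acts_by g k \<Longrightarrow> acts_by g l \<Longrightarrow> [k = l] (mod p)"
  using root_power_eq_imp_cong[OF p \<mu>_pow[OF x] \<mu>_x_neq_1] x unfolding acts_by_def by metis

lemma acts_by_one: "acts_by \<one> 1"
  by (simp add: acts_by_def M_elem)

lemma acts_by_pow: "g \<in> carrier G \<Longrightarrow> acts_by g k \<Longrightarrow> acts_by (g [^] (i::nat)) (k ^ i)"
proof (induction i)
  case 0
  then show ?case using acts_by_one by simp
next
  case (Suc i)
  then show ?case using acts_by_mult[of "g [^] i" g "k ^ i" k] by (simp add: mult.commute)
qed

lemma acts_by_coprime:
  assumes g: "g \<in> carrier G" and k: "acts_by g k"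
  shows "coprime k p"
proof -
  obtain l where l: "acts_by (inv g) l" using acts_by_exists[of "inv g"] g by auto
  have "acts_by \<one> (k * l)" using acts_by_mult[OF g _ k l] g by simp
  then have "[k * l = 1] (mod p)" using acts_by_unique acts_by_one by blast
  then show ?thesis by (metis coprime_iff_invertible_nat One_nat_def)
qed

text \<open>
  The centralizer of \<open>M/N\<close> in \<open>G\<close>.
\<close>

definition C :: "'a set" where
  "C = {g \<in> carrier G. acts_by g 1}"

lemma M_subset_C: "M \<subseteq> C"
proof
  fix g assume g: "g \<in> M"
  have "\<mu> (g \<otimes> m \<otimes> inv g) = \<mu> m" if m: "m \<in> M" for m
  proof -
    have "\<mu> (g \<otimes> m \<otimes> inv g) = (\<mu> g * \<mu> (inv g)) * \<mu> m"
      using g m by (simp add: \<mu>_mult M_mult M_inv)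
    also have "\<mu> g * \<mu> (inv g) = 1"
      using \<mu>_mult[OF g M_inv[OF g]] M_elem[OF g] by (simp add: \<mu>_one)
    finally show ?thesis by simp
  qed
  then show "g \<in> C" using M_elem[OF g] by (simp add: C_def acts_by_def)
qed

lemma C_normal: "C \<lhd> G"
  unfolding normal_inv_iff
proof (intro conjI ballI)
  have inv_acts: "acts_by (inv g) 1" if g: "g \<in> carrier G" "acts_by g 1" for g
  proof -
    obtain l where l: "acts_by (inv g) l" using acts_by_exists[of "inv g"] g by auto
    have "acts_by \<one> (1 * l)" using acts_by_mult[OF g(1) _ g(2) l] g by simp
    then have "[l = 1] (mod p)" using acts_by_unique acts_by_one by simp
    then show ?thesis using acts_by_cong[OF l] by blast
  qed
  show "subgroup C G"
  proof (rule subgroupI)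
    show "C \<subseteq> carrier G" by (auto simp: C_def)
    show "C \<noteq> {}" using acts_by_one by (auto simp: C_def)
    show "inv a \<in> C" if "a \<in> C" for a using that inv_acts by (auto simp: C_def)
    show "a \<otimes> b \<in> C" if "a \<in> C" "b \<in> C" for a b
      using that acts_by_mult[of a b 1 1] by (auto simp: C_def)
  qed
  fix g h assume g: "g \<in> carrier G" and h: "h \<in> C"
  obtain k where k: "acts_by g k" using acts_by_exists[OF g] by blast
  obtain l where l: "acts_by (inv g) l" using acts_by_exists[of "inv g"] g by auto
  have "acts_by \<one> (k * l)" using acts_by_mult[OF g _ k l] g by simp
  then have kl: "[k * l = 1] (mod p)" using acts_by_unique acts_by_one by blast
  have "acts_by (g \<otimes> h) (k * 1)" using acts_by_mult[OF g _ k, of h 1] h by (simp add: C_def)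
  then have "acts_by (g \<otimes> h \<otimes> inv g) (k * 1 * l)"
    using acts_by_mult[of "g \<otimes> h" "inv g"] l g h by (simp add: C_def)
  then have "acts_by (g \<otimes> h \<otimes> inv g) 1" using acts_by_cong kl by simp
  then show "g \<otimes> h \<otimes> inv g \<in> C" using g h by (simp add: C_def)
qed

text \<open>
  Fix a primitive root \<open>r\<close>. The numbers \<open>i\<close> for which some element of \<open>G\<close> acts on \<open>M/N\<close> with exponent \<open>r\<^sup>i\<close>
  are the multiples of the least positive one; an element \<open>t\<close> that realizes this one generates \<open>G/C\<close>.
\<close>

lemma quotient_by_C_cyclic:
  obtains t where "t \<in> carrier G" and "\<And>g. g \<in> carrier G \<Longrightarrow> \<exists>(i::nat) y. y \<in> C \<and> g = t [^] i \<otimes> y"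
proof -
  obtain r where r: "residue_primroot p r" using prime_primitive_root_exists[OF p_gt_1 p] by blast
  have rlog: "\<exists>i. [k = r ^ i] (mod p)" if k: "coprime k p" for k
  proof -
    have "k mod p \<in> totatives p"
      using k p_gt_1 p by (auto simp: in_totatives_iff coprime_commute dvd_eq_mod_eq_0[symmetric] intro!: Nat.gr0I)
    then obtain i where "k mod p = r ^ i mod p"
      using residue_primroot_is_generator[OF p_gt_1 r] by (auto simp: bij_betw_def)
    then show ?thesis by (auto simp: cong_def)
  qed
  have fermat: "[r ^ (p - 1) = 1] (mod p)"
    using r p by (intro fermat_theorem) (auto simp: residue_primroot_def coprime_absorb_left)
  define I where "I = {i. \<exists>g\<in>carrier G. acts_by g (r ^ i)}"
  have "p - 1 \<in> I" unfolding I_def using acts_by_cong[OF acts_by_one cong_sym[OF fermat]] by blast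
  then have ex: "\<exists>j. j > 0 \<and> j \<in> I" using p_gt_1 by (intro exI[of _ "p - 1"]) auto
  define j where "j = (LEAST j. j > 0 \<and> j \<in> I)"
  have j: "j > 0" "j \<in> I" using LeastI_ex[OF ex] by (auto simp: j_def)
  have least: "j \<le> i" if "i > 0" "i \<in> I" for i
    unfolding j_def using that by (intro Least_le) auto
  obtain t where t: "t \<in> carrier G" "acts_by t (r ^ j)" using j(2) by (auto simp: I_def)
  have "\<exists>(i::nat) y. y \<in> C \<and> g = t [^] i \<otimes> y" if g: "g \<in> carrier G" for g
  proof -
    obtain k where k: "acts_by g k" using acts_by_exists[OF g] by blast
    obtain i where i: "[k = r ^ i] (mod p)" using rlog[OF acts_by_coprime[OF g k]] by blast
    have gi: "acts_by g (r ^ i)" by (rule acts_by_cong[OF k i])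
    define q where "q = i div j"
    have tq: "t [^] q \<in> carrier G" using t by simp
    \<comment> \<open>Division of \<open>i\<close> by \<open>j\<close> leaves the exponent \<open>i mod j\<close>. Exponents of \<open>r\<close> are natural numbers, so the inverse of \<open>t\<^sup>q\<close> is written as a power of \<open>t\<close>.\<close>
    obtain q' :: nat where q': "inv (t [^] q) = t [^] q'" using inv_pow_eq_pow[OF t(1)] by blast
    have aq': "acts_by (t [^] q') (r ^ (j * q'))" using acts_by_pow[OF t, of q'] by (simp add: power_mult)
    have aq: "acts_by (t [^] q) (r ^ (j * q))" using acts_by_pow[OF t, of q] by (simp add: power_mult)
    have "acts_by \<one> (r ^ (j * q') * r ^ (j * q))"
      using acts_by_mult[OF _ tq aq' aq] t q' tq by (metis l_inv nat_pow_closed)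
    then have inv1: "[r ^ (j * q') * r ^ (j * q) = 1] (mod p)" using acts_by_unique acts_by_one by blast
    let ?s = "i mod j"
    have "acts_by (inv (t [^] q) \<otimes> g) (r ^ (j * q') * r ^ i)"
      unfolding q' using acts_by_mult[OF _ g aq' gi] t by simp
    moreover have "[r ^ (j * q') * r ^ i = r ^ ?s] (mod p)"
    proof -
      have "r ^ i = r ^ (j * q) * r ^ ?s" unfolding q_def by (simp flip: power_add)
      then have "r ^ (j * q') * r ^ i = (r ^ (j * q') * r ^ (j * q)) * r ^ ?s" by simp
      also have "[\<dots> = 1 * r ^ ?s] (mod p)" using inv1 by (rule cong_scalar_right)
      finally show ?thesis by simp
    qed
    ultimately have s: "acts_by (inv (t [^] q) \<otimes> g) (r ^ ?s)" by (rule acts_by_cong)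
    then have "?s \<in> I" unfolding I_def using tq g by blast
    then have "?s = 0" using least[of ?s] mod_less_divisor[OF j(1), of i] by (cases "?s = 0") auto
    then have "inv (t [^] q) \<otimes> g \<in> C" using s tq g by (simp add: C_def)
    moreover have "g = t [^] q \<otimes> (inv (t [^] q) \<otimes> g)" using tq g by (simp add: cancel_inv)
    ultimately show ?thesis by blast
  qed
  then show ?thesis using that t(1) by blast
qed

text \<open>
  By Fermat's theorem \<open>t\<^sup>p\<^sup>-\<^sup>1\<close> acts trivially on \<open>M/N\<close>.
\<close>

lemma index_C_dvd:
  assumes t: "t \<in> carrier G" and gen_t: "\<And>g. g \<in> carrier G \<Longrightarrow> \<exists>(i::nat) y. y \<in> C \<and> g = t [^] i \<otimes> y"
  shows "\<exists>d. card (carrier G) = d * card C \<and> d dvd p - 1"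
proof -
  interpret C: finite_group_normal G C by (rule finite_group_normalI[OF C_normal])
  obtain n :: nat where n: "n > 0" "t [^] n \<in> C" "\<And>m. m > 0 \<Longrightarrow> t [^] m \<in> C \<Longrightarrow> n \<le> m"
    using C.order_mod_N_exists[OF t] by blast
  have "{t [^] i \<otimes> y | (i::nat) y. y \<in> C} = carrier G"
    using t C.N_subset gen_t by (intro equalityI subsetI) (auto, blast)
  then have "card (carrier G) = n * card C" using C.card_powers_mod_N[OF t n] by simp
  moreover have "n dvd p - 1"
  proof -
    obtain k where k: "acts_by t k" using acts_by_exists[OF t] by blast
    have "\<not> p dvd k" using acts_by_coprime[OF t k] p by (auto simp: coprime_absorb_right)
    then have "[k ^ (p - 1) = 1] (mod p)" by (rule fermat_theorem[OF p])
    then have "acts_by (t [^] (p - 1)) 1" using acts_by_cong[OF acts_by_pow[OF t k]] by blast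
    then have "t [^] (p - 1) \<in> C" using t by (simp add: C_def)
    then show ?thesis using C.pow_mod_N_iff[OF t n] by simp
  qed
  ultimately show ?thesis by blast
qed

lemma conj_\<eta>:
  assumes g: "g \<in> carrier G"
  shows "\<exists>s<p. conj_char M g \<eta> = tw s"
proof -
  interpret MN: finite_group_normal GM N by (rule N_in_M)
  have \<eta>c: "\<eta> \<in> characters GM" by (rule Irr_character[OF \<eta>_Irr])
  have I: "conj_char M g \<eta> \<in> Irr GM" by (rule M.conj_char_Irr[OF g \<eta>_Irr])
  have rest: "\<eta> y = \<theta> y" if y: "y \<in> N" for y
    using MN.invariant_restriction[of \<theta> \<eta> y] \<theta> \<theta>_inv_M \<eta> y extension_multiplicity by simp
  have "char_prod GN (conj_char M g \<eta>) \<theta> = char_prod GN \<eta> \<theta>"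
  proof (rule finite_group.char_prod_cong[OF N.finite_group_N])
    fix y assume "y \<in> carrier GN"
    then have y: "y \<in> N" by simp
    then have "conj_char M g \<eta> y = \<theta> (g \<otimes> y \<otimes> inv g)"
      using NM rest[OF N.conj_closed[OF g y]] by (auto simp: conj_char_def)
    also have "\<dots> = \<eta> y" using \<theta>_inv g y rest[OF y] by (simp add: invariant_character_def)
    finally show "conj_char M g \<eta> y = \<eta> y" .
  qed simp
  then have "char_multiplicity GN (conj_char M g \<eta>) \<theta> = 1"
    using extension_multiplicity by (simp add: char_multiplicity_def)
  then have "conj_char M g \<eta> \<in> Irr_above GM N \<theta>"
    using I MN.Irr_above_eq[OF MN.subgroup_N, of \<theta>] \<theta> by simp
  then show ?thesis unfolding extensions_eq by auto
qed

lemma conj_tw: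
  assumes g: "g \<in> carrier G" "acts_by g k" and s: "conj_char M g \<eta> = tw s"
  shows "conj_char M g (tw i) = tw (s + k * i)"
proof
  fix m
  show "conj_char M g (tw i) m = tw (s + k * i) m"
  proof (cases "m \<in> M")
    case True
    have "\<eta> (g \<otimes> m \<otimes> inv g) = \<mu> m ^ s * \<eta> m"
      using fun_cong[OF s, of m] True by (simp add: conj_char_def tw_apply)
    then show ?thesis
      using M.conj_closed[OF g(1) True] g(2) True
      by (simp add: conj_char_def tw_apply acts_by_def power_add power_mult)
  next
    case False
    then show ?thesis by (simp add: conj_char_def tw_def twist_def)
  qed
qed

section \<open>The two orbit types on the extensions\<close>

lemma above_\<eta>_above_\<theta>: "Irr_above G M (tw i) \<subseteq> Irr_above G N \<theta>"
proof
  fix \<chi> assume "\<chi> \<in> Irr_above G M (tw i)"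
  then have \<chi>: "\<chi> \<in> Irr G" "char_multiplicity GM \<chi> (tw i) > 0"
    unfolding Irr_above_eq[OF M.subgroup_N tw_Irr] by auto
  then have "char_multiplicity GN \<chi> \<theta> > 0"
    using multiplicity_trans_pos[OF N.subgroup_N M.subgroup_N NM _ \<theta>, of \<chi>] tw_Irr tw_multiplicity
      Irr_subset_characters[of G] by blast
  then show "\<chi> \<in> Irr_above G N \<theta>" using \<chi>(1) unfolding Irr_above_eq[OF N.subgroup_N \<theta>] by simp
qed

text \<open>
  An element of \<open>C\<close> that moves \<open>\<eta>\<close> acts as a nontrivial translation on the exponents \<open>i\<close> of the
  extensions \<open>\<mu>\<^sup>i \<eta>\<close>, so that \<open>G\<close> permutes them transitively.
\<close>

lemma transitive_above:
  assumes c: "c \<in> C" and moved: "conj_char M c \<eta> \<noteq> \<eta>"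
  shows "Irr_above G N \<theta> = Irr_above G M \<eta>"
proof
  have cG: "c \<in> carrier G" and c1: "acts_by c 1" using c by (auto simp: C_def)
  obtain s where s: "s < p" "conj_char M c \<eta> = tw s" using conj_\<eta>[OF cG] by blast
  have "s \<noteq> 0" using s(2) moved by (auto simp: tw_0)
  then have "coprime s p" using coprime_less_prime[OF p _ s(1)] by simp
  then obtain v where v: "[s * v = 1] (mod p)" by (metis cong_solve_coprime_nat One_nat_def)
  have pow: "conj_char M (c [^] (i::nat)) \<eta> = tw (i * s)" for i
  proof (induction i)
    case 0
    then show ?case using M.conj_char_one[OF \<eta>_Irr] by (simp add: tw_0)
  next
    case (Suc i)
    have "conj_char M (c [^] Suc i) \<eta> = conj_char M c (conj_char M (c [^] i) \<eta>)"
      using M.conj_char_mult[of "c [^] i" c \<eta>] cG by simp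
    also have "\<dots> = tw (s + 1 * (i * s))" unfolding Suc by (rule conj_tw[OF cG c1 s(2)])
    finally show ?case by simp
  qed
  have all: "tw i = conj_char M (c [^] (v * i)) \<eta>" for i
  proof -
    have "[s * v * i = 1 * i] (mod p)" by (rule cong_scalar_right[OF v])
    then have "tw i = tw (v * i * s)" unfolding tw_eq_iff by (simp add: cong_sym_eq mult_ac)
    then show ?thesis using pow by simp
  qed
  show "Irr_above G M \<eta> \<subseteq> Irr_above G N \<theta>" using above_\<eta>_above_\<theta>[of 0] by (simp add: tw_0)
  show "Irr_above G N \<theta> \<subseteq> Irr_above G M \<eta>"
  proof
    interpret MN: finite_group_normal GM N by (rule N_in_M)
    fix \<chi> assume "\<chi> \<in> Irr_above G N \<theta>"
    then have \<chi>: "\<chi> \<in> Irr G" "char_multiplicity GN \<chi> \<theta> > 0" unfolding Irr_above_eq[OF N.subgroup_N \<theta>] by auto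
    have \<chi>c: "\<chi> \<in> characters G" by (rule Irr_character[OF \<chi>(1)])
    obtain \<psi> where \<psi>: "\<psi> \<in> Irr GM" "char_multiplicity GM \<chi> \<psi> > 0" "char_multiplicity GN \<psi> \<theta> > 0"
      using multiplicity_trans_pos[OF N.subgroup_N M.subgroup_N NM \<chi>c \<theta>] \<chi>(2) by blast
    then have "\<psi> \<in> Irr_above GM N \<theta>" using MN.Irr_above_eq[OF MN.subgroup_N, of \<theta>] \<theta> by simp
    then obtain i where "\<psi> = tw i" unfolding extensions_eq by blast
    then have "char_multiplicity GM \<chi> \<eta> > 0"
      using \<psi>(2) M.multiplicity_conj_char[OF _ \<chi>c, of "c [^] (v * i)" \<eta>] all[of i] cG by simp
    then show "\<chi> \<in> Irr_above G M \<eta>" using \<chi>(1) unfolding Irr_above_eq[OF M.subgroup_N \<eta>_Irr] by simp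
  qed
qed

text \<open>
  Otherwise only the cyclic group \<open>G/C\<close> acts. A generator sends the exponent \<open>i\<close> to \<open>s + k i\<close>;
  if \<open>k\<close> is not \<open>1\<close> modulo \<open>p\<close>, the equation \<open>i = s + k i\<close> is solvable modulo \<open>p\<close>.
\<close>

lemma exists_invariant_extension:
  assumes fixed: "\<And>c. c \<in> C \<Longrightarrow> conj_char M c \<eta> = \<eta>"
  shows "\<exists>i. invariant_character G M (tw i)"
proof -
  obtain t where t: "t \<in> carrier G" and gen_t: "\<And>g. g \<in> carrier G \<Longrightarrow> \<exists>(i::nat) y. y \<in> C \<and> g = t [^] i \<otimes> y"
    using quotient_by_C_cyclic by blast
  obtain k where k: "acts_by t k" using acts_by_exists[OF t] by blast
  obtain s where s: "s < p" "conj_char M t \<eta> = tw s" using conj_\<eta>[OF t] by blast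
  have "\<exists>i. [s + k * i = i] (mod p)"
  proof (cases "[k = 1] (mod p)")
    case True
    then have "t \<in> C" using t acts_by_cong[OF k] by (simp add: C_def)
    then have "tw s = tw 0" using fixed s(2) by (simp add: tw_0)
    then have "[s = 0] (mod p)" unfolding tw_eq_iff .
    then show ?thesis by (intro exI[of _ 0]) simp
  next
    case False
    have "\<not> int p dvd int k - 1"
      using False by (metis cong_iff_dvd_diff cong_int_iff of_nat_1)
    then have "coprime (int k - 1) (int p)"
      using p by (meson coprime_commute prime_imp_coprime prime_nat_int_transfer)
    then obtain v where v: "[(int k - 1) * v = 1] (mod int p)" using cong_solve_coprime_int by blast
    define i where "i = nat ((- int s * v) mod int p)"
    have ii: "[int i = - int s * v] (mod int p)"
      using p_gt_1 by (simp add: i_def cong_def)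
    have "[(int k - 1) * int i = (int k - 1) * (- int s * v)] (mod int p)" by (rule cong_scalar_left[OF ii])
    also have "(int k - 1) * (- int s * v) = (int k - 1) * v * (- int s)" by (simp add: algebra_simps)
    also have "[\<dots> = 1 * (- int s)] (mod int p)" by (rule cong_scalar_right[OF v])
    finally have "int p dvd (int k - 1) * int i - (- int s)" by (simp add: cong_iff_dvd_diff)
    also have "(int k - 1) * int i - (- int s) = int (s + k * i) - int i" by (simp add: algebra_simps)
    finally have "[int (s + k * i) = int i] (mod int p)" by (simp only: cong_iff_dvd_diff)
    then show ?thesis unfolding cong_int_iff by blast
  qed
  then obtain i where i: "[s + k * i = i] (mod p)" by blast
  have ti: "conj_char M t (tw i) = tw i"
    unfolding conj_tw[OF t k s(2)] tw_eq_iff using i .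
  have Ci: "conj_char M c (tw i) = tw i" if c: "c \<in> C" for c
  proof -
    have cG: "c \<in> carrier G" and c1: "acts_by c 1" using c by (auto simp: C_def)
    have "conj_char M c \<eta> = tw 0" using fixed[OF c] by (simp add: tw_0)
    from conj_tw[OF cG c1 this, of i] show ?thesis by simp
  qed
  have tpow: "conj_char M (t [^] (j::nat)) (tw i) = tw i" for j
  proof (induction j)
    case 0
    then show ?case using M.conj_char_one[OF tw_Irr] by simp
  next
    case (Suc j)
    then show ?case using M.conj_char_mult[of "t [^] j" t "tw i"] t ti by simp
  qed
  have "g \<in> stabilizer M (tw i)" if g: "g \<in> carrier G" for g
  proof -
    obtain j :: nat and y where y: "y \<in> C" "g = t [^] j \<otimes> y" using gen_t[OF g] by blast
    have "y \<in> carrier G" using y(1) by (simp add: C_def)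
    then have "conj_char M g (tw i) = conj_char M y (conj_char M (t [^] j) (tw i))"
      unfolding y(2) using t by (intro M.conj_char_mult[symmetric]) auto
    also have "\<dots> = tw i" unfolding tpow by (rule Ci[OF y(1)])
    finally show ?thesis using g M.stabilizer_iff[OF tw_Irr] by simp
  qed
  then have "invariant_character G M (tw i)"
    unfolding invariant_character_def by (auto simp: stabilizer_def)
  then show ?thesis by blast
qed

section \<open>An invariant extension is impossible\<close>

lemma subgroup_C: "subgroup C G"
  using C_normal by (rule normal_imp_subgroup)

lemma C_M: "finite_group_normal (G\<lparr>carrier := C\<rparr>) M"
  by (rule M.normal_in_intermediate[OF subgroup_C M_subset_C])

lemma invariant_in_subgroup:
  assumes "subgroup H G" and "M \<subseteq> H" and "H \<subseteq> stabilizer M \<phi>"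
  shows "invariant_character (G\<lparr>carrier := H\<rparr>) M \<phi>"
  using assms m_inv_consistent[OF assms(1)] by (auto simp: invariant_character_def stabilizer_def)

text \<open>
  An element that acts with exponent \<open>k\<close> and fixes \<open>\<eta>\<close> sends \<open>\<mu>\<eta>\<close> to \<open>\<mu>\<^sup>k \<eta>\<close>.
\<close>

lemma stabilizer_tw1:
  assumes inv: "invariant_character G M \<eta>"
  shows "stabilizer M (tw 1) = C"
proof -
  have "g \<in> stabilizer M (tw 1) \<longleftrightarrow> g \<in> C" if g: "g \<in> carrier G" for g
  proof -
    obtain k where k: "acts_by g k" using acts_by_exists[OF g] by blast
    have "conj_char M g \<eta> = tw 0"
      using M.invariant_orbit[OF \<eta>_Irr inv] g by (auto simp: char_orbit_def tw_0)
    from conj_tw[OF g k this, of 1] have "conj_char M g (tw 1) = tw k" by simp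
    then have "g \<in> stabilizer M (tw 1) \<longleftrightarrow> [k = 1] (mod p)"
      using g M.stabilizer_iff[OF tw_Irr, of g 1] tw_eq_iff by simp
    also have "\<dots> \<longleftrightarrow> acts_by g 1" using k acts_by_unique acts_by_cong by blast
    finally show ?thesis using g by (simp add: C_def)
  qed
  then show ?thesis by (auto simp: stabilizer_def C_def)
qed

lemma invariant_in_C:
  assumes inv: "invariant_character G M \<eta>"
  shows "invariant_character (G\<lparr>carrier := C\<rparr>) M \<eta>" and "invariant_character (G\<lparr>carrier := C\<rparr>) M (tw 1)"
proof -
  have "C \<subseteq> stabilizer M \<eta>"
    using inv subgroup.subset[OF subgroup_C] by (auto simp: stabilizer_def invariant_character_def)
  then show "invariant_character (G\<lparr>carrier := C\<rparr>) M \<eta>"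
    by (rule invariant_in_subgroup[OF subgroup_C M_subset_C])
  show "invariant_character (G\<lparr>carrier := C\<rparr>) M (tw 1)"
    by (rule invariant_in_subgroup[OF subgroup_C M_subset_C]) (simp only: stabilizer_tw1[OF inv] order_refl)
qed

text \<open>
  Put \<open>\<nu>(m y) = \<mu>(m)\<close> for \<open>m \<in> M\<close> and \<open>y \<in> P\<close>. This is well defined because \<open>P \<inter> M\<close> lies in the kernel
  \<open>N\<close> of \<open>\<mu>\<close>, and multiplicative because \<open>P\<close> centralizes \<open>M/N\<close>.
\<close>

lemma extend_linear_char:
  assumes P: "subgroup P G" "P \<subseteq> C" "P \<inter> M \<subseteq> N"
  shows "\<exists>\<nu>. linear_char (G\<lparr>carrier := M <#> P\<rparr>) \<nu> \<and> (\<forall>m\<in>M. \<nu> m = \<mu> m)"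
proof -
  have PG: "y \<in> carrier G" if "y \<in> P" for y using that subgroup.subset[OF P(1)] by auto
  define \<nu> where "\<nu> g = (SOME v. \<exists>m\<in>M. \<exists>y\<in>P. g = m \<otimes> y \<and> v = \<mu> m)" for g
  have val: "\<nu> (m \<otimes> y) = \<mu> m" if m: "m \<in> M" and y: "y \<in> P" for m y
  proof -
    have "\<exists>m'\<in>M. \<exists>y'\<in>P. m \<otimes> y = m' \<otimes> y' \<and> \<nu> (m \<otimes> y) = \<mu> m'"
      unfolding \<nu>_def by (rule someI[of _ "\<mu> m"]) (use m y in blast)
    then obtain m' y' where my: "m' \<in> M" "y' \<in> P" "m \<otimes> y = m' \<otimes> y'" "\<nu> (m \<otimes> y) = \<mu> m'" by blast
    note c = M_elem[OF m] M_elem[OF my(1)] PG[OF y] PG[OF my(2)]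
    have "y \<otimes> inv y' = inv m \<otimes> (m \<otimes> y) \<otimes> inv y'" using c by (simp add: cancel_inv)
    also have "\<dots> = inv m \<otimes> m'" unfolding my(3) using c by (simp add: m_assoc)
    finally have e: "inv m \<otimes> m' = y \<otimes> inv y'" ..
    have "inv m \<otimes> m' \<in> M" using m my(1) by (simp add: M_mult M_inv)
    moreover have "inv m \<otimes> m' \<in> P" unfolding e using y my(2) P(1) by (simp add: subgroup.m_closed subgroup.m_inv_closed)
    ultimately have "inv m \<otimes> m' \<in> N" using P(3) by blast
    then have "\<mu> (inv m \<otimes> m') = 1" using \<mu>_ker[of "inv m \<otimes> m'"] NM by auto
    moreover have "\<mu> m' = \<mu> m * \<mu> (inv m \<otimes> m')"
      using \<mu>_mult[of m "inv m \<otimes> m'"] m my(1) c by (simp add: M_mult M_inv cancel_inv)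
    ultimately show ?thesis using my(4) by simp
  qed
  have one: "\<one> \<in> M" "\<one> \<in> P" using subgroup.one_closed M.subgroup_N P(1) by auto
  have "linear_char (G\<lparr>carrier := M <#> P\<rparr>) \<nu>"
    unfolding linear_char_def
  proof (intro conjI ballI)
    have "\<nu> (\<one> \<otimes> \<one>) = 1" using val[OF one] \<mu>_one by simp
    then show "\<nu> \<one>\<^bsub>G\<lparr>carrier := M <#> P\<rparr>\<^esub> = 1" by simp
    fix g h assume "g \<in> carrier (G\<lparr>carrier := M <#> P\<rparr>)" "h \<in> carrier (G\<lparr>carrier := M <#> P\<rparr>)"
    then obtain m y m' y' where g: "m \<in> M" "y \<in> P" "g = m \<otimes> y" and h: "m' \<in> M" "y' \<in> P" "h = m' \<otimes> y'"
      by (auto simp: set_mult_def)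
    note c = M_elem[OF g(1)] M_elem[OF h(1)] PG[OF g(2)] PG[OF h(2)]
    have k: "y \<otimes> m' \<otimes> inv y \<in> M" using M.conj_closed[OF PG[OF g(2)] h(1)] .
    have "g \<otimes> h = (m \<otimes> (y \<otimes> m' \<otimes> inv y)) \<otimes> (y \<otimes> y')"
      unfolding g h using c by (simp add: m_assoc cancel_inv)
    moreover have "y \<otimes> y' \<in> P" using g h P(1) by (simp add: subgroup.m_closed)
    ultimately have "\<nu> (g \<otimes> h) = \<mu> m * \<mu> (y \<otimes> m' \<otimes> inv y)"
      using val[OF M_mult[OF g(1) k]] \<mu>_mult[OF g(1) k] by simp
    also have "\<mu> (y \<otimes> m' \<otimes> inv y) = \<mu> m'" using g(2) P(2) h(1) by (auto simp: C_def acts_by_def)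
    finally show "\<nu> (g \<otimes>\<^bsub>G\<lparr>carrier := M <#> P\<rparr>\<^esub> h) = \<nu> g * \<nu> h" using val g h by simp
  qed
  moreover have "\<nu> m = \<mu> m" if "m \<in> M" for m using val[OF that one(2)] M_elem[OF that] by simp
  ultimately show ?thesis by blast
qed

text \<open>
  Twisting \<open>\<beta>\<close>, restricted to \<open>M P\<close>, by an extension of \<open>\<mu>\<close> moves it from \<open>\<eta>\<close> to \<open>\<mu>\<eta>\<close>. If \<open>\<psi>\<close>
  is the only character of \<open>C\<close> above \<open>\<mu>\<eta>\<close>, then the character induced to \<open>C\<close> is a multiple of \<open>\<psi>\<close>,
  and its degree is \<open>|C : M P| \<beta>(1)\<close>.
\<close>

lemma twisted_induction_degree:
  assumes inv: "invariant_character G M \<eta>"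
    and P: "subgroup P G" "P \<subseteq> C" "P \<inter> M \<subseteq> N"
    and \<beta>: "\<beta> \<in> Irr_above (G\<lparr>carrier := C\<rparr>) M \<eta>" and uniq: "Irr_above (G\<lparr>carrier := C\<rparr>) M (tw 1) = {\<psi>}"
  shows "char_multiplicity GM \<psi> (tw 1) * card (M <#> P) dvd card C * char_multiplicity GM \<beta> \<eta>"
proof -
  let ?GC = "G\<lparr>carrier := C\<rparr>" and ?S = "M <#> P" and ?GS = "G\<lparr>carrier := M <#> P\<rparr>"
  interpret C: finite_group_normal ?GC M by (rule C_M)
  have S: "subgroup ?S G" by (rule mult_norm_subgroup[OF M_normal P(1)])
  have MS: "M \<subseteq> ?S"
  proof
    fix m assume m: "m \<in> M"
    then have "m = m \<otimes> \<one>" using M_elem by simp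
    then show "m \<in> ?S" unfolding set_mult_def using m subgroup.one_closed[OF P(1)] by blast
  qed
  have SC: "?S \<subseteq> C"
    unfolding set_mult_def using M_subset_C P(2) subgroup.m_closed[OF subgroup_C] by blast
  have SsubC: "subgroup ?S ?GC" by (rule subgroup_incl[OF S subgroup_C SC])
  interpret S: finite_group_normal ?GS M by (rule M.normal_in_intermediate[OF S MS])
  note inv\<eta> = invariant_in_C(1)[OF inv] and inv1 = invariant_in_C(2)[OF inv]
  have [simp]: "?GC\<lparr>carrier := M\<rparr> = GM" "?GC\<lparr>carrier := ?S\<rparr> = ?GS" "?GS\<lparr>carrier := M\<rparr> = GM" by simp_all
  have \<eta>I: "\<eta> \<in> Irr (?GC\<lparr>carrier := M\<rparr>)" using \<eta>_Irr by simp
  have tI: "tw 1 \<in> Irr (?GC\<lparr>carrier := M\<rparr>)" using tw_Irr by simp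
  define b where "b = char_multiplicity GM \<beta> \<eta>"
  define f where "f = char_multiplicity GM \<psi> (tw 1)"
  define u where "u = degree_nat G \<eta>"
  have u0: "u > 0" unfolding u_def by (rule degree_Irr_subgroup_pos[OF M.subgroup_N \<eta>_Irr])
  have \<psi>: "\<psi> \<in> Irr_above ?GC M (tw 1)" using uniq by simp
  have d\<psi>: "degree_nat G \<psi> = f * u"
    using C.invariant_degree[OF tI inv1 \<psi>] by (simp add: f_def u_def tw_degree)
  have d\<beta>: "degree_nat G \<beta> = b * u" using C.invariant_degree[OF \<eta>I inv\<eta> \<beta>] by (simp add: b_def u_def)
  have \<beta>M: "\<beta> m = of_nat b * \<eta> m" if "m \<in> M" for m
    using C.invariant_restriction[OF \<eta>I inv\<eta> \<beta> that] by (simp add: b_def)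
  have \<beta>c: "\<beta> \<in> characters ?GC" using \<beta> Irr_subset_characters[of ?GC] by (auto simp: Irr_above_def)
  obtain \<nu> where \<nu>: "linear_char ?GS \<nu>" "\<And>m. m \<in> M \<Longrightarrow> \<nu> m = \<mu> m" using extend_linear_char[OF P] by blast
  define \<zeta> where "\<zeta> = twist ?GS \<nu> (restrict \<beta> ?S)"
  have "restrict \<beta> ?S \<in> characters ?GS" using C.restrict_character[OF SsubC \<beta>c] by simp
  then have \<zeta>c: "\<zeta> \<in> characters ?GS" unfolding \<zeta>_def by (rule S.twist_characters[OF \<nu>(1)])
  have \<zeta>M: "\<zeta> m = of_nat b * tw 1 m" if m: "m \<in> M" for m
    using m MS \<nu>(2)[OF m] \<beta>M[OF m] by (auto simp: \<zeta>_def twist_def tw_apply)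
  have \<zeta>_mult: "\<phi> = tw 1" if \<phi>: "\<phi> \<in> Irr GM" "char_multiplicity GM \<zeta> \<phi> > 0" for \<phi>
  proof (rule ccontr)
    assume ne: "\<phi> \<noteq> tw 1"
    interpret GM: finite_group GM by (rule M.finite_group_N)
    have "char_prod GM \<zeta> \<phi> = of_nat b * char_prod GM (tw 1) \<phi>"
      unfolding char_prod_subgroup[OF M.subgroup_N] by (simp add: \<zeta>M sum_distrib_left mult.assoc)
    also have "\<dots> = 0" using GM.Irr_orthonormal[OF tw_Irr[of 1] \<phi>(1)] ne by auto
    finally show False using \<phi>(2) by (simp add: char_multiplicity_def)
  qed
  \<comment> \<open>A constituent \<open>\<sigma>\<close> of \<open>\<zeta>\<close> lies above \<open>\<mu>\<eta>\<close> as well, so \<open>\<sigma>\<^sup>C\<close> is a multiple of \<open>\<psi>\<close> and its degree is a multiple of \<open>f u\<close>.\<close>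
  have dvd_\<sigma>: "f * u * card ?S dvd card C * degree_nat G \<sigma>"
    if \<sigma>: "\<sigma> \<in> Irr ?GS" "char_multiplicity ?GS \<zeta> \<sigma> > 0" for \<sigma>
  proof -
    have \<sigma>c: "\<sigma> \<in> characters ?GS" using \<sigma>(1) Irr_subset_characters[of ?GS] by blast
    have "degree_nat G \<sigma> > 0" using degree_Irr_subgroup_pos[OF S \<sigma>(1)] .
    then have "(\<Sum>\<phi>\<in>Irr GM. char_multiplicity GM \<sigma> \<phi> * degree_nat G \<phi>) > 0"
      using S.restriction_degree[OF S.subgroup_N \<sigma>c] by simp
    then obtain \<phi> where \<phi>: "\<phi> \<in> Irr GM" "char_multiplicity GM \<sigma> \<phi> > 0"
      using sum_mult_pos_iff[OF finite_Irr_subgroup[OF M.subgroup_N]] by blast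
    have self: "subgroup ?S ?GS" using S.subgroup_self by simp
    have "char_multiplicity GM \<zeta> \<phi> > 0"
      using S.multiplicity_trans_pos[OF S.subgroup_N self MS \<zeta>c, of \<phi>] \<phi> \<sigma> by auto
    then have \<phi>1: "\<phi> = tw 1" by (rule \<zeta>_mult[OF \<phi>(1)])
    have only: "\<chi> = \<psi>" if \<chi>: "\<chi> \<in> Irr ?GC" "char_multiplicity ?GS \<chi> \<sigma> > 0" for \<chi>
    proof -
      have "\<chi> \<in> characters ?GC" using \<chi>(1) Irr_subset_characters[of ?GC] by blast
      then have "char_multiplicity GM \<chi> (tw 1) > 0"
        using C.multiplicity_trans_pos[OF C.subgroup_N SsubC MS _ tI, of \<chi>] \<chi>(2) \<sigma>(1) \<phi>(2) \<phi>1 by auto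
      then have "\<chi> \<in> Irr_above ?GC M (tw 1)" using \<chi>(1) C.Irr_above_eq[OF C.subgroup_N tI] by simp
      then show ?thesis using uniq by simp
    qed
    have "\<psi> \<in> Irr ?GC" using \<psi> by (simp add: Irr_above_def)
    then have "(\<Sum>\<chi>\<in>Irr ?GC. char_multiplicity ?GS \<chi> \<sigma> * degree_nat G \<chi>) =
      (\<Sum>\<chi>\<in>{\<psi>}. char_multiplicity ?GS \<chi> \<sigma> * degree_nat G \<chi>)"
      by (intro sum.mono_neutral_right C.finite_Irr) (use only in auto)
    then have "card ?S * (char_multiplicity ?GS \<psi> \<sigma> * (f * u)) = card C * degree_nat G \<sigma>"
      using C.induction_degree[OF SsubC, of \<sigma>] \<sigma>(1) d\<psi> by simp
    then have "card C * degree_nat G \<sigma> = (f * u * card ?S) * char_multiplicity ?GS \<psi> \<sigma>" by (simp add: mult_ac)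
    then show ?thesis by (rule dvdI)
  qed
  have "degree_nat G \<zeta> = degree_nat G \<beta>"
    using \<zeta>M[OF subgroup.one_closed[OF M.subgroup_N]] \<beta>M[OF subgroup.one_closed[OF M.subgroup_N]]
    by (simp add: degree_nat_def tw_apply[OF subgroup.one_closed[OF M.subgroup_N]] \<mu>_one)
  then have "card C * (b * u) = (\<Sum>\<sigma>\<in>Irr ?GS. char_multiplicity ?GS \<zeta> \<sigma> * (card C * degree_nat G \<sigma>))"
    using S.degree_decomposition[OF \<zeta>c] d\<beta> by (simp add: sum_distrib_left mult.left_commute)
  also have "f * u * card ?S dvd \<dots>"
  proof (rule dvd_sum)
    fix \<sigma> assume \<sigma>: "\<sigma> \<in> Irr ?GS"
    show "f * u * card ?S dvd char_multiplicity ?GS \<zeta> \<sigma> * (card C * degree_nat G \<sigma>)"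
    proof (cases "char_multiplicity ?GS \<zeta> \<sigma> = 0")
      case False
      then have pos: "char_multiplicity ?GS \<zeta> \<sigma> > 0" by simp
      show ?thesis by (rule dvd_mult[OF dvd_\<sigma>[OF \<sigma> pos]])
    qed simp
  qed
  finally have "u * (f * card ?S) dvd u * (card C * b)" by (simp only: mult_ac)
  then show ?thesis using u0 by (simp add: f_def b_def)
qed

text \<open>
  With \<open>d = |G : C|\<close>, \<open>u = \<eta>(1)\<close> and \<open>m = [\<chi>\<^sub>0, \<beta>]\<close>, Clifford's theorem and the degree of \<open>\<beta>\<^sup>G = m \<chi>\<^sub>0\<close> give
  \<open>e = m k b\<close> and \<open>m e = d b\<close>; together with \<open>e\<^sup>2 = d f\<^sup>2\<close> this yields \<open>f\<^sup>2 = k b\<^sup>2\<close>. The Sylow argument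
  shows \<open>k = 1\<close>, the cyclic quotient \<open>G/C\<close> shows \<open>m = 1\<close>, and what remains is \<open>d = 1\<close>.
\<close>

theorem no_invariant_extension:
  assumes inj: "inj_on (degree_nat G) (Irr_above G N \<theta>)"
    and inv: "invariant_character G M \<eta>"
    and uniq0: "Irr_above G M \<eta> = {\<chi>\<^sub>0}" and uniq1: "Irr_above (G\<lparr>carrier := C\<rparr>) M (tw 1) = {\<psi>}"
  shows False
proof -
  let ?GC = "G\<lparr>carrier := C\<rparr>"
  interpret MC: finite_group_normal ?GC M by (rule C_M)
  interpret C: finite_group_normal G C by (rule finite_group_normalI[OF C_normal])
  have [simp]: "?GC\<lparr>carrier := M\<rparr> = GM" by simp
  have \<eta>I: "\<eta> \<in> Irr (?GC\<lparr>carrier := M\<rparr>)" using \<eta>_Irr by simp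
  have tI: "tw 1 \<in> Irr (?GC\<lparr>carrier := M\<rparr>)" using tw_Irr by simp
  note inv\<eta> = invariant_in_C(1)[OF inv] and inv1 = invariant_in_C(2)[OF inv]
  have \<chi>\<^sub>0: "\<chi>\<^sub>0 \<in> Irr_above G M \<eta>" and \<psi>: "\<psi> \<in> Irr_above ?GC M (tw 1)" using uniq0 uniq1 by auto
  obtain t where t: "t \<in> carrier G" and gen_t: "\<And>g. g \<in> carrier G \<Longrightarrow> \<exists>(i::nat) y. y \<in> C \<and> g = t [^] i \<otimes> y"
    using quotient_by_C_cyclic by blast
  obtain d where d: "card (carrier G) = d * card C" "d dvd p - 1" using index_C_dvd[OF t gen_t] by blast
  have d0: "d > 0" using d(1) card_pos by (cases d) auto
  have C0: "card C > 0" by (rule card_subgroup_pos[OF subgroup_C])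
  have M0: "card M > 0" by (rule card_subgroup_pos[OF M.subgroup_N])
  define e where "e = char_multiplicity GM \<chi>\<^sub>0 \<eta>"
  define f where "f = char_multiplicity GM \<psi> (tw 1)"
  define u where "u = degree_nat G \<eta>"
  have u0: "u > 0" unfolding u_def by (rule degree_Irr_subgroup_pos[OF M.subgroup_N \<eta>_Irr])
  have d\<chi>\<^sub>0: "degree_nat G \<chi>\<^sub>0 = e * u" unfolding e_def u_def by (rule M.invariant_degree[OF \<eta>_Irr inv \<chi>\<^sub>0])
  have d\<psi>: "degree_nat G \<psi> = f * u"
    using MC.invariant_degree[OF tI inv1 \<psi>] by (simp add: f_def u_def tw_degree)
  have e2: "card M * e\<^sup>2 = d * card C"
    using M.sum_squares_above[OF \<eta>_Irr inv] unfolding uniq0 d(1)[symmetric] by (simp add: e_def)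
  have f2: "card M * f\<^sup>2 = card C"
    using MC.sum_squares_above[OF tI inv1] unfolding uniq1 by (simp add: f_def)
  have ef: "e\<^sup>2 = d * f\<^sup>2"
    using e2 M0 unfolding f2[symmetric] by (simp add: mult.left_commute)
  obtain \<chi>\<^sub>1 where \<chi>\<^sub>1: "Irr_above G M (tw 1) = {\<chi>\<^sub>1}"
    "degree_nat G \<chi>\<^sub>1 * card C = card (carrier G) * degree_nat G \<psi>"
    using M.Clifford_unique[OF tw_Irr stabilizer_tw1[OF inv, symmetric] uniq1] by blast
  obtain \<beta> where \<beta>: "\<beta> \<in> Irr_above ?GC M \<eta>"
    using MC.Irr_above_nonempty[OF MC.subgroup_N \<eta>I] by blast
  have \<beta>I: "\<beta> \<in> Irr ?GC" "char_multiplicity GM \<beta> \<eta> > 0"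
    using \<beta> MC.Irr_above_eq[OF MC.subgroup_N \<eta>I] by auto
  define b where "b = char_multiplicity GM \<beta> \<eta>"
  have d\<beta>: "degree_nat G \<beta> = b * u" using MC.invariant_degree[OF \<eta>I inv\<eta> \<beta>] by (simp add: b_def u_def)
  have b0: "b > 0" using \<beta>I(2) by (simp add: b_def)
  have above\<beta>: "\<chi> = \<chi>\<^sub>0" if \<chi>: "\<chi> \<in> Irr G" "char_multiplicity ?GC \<chi> \<beta> > 0" for \<chi>
  proof -
    have "char_multiplicity GM \<chi> \<eta> > 0"
      using multiplicity_trans_pos[OF M.subgroup_N subgroup_C M_subset_C _ \<eta>_Irr, of \<chi>] \<chi> \<beta>I
        Irr_subset_characters[of G] by blast
    then have "\<chi> \<in> Irr_above G M \<eta>" using \<chi>(1) unfolding Irr_above_eq[OF M.subgroup_N \<eta>_Irr] by simp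
    then show ?thesis using uniq0 by simp
  qed
  have \<chi>\<^sub>0I: "\<chi>\<^sub>0 \<in> Irr G" using \<chi>\<^sub>0 by (simp add: Irr_above_def)
  have "Irr_above G C \<beta> \<noteq> {}" by (rule Irr_above_nonempty[OF subgroup_C \<beta>I(1)])
  then have \<chi>\<^sub>0\<beta>: "\<chi>\<^sub>0 \<in> Irr_above G C \<beta>"
    using above\<beta> unfolding Irr_above_eq[OF subgroup_C \<beta>I(1)] by blast
  then have m0: "char_multiplicity ?GC \<chi>\<^sub>0 \<beta> > 0" unfolding Irr_above_eq[OF subgroup_C \<beta>I(1)] by simp
  define m where "m = char_multiplicity ?GC \<chi>\<^sub>0 \<beta>"
  define k where "k = card (char_orbit C \<beta>)"
  have "e * u = m * k * (b * u)"
    using C.Clifford_degree[OF \<beta>I(1) \<chi>\<^sub>0I m0] by (simp add: d\<chi>\<^sub>0 d\<beta> m_def k_def)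
  then have emkb: "e = m * k * b" using u0 by simp
  have "(\<Sum>\<chi>\<in>Irr G. char_multiplicity ?GC \<chi> \<beta> * degree_nat G \<chi>) = (\<Sum>\<chi>\<in>{\<chi>\<^sub>0}. char_multiplicity ?GC \<chi> \<beta> * degree_nat G \<chi>)"
    by (rule sum.mono_neutral_right[OF finite_Irr]) (use \<chi>\<^sub>0I above\<beta> in auto)
  then have "card C * (m * (e * u)) = d * card C * (b * u)"
    using induction_degree[OF subgroup_C \<beta>I(1)] by (simp add: d\<chi>\<^sub>0 d\<beta> m_def d(1))
  then have "(card C * u) * (m * e) = (card C * u) * (d * b)" by (simp only: mult_ac)
  then have me: "m * e = d * b" using C0 u0 by simp
  have "d * f\<^sup>2 = e * (m * k * b)" using ef emkb by (simp add: power2_eq_square)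
  also have "\<dots> = (m * e) * (k * b)" by (simp only: mult_ac)
  also have "\<dots> = d * (k * b\<^sup>2)" unfolding me by (simp add: power2_eq_square mult_ac)
  finally have fkb: "f\<^sup>2 = k * b\<^sup>2" using d0 by simp
  have kd: "k dvd d"
  proof -
    let ?St = "stabilizer C \<beta>"
    have St: "subgroup ?St G" by (rule C.stabilizer_subgroup[OF \<beta>I(1)])
    interpret St: finite_group "G\<lparr>carrier := ?St\<rparr>" by (rule subgroup_finite_group[OF St])
    have "subgroup C (G\<lparr>carrier := ?St\<rparr>)"
      by (rule subgroup_incl[OF subgroup_C St C.N_subset_stabilizer[OF \<beta>I(1)]])
    from St.card_subgroup_dvd[OF this] obtain c where c: "card ?St = card C * c" by auto
    have "k * card ?St = d * card C" unfolding k_def d(1)[symmetric] by (rule C.card_orbit_stabilizer[OF \<beta>I(1)])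
    then have "card C * (k * c) = card C * d" unfolding c by (simp only: mult_ac)
    then have "d = k * c" using C0 by simp
    then show ?thesis by simp
  qed
  have k1: "k = 1"
  proof (rule ccontr)
    assume "k \<noteq> 1"
    \<comment> \<open>Any such \<open>q\<close> divides \<open>p - 1\<close>, so \<open>\<mu>\<close>, of order \<open>p\<close>, is trivial on the intersection of \<open>M\<close> with a \<open>q\<close>-group.\<close>
    then obtain q where q: "prime q" "q dvd k" using prime_factor_nat by blast
    have "q dvd p - 1" using q(2) kd d(2) dvd_trans by blast
    then have "q \<noteq> p" using p_gt_1 by (auto dest: dvd_imp_le)
    then have qp: "coprime q p" using q(1) p by (simp add: primes_coprime)
    have "\<not> is_unit q" using prime_gt_1_nat[OF q(1)] by simp
    then obtain a r where r: "card C = q ^ a * r" "\<not> q dvd r"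
      using multiplicity_decompose'[of "card C" q] C0 by (metis neq0_conv)
    interpret GC: group ?GC by (rule MC.is_group)
    obtain P where P: "subgroup P ?GC" "card P = q ^ a"
      using sylow_thm[OF q(1) MC.is_group, of a r] r(1) MC.fin by (auto simp: Coset.order_def)
    have PC: "P \<subseteq> C" using subgroup.subset[OF P(1)] by simp
    have PG: "subgroup P G" using incl_subgroup[OF subgroup_C P(1)] .
    have PMN: "P \<inter> M \<subseteq> N"
    proof
      fix y assume y: "y \<in> P \<inter> M"
      have "y [^] card P = \<one>"
      proof -
        interpret PP: finite_group "G\<lparr>carrier := P\<rparr>" by (rule subgroup_finite_group[OF PG])
        show ?thesis using PP.pow_order_eq_1[of y] y by (simp add: Coset.order_def nat_pow_subgroup)
      qed
      then have 1: "\<mu> y ^ (q ^ a) = 1" using \<mu>_pow_elem(2)[of y "card P"] y P(2) by (simp add: \<mu>_one)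
      have "coprime (q ^ a) p" using qp by simp
      then have "\<mu> y = 1"
        using root_of_unity_coprime[OF \<mu>_pow 1] y prime_gt_0_nat[OF q(1)] by simp
      then show "y \<in> N" using \<mu>_ker[of y] y by simp
    qed
    have S: "subgroup (M <#> P) G" by (rule mult_norm_subgroup[OF M_normal PG])
    have "M <#> P \<subseteq> C"
      unfolding set_mult_def using M_subset_C PC subgroup.m_closed[OF subgroup_C] by blast
    then have "subgroup (M <#> P) ?GC" by (rule subgroup_incl[OF S subgroup_C])
    from MC.card_subgroup_dvd[OF this] obtain j where j: "card C = card (M <#> P) * j" by auto
    have "P \<subseteq> M <#> P"
    proof
      fix y assume y: "y \<in> P"
      then have "y = \<one> \<otimes> y" using subgroup.subset[OF PG] by auto
      then show "y \<in> M <#> P" unfolding set_mult_def using y subgroup.one_closed[OF M.subgroup_N] by blast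
    qed
    then have "subgroup P (G\<lparr>carrier := M <#> P\<rparr>)" by (rule subgroup_incl[OF PG S])
    from finite_group.card_subgroup_dvd[OF subgroup_finite_group[OF S] this]
    obtain l where l: "card (M <#> P) = q ^ a * l" by (auto simp: P(2))
    \<comment> \<open>\<open>P\<close> carries the full power of \<open>q\<close> in \<open>|C|\<close>, which leaves none for the index \<open>j\<close> of \<open>M P\<close>.\<close>
    have "r = l * j" using r(1) j l prime_gt_0_nat[OF q(1)] by (simp add: mult.assoc)
    then have qj: "\<not> q dvd j" using r(2) by auto
    have S0: "card (M <#> P) > 0" by (rule card_subgroup_pos[OF S])
    have "f * card (M <#> P) dvd card C * b"
      unfolding f_def b_def by (rule twisted_induction_degree[OF inv PG PC PMN \<beta> uniq1])
    then have "card (M <#> P) * f dvd card (M <#> P) * (j * b)" unfolding j by (simp only: mult_ac)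
    then have "f dvd j * b" using S0 by simp
    then have "f\<^sup>2 dvd (j * b)\<^sup>2" by (simp add: dvd_power_same)
    then have "b\<^sup>2 * k dvd b\<^sup>2 * j\<^sup>2" unfolding fkb power_mult_distrib by (simp only: mult_ac)
    then have "k dvd j\<^sup>2" using b0 by simp
    then have "q dvd j\<^sup>2" using q(2) dvd_trans by blast
    then show False using qj prime_dvd_power[OF q(1)] by blast
  qed
  have "char_orbit C \<beta> = {\<beta>}"
    using k1 C.self_in_char_orbit[OF \<beta>I(1)] unfolding k_def by (metis card_1_singletonE singletonD)
  then have "g \<in> stabilizer C \<beta>" if "g \<in> carrier G" for g
    using that C.stabilizer_iff[OF \<beta>I(1), of g] by (auto simp: char_orbit_def)
  then have inv\<beta>: "invariant_character G C \<beta>" by (auto simp: invariant_character_def stabilizer_def)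
  have "m = 1"
    unfolding m_def by (rule C.cyclic_quotient_multiplicity_one[OF t gen_t \<beta>I(1) inv\<beta> \<chi>\<^sub>0\<beta>])
  \<comment> \<open>Now \<open>m = k = 1\<close>, so that \<open>m e = d b\<close> reads \<open>b = d b\<close>.\<close>
  then have "e = b" using emkb k1 by simp
  then have d1: "d = 1" using me \<open>m = 1\<close> b0 by simp
  then have "e = f" using ef by simp
  then have "degree_nat G \<chi>\<^sub>1 = degree_nat G \<chi>\<^sub>0"
    using \<chi>\<^sub>1(2) C0 unfolding d(1) d1 d\<psi> d\<chi>\<^sub>0 by simp
  moreover have "\<chi>\<^sub>0 \<in> Irr_above G N \<theta>" "\<chi>\<^sub>1 \<in> Irr_above G N \<theta>"
    using above_\<eta>_above_\<theta>[of 0] above_\<eta>_above_\<theta>[of 1] \<chi>\<^sub>0 \<chi>\<^sub>1(1) by (auto simp: tw_0)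
  ultimately have eq: "\<chi>\<^sub>1 = \<chi>\<^sub>0" using inj_onD[OF inj] by blast
  \<comment> \<open>This contradicts the invariance of \<open>\<eta>\<close>: the only constituent of \<open>\<chi>\<^sub>0\<close> on \<open>M\<close> is \<open>\<eta>\<close>.\<close>
  have "\<chi>\<^sub>1 \<in> Irr_above G M (tw 1)" using \<chi>\<^sub>1(1) by simp
  then have pos: "char_multiplicity GM \<chi>\<^sub>0 (tw 1) > 0"
    unfolding eq Irr_above_eq[OF M.subgroup_N tw_Irr] by simp
  have pos0: "char_multiplicity GM \<chi>\<^sub>0 \<eta> > 0"
    using \<chi>\<^sub>0 unfolding Irr_above_eq[OF M.subgroup_N \<eta>_Irr] by simp
  have st: "conj_char M g \<phi> \<in> {\<eta>}" if "g \<in> carrier G" "\<phi> \<in> {\<eta>}" for g \<phi>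
    using that M.invariant_orbit[OF \<eta>_Irr inv] by (auto simp: char_orbit_def)
  have "tw 1 \<in> {\<eta>}"
    by (rule M.constituents_in_stable_set[OF _ st \<chi>\<^sub>0I _ pos0 tw_Irr pos]) (use \<eta>_Irr in auto)
  then have "tw 1 = tw 0" by (simp add: tw_0)
  then have "[1 = 0] (mod p)" unfolding tw_eq_iff .
  then show False using p_gt_1 by (simp add: cong_def)
qed

end

section \<open>Supersolvable quotients\<close>

text \<open>
  Both applications of the induction hypothesis replace \<open>(G, N, \<theta>)\<close> by \<open>(T, M, \<phi>)\<close>, where \<open>T \<ge> M\<close> stabilizes
  the extension \<open>\<phi>\<close> of \<open>\<theta>\<close>; the series is inherited by \<open>T\<close>, and \<open>|T| - |M| < |G| - |N|\<close>.
\<close>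

lemma unique_above:
  assumes "finite_group_normal G N" and "prime_series G N" and "\<theta> \<in> Irr (G\<lparr>carrier := N\<rparr>)"
    and "invariant_character G N \<theta>" and "inj_on (degree_nat G) (Irr_above G N \<theta>)"
  shows "\<exists>\<chi>. Irr_above G N \<theta> = {\<chi>}"
  using assms
proof (induction "card (carrier G) - card N" arbitrary: G N \<theta> rule: less_induct)
  case less
  interpret N: finite_group_normal G N by (rule less.prems(1))
  note \<theta> = less.prems(3) and inj = less.prems(5)
  from less.prems(2) show ?case
  proof cases
    case top
    then have G: "G\<lparr>carrier := N\<rparr> = G" by simp
    have "\<theta> \<in> Irr G" using \<theta> unfolding G .
    then have "Irr_above G N \<theta> = {\<theta>}"
      unfolding N.Irr_above_eq[OF N.subgroup_N \<theta>] unfolding G by (auto simp: N.multiplicity_Irr split: if_splits)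
    then show ?thesis by blast
  next
    case (step M p)
    let ?GM = "G\<lparr>carrier := M\<rparr>"
    interpret M: finite_group_normal G M by (rule N.finite_group_normalI[OF step(2)])
    interpret MN: finite_group_normal ?GM N by (rule N.normal_in_intermediate[OF M.subgroup_N step(4)])
    have \<theta>': "\<theta> \<in> Irr (?GM\<lparr>carrier := N\<rparr>)" using \<theta> by simp
    obtain \<eta> where \<eta>: "\<eta> \<in> Irr_above ?GM N \<theta>" using MN.Irr_above_nonempty[OF MN.subgroup_N \<theta>'] by blast
    have "card (carrier ?GM) = p * card N" using step(6) by simp
    from MN.prime_index_linear_char[OF step(5) this]
    obtain x \<mu> where x: "x \<in> M" "\<forall>g\<in>M. \<exists>(i::nat) y. y \<in> N \<and> g = x [^]\<^bsub>G\<^esub> i \<otimes>\<^bsub>G\<^esub> y"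
      and \<mu>: "linear_char ?GM \<mu>" "\<forall>g\<in>M. \<mu> g = 1 \<longleftrightarrow> g \<in> N" "\<forall>g\<in>M. \<mu> g ^ p = 1"
      by (auto simp: nat_pow_subgroup)
    have prime_step: "prime_step G N M p \<theta> \<phi> \<mu> x" if "\<phi> \<in> Irr_above ?GM N \<theta>" for \<phi>
      by (intro prime_step.intro prime_step_axioms.intro N.finite_group_axioms)
        (use step x \<mu> \<theta> less.prems(4) N.normal that in auto)
    interpret P: prime_step G N M p \<theta> \<eta> \<mu> x by (rule prime_step[OF \<eta>])
    have IH: "\<exists>\<chi>. Irr_above (G\<lparr>carrier := T\<rparr>) M \<phi> = {\<chi>}"
      if T: "subgroup T G" "M \<subseteq> T" "T \<subseteq> N.stabilizer M \<phi>" and \<phi>: "\<phi> \<in> Irr ?GM"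
        and d: "inj_on (degree_nat G) (Irr_above (G\<lparr>carrier := T\<rparr>) M \<phi>)" for T \<phi>
    proof (rule less.hyps)
      have "card N < card M" using step(5,6) N.card_subgroup_pos[OF N.subgroup_N] prime_gt_1_nat[of p] by simp
      moreover have "card M \<le> card T" using T(2) by (intro card_mono finite_subset[OF subgroup.subset[OF T(1)] N.fin])
      moreover have "card T \<le> card (carrier G)" by (rule card_mono[OF N.fin subgroup.subset[OF T(1)]])
      ultimately show "card (carrier (G\<lparr>carrier := T\<rparr>)) - card M < card (carrier G) - card N" by simp
      show "finite_group_normal (G\<lparr>carrier := T\<rparr>) M" by (rule M.normal_in_intermediate[OF T(1,2)])
      have "M \<inter> T = M" using T(2) by blast
      then show "prime_series (G\<lparr>carrier := T\<rparr>) M" using N.prime_series_subgroup[OF step(1) T(1)] by simp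
      show "\<phi> \<in> Irr (G\<lparr>carrier := T\<rparr>\<lparr>carrier := M\<rparr>)" using \<phi> by simp
      show "invariant_character (G\<lparr>carrier := T\<rparr>) M \<phi>" by (rule P.invariant_in_subgroup[OF T])
      show "inj_on (degree_nat (G\<lparr>carrier := T\<rparr>)) (Irr_above (G\<lparr>carrier := T\<rparr>) M \<phi>)" using d by simp
    qed
    show ?thesis
    proof (cases "\<exists>c\<in>P.C. N.conj_char M c \<eta> \<noteq> \<eta>")
      case True
      then have eq: "Irr_above G N \<theta> = Irr_above G M \<eta>" using P.transitive_above by blast
      let ?T = "N.stabilizer M \<eta>"
      have "inj_on (degree_nat G) (Irr_above (G\<lparr>carrier := ?T\<rparr>) M \<eta>)"
        by (rule M.Clifford_distinct_degrees[OF P.\<eta>_Irr refl]) (use inj eq in simp)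
      then obtain \<psi> where "Irr_above (G\<lparr>carrier := ?T\<rparr>) M \<eta> = {\<psi>}"
        using IH[OF M.stabilizer_subgroup[OF P.\<eta>_Irr] M.N_subset_stabilizer[OF P.\<eta>_Irr] order_refl P.\<eta>_Irr] by blast
      from M.Clifford_unique[OF P.\<eta>_Irr refl this] show ?thesis unfolding eq by blast
    next
      case False
      then obtain i where inv: "invariant_character G M (P.tw i)" using P.exists_invariant_extension by blast
      \<comment> \<open>The invariant extension becomes the base point, so that \<open>E.tw 1\<close> is \<open>\<mu>\<close> times it.\<close>
      interpret E: prime_step G N M p \<theta> "P.tw i" \<mu> x by (rule prime_step[OF P.tw_above])
      have sub: "inj_on (degree_nat G) (Irr_above G M (E.tw j))" for j
        by (rule inj_on_subset[OF inj E.above_\<eta>_above_\<theta>])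
      have stab: "carrier G \<subseteq> N.stabilizer M (P.tw i)"
        using inv by (auto simp: N.stabilizer_def invariant_character_def)
      have G: "G\<lparr>carrier := carrier G\<rparr> = G" by simp
      obtain \<chi>\<^sub>0 where "Irr_above G M (P.tw i) = {\<chi>\<^sub>0}"
        using IH[OF N.subgroup_self M.N_subset stab P.tw_Irr] sub[of 0] unfolding G E.tw_0 by blast
      moreover obtain \<psi> where "Irr_above (G\<lparr>carrier := E.C\<rparr>) M (E.tw 1) = {\<psi>}"
        using IH[OF E.subgroup_C E.M_subset_C _ E.tw_Irr]
          M.Clifford_distinct_degrees[OF E.tw_Irr E.stabilizer_tw1[OF inv, symmetric] sub]
          E.stabilizer_tw1[OF inv] by blast
      ultimately have False by (rule E.no_invariant_extension[OF inj inv])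
      then show ?thesis ..
    qed
  qed
qed

theorem theorem2:
  fixes G :: "('a, 'b) monoid_scheme" and N :: "'a set" and \<theta> :: "'a \<Rightarrow> complex"
  assumes "group G" and "finite (carrier G)"
    and "N \<lhd> G"
    and "\<theta> \<in> Irr (G\<lparr>carrier := N\<rparr>)"
    and "invariant_character G N \<theta>"
    and "inj_on (char_degree G) (Irr_above G N \<theta>)"
    and "supersolvable (G Mod N)"
  shows "fully_ramified G N \<theta>"
proof -
  interpret finite_group_normal G N
    using assms(1-3) by (simp add: finite_group_normal_def finite_group_normal_axioms_def
      finite_group_def finite_group_axioms_def)
  have "inj_on (degree_nat G) (Irr_above G N \<theta>)"
  proof (rule inj_onI)
    fix \<chi> \<psi> assume \<chi>: "\<chi> \<in> Irr_above G N \<theta>" and \<psi>: "\<psi> \<in> Irr_above G N \<theta>" and eq: "degree_nat G \<chi> = degree_nat G \<psi>"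
    have "\<chi> \<in> characters G" "\<psi> \<in> characters G"
      using \<chi> \<psi> Irr_subset_characters[of G] by (auto simp: Irr_above_def)
    then have "char_degree G \<chi> = char_degree G \<psi>"
      using of_nat_degree[of \<chi>] of_nat_degree[of \<psi>] eq by (simp add: char_degree_def)
    then show "\<chi> = \<psi>" using inj_onD[OF assms(6)] \<chi> \<psi> by blast
  qed
  then obtain \<chi> where "Irr_above G N \<theta> = {\<chi>}"
    using unique_above[OF finite_group_normal_axioms supersolvable_prime_series[OF assms(3,7)] assms(4,5)] by blast
  then show ?thesis using assms(4,5) unfolding fully_ramified_def by auto
qed

end
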